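(* Let $V=\mathbb F_2^{10}$ with standard basis $e_1,\ldots,e_{10}$, let $W=\langle e_1,e_2,e_3\rangle$, $X=\langle e_4,\ldots,e_{10}\rangle$, $H=\langle e_4,\ldots,e_9\rangle$, and let $M$ be the binary matroid with one column for each vector in $$E=(V\setminus\{0\})\setminus\bigl((W\setminus\{0\})\cup(X\setminus H)\bigr).$$ Then $M$ is simple of rank $10$, has $952$ elements, and $$Q_M(t)=30307166191616+4194859712512\,t+609014784\,t^2+89280\,t^3.$$ Writing $Q_M(t)=\sum_jc_jt^j$, one has $$\Delta_2(M)=c_2^2-c_1c_3=-3618068002504704<0.$$
   Context: Matroid polynomials: for a loopless matroid $M$ of rank $r$, let $L(M)$ be its lattice of flats, $M|F$ the restriction to a flat $F$, $M/F$ the contraction, $\mu$ the Möbius function of $L(M)$, and $\chi_M(t)=\sum_{F\in L(M)}\mu(\varnothing,F)t^{r-\operatorname{rk}F}$. The Kazhdan–Lusztig polynomial $P_M$ is determined by: $P_M=1$ if $r=0$; $\deg P_M<r/2$ if $r>0$; and $t^rP_M(t^{-1})=\sum_{F\in L(M)}\chi_{M|F}(t)P_{M/F}(t)$. The (ordinary, unnormalized) inverse Kazhdan–Lusztig polynomial $Q_M$ is determined by $Q_M=1$ if $r=0$, and for $r>0$, $$Q_M=\sum_{\varnothing\ne F\in L(M)}(-1)^{\operatorname{rk}F+1}P_{M|F}\,Q_{M/F}.$$ *)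

theory Defs
  imports "HOL-Analysis.Analysis" "HOL-Library.Z2" "HOL-Library.Numeral_Type"
    "HOL-Computational_Algebra.Polynomial"
begin

section \<open>Finite matroids\<close>

definition is_matroid :: "'a set \<Rightarrow> 'a set set \<Rightarrow> bool" where
  "is_matroid E \<I> \<longleftrightarrow>
     finite E \<and> (\<forall>I\<in>\<I>. I \<subseteq> E) \<and> {} \<in> \<I> \<and>
     (\<forall>I\<in>\<I>. \<forall>J. J \<subseteq> I \<longrightarrow> J \<in> \<I>) \<and>
     (\<forall>I\<in>\<I>. \<forall>J\<in>\<I>. card I < card J \<longrightarrow> (\<exists>x\<in>J - I. insert x I \<in> \<I>))"

lemma is_matroidI:
  assumes "finite E"
    and "\<And>I. I \<in> \<I> \<Longrightarrow> I \<subseteq> E"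
    and "{} \<in> \<I>"
    and "\<And>I J. I \<in> \<I> \<Longrightarrow> J \<subseteq> I \<Longrightarrow> J \<in> \<I>"
    and "\<And>I J. I \<in> \<I> \<Longrightarrow> J \<in> \<I> \<Longrightarrow> card I < card J \<Longrightarrow> \<exists>x\<in>J - I. insert x I \<in> \<I>"
  shows "is_matroid E \<I>"
  using assms unfolding is_matroid_def by blast

typedef 'a matroid = "{(E :: 'a set, \<I> :: 'a set set). is_matroid E \<I>}"
proof
  show "({}, {{}}) \<in> {(E :: 'a set, \<I> :: 'a set set). is_matroid E \<I>}"
    by (simp add: is_matroid_def)
qed

setup_lifting type_definition_matroid

lift_definition ground :: "'a matroid \<Rightarrow> 'a set" is fst .

lift_definition indep :: "'a matroid \<Rightarrow> 'a set \<Rightarrow> bool" is "\<lambda>M I. I \<in> snd M" .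

lemma is_matroid_ground_indep: "is_matroid (ground M) {I. indep M I}"
  by transfer auto

lemma finite_ground: "finite (ground M)"
  using is_matroid_ground_indep[of M] by (simp add: is_matroid_def)

lemma indep_subset_ground: "indep M I \<Longrightarrow> I \<subseteq> ground M"
  using is_matroid_ground_indep[of M] by (simp add: is_matroid_def)

lemma finite_indep: "indep M I \<Longrightarrow> finite I"
  using finite_ground finite_subset indep_subset_ground by metis

lemma indep_empty: "indep M {}"
  using is_matroid_ground_indep[of M] by (simp add: is_matroid_def)

lemma indep_subset: "indep M I \<Longrightarrow> J \<subseteq> I \<Longrightarrow> indep M J"
  using is_matroid_ground_indep[of M] unfolding is_matroid_def by blast

lemma indep_augment:
  "indep M I \<Longrightarrow> indep M J \<Longrightarrow> card I < card J \<Longrightarrow> \<exists>x\<in>J - I. indep M (insert x I)"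
  using is_matroid_ground_indep[of M] unfolding is_matroid_def by blast

definition rk :: "'a matroid \<Rightarrow> 'a set \<Rightarrow> nat" where
  "rk M A = Max (card ` {I. indep M I \<and> I \<subseteq> A})"

definition mrank :: "'a matroid \<Rightarrow> nat" where
  "mrank M = rk M (ground M)"

definition loopless :: "'a matroid \<Rightarrow> bool" where
  "loopless M \<longleftrightarrow> (\<forall>x\<in>ground M. indep M {x})"

definition simple :: "'a matroid \<Rightarrow> bool" where
  "simple M \<longleftrightarrow> loopless M \<and> (\<forall>x\<in>ground M. \<forall>y\<in>ground M. x \<noteq> y \<longrightarrow> indep M {x, y})"

text \<open>The lattice of flats \<open>L(M)\<close>, ordered by inclusion.\<close>

definition flats :: "'a matroid \<Rightarrow> 'a set set" where
  "flats M = {F. F \<subseteq> ground M \<and> (\<forall>x\<in>ground M - F. rk M F < rk M (insert x F))}"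

definition basis_of :: "'a matroid \<Rightarrow> 'a set \<Rightarrow> 'a set \<Rightarrow> bool" where
  "basis_of M A B \<longleftrightarrow>
     indep M B \<and> B \<subseteq> A \<and> (\<forall>x\<in>A - B. \<not> indep M (insert x B))"

lemma ex_basis_of: "\<exists>B. basis_of M A B"
proof -
  have fin: "finite {I. indep M I \<and> I \<subseteq> A}"
    by (rule finite_subset[of _ "Pow (ground M)"])
       (auto simp: finite_ground dest: indep_subset_ground)
  have "{I. indep M I \<and> I \<subseteq> A} \<noteq> {}"
    using indep_empty[of M] by blast
  from finite_has_maximal[OF fin this] obtain B where
    B: "indep M B" "B \<subseteq> A" "\<forall>C\<in>{I. indep M I \<and> I \<subseteq> A}. B \<subseteq> C \<longrightarrow> B = C"
    by auto
  have "\<not> indep M (insert x B)" if "x \<in> A - B" for x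
    using B that by blast
  with B show ?thesis
    unfolding basis_of_def by blast
qed

lemma basis_of_exchange:
  assumes B: "basis_of M F B" and B': "basis_of M F B'"
    and J: "J \<inter> F = {}" "indep M (J \<union> B)"
  shows "indep M (J \<union> B')"
proof -
  let ?S = "{I. indep M I \<and> B' \<subseteq> I \<and> I \<subseteq> J \<union> B \<union> B'}"
  have fin: "finite ?S"
    by (rule finite_subset[of _ "Pow (ground M)"])
       (auto simp: finite_ground dest: indep_subset_ground)
  have "B' \<in> ?S"
    using B' by (auto simp: basis_of_def)
  then have "?S \<noteq> {}"
    by (metis empty_iff)
  from finite_has_maximal[OF fin this] obtain C where
    C: "C \<in> ?S" and max: "\<forall>D\<in>?S. C \<subseteq> D \<longrightarrow> C = D"
    by (rule bexE)
  have finJB: "finite (J \<union> B)" and finC: "finite C"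
    using J C by (auto dest: finite_indep)
  have card_le: "card I \<le> card K"
    if "basis_of M F K" "indep M I" "I \<subseteq> F" for I K
  proof (rule ccontr)
    assume "\<not> card I \<le> card K"
    with that obtain x where "x \<in> I - K" "indep M (insert x K)"
      using indep_augment[of M K I] by (auto simp: basis_of_def)
    with that show False
      by (auto simp: basis_of_def)
  qed
  have "card B' \<le> card B"
    using card_le[OF B, of B'] B' by (auto simp: basis_of_def)
  have "\<not> card C < card (J \<union> B)"
  proof
    assume "card C < card (J \<union> B)"
    then obtain x where "x \<in> (J \<union> B) - C" "indep M (insert x C)"
      using indep_augment[of M C "J \<union> B"] C J by auto
    then have "insert x C \<in> ?S"
      using C by auto
    with max \<open>x \<in> (J \<union> B) - C\<close> show False
      by blast
  qed
  moreover have CF: "C \<subseteq> J \<union> B'"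
  proof
    fix x assume x: "x \<in> C"
    show "x \<in> J \<union> B'"
    proof (rule ccontr)
      assume "x \<notin> J \<union> B'"
      with x C B have "x \<in> F - B'" "insert x B' \<subseteq> C"
        by (auto simp: basis_of_def)
      with C B' show False
        using indep_subset[of M C "insert x B'"] by (auto simp: basis_of_def)
    qed
  qed
  have finJ: "finite J" and finB: "finite B"
    using finJB by auto
  have finB': "finite B'"
    using B' finite_indep by (auto simp: basis_of_def)
  have "J \<inter> B = {}" "J \<inter> B' = {}"
    using J B B' by (auto simp: basis_of_def)
  then have "card (J \<union> B) = card J + card B" "card (J \<union> B') = card J + card B'"
    using finJ finB finB' by (simp_all add: card_Un_disjoint)
  with calculation \<open>card B' \<le> card B\<close> have "card (J \<union> B') \<le> card C"
    by linarith
  then have "C = J \<union> B'"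
    using CF finJ finB' by (simp add: card_seteq)
  with C show ?thesis
    by simp
qed

lemma is_matroid_restr: "is_matroid (ground M \<inter> A) {I. indep M I \<and> I \<subseteq> A}"
proof (rule is_matroidI)
  fix I J
  assume IJ: "I \<in> {I. indep M I \<and> I \<subseteq> A}" "J \<in> {I. indep M I \<and> I \<subseteq> A}" "card I < card J"
  then obtain x where "x \<in> J - I" "indep M (insert x I)"
    using indep_augment by blast
  with IJ show "\<exists>x\<in>J - I. insert x I \<in> {I. indep M I \<and> I \<subseteq> A}"
    by blast
next
  show "\<And>I. I \<in> {I. indep M I \<and> I \<subseteq> A} \<Longrightarrow> I \<subseteq> ground M \<inter> A"
    using indep_subset_ground by blast
  show "\<And>I J. I \<in> {I. indep M I \<and> I \<subseteq> A} \<Longrightarrow> J \<subseteq> I \<Longrightarrow> J \<in> {I. indep M I \<and> I \<subseteq> A}"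
    using indep_subset by blast
qed (simp_all add: finite_ground indep_empty)

text \<open>The restriction \<open>M|A\<close>; elements of \<open>A\<close> outside the ground set are ignored.\<close>

lift_definition restr :: "'a matroid \<Rightarrow> 'a set \<Rightarrow> 'a matroid"
  is "\<lambda>M A. (ground M \<inter> A, {I. indep M I \<and> I \<subseteq> A})"
  by (simp add: is_matroid_restr)

lemma is_matroid_contr:
  "is_matroid (ground M - A) {J. J \<subseteq> ground M - A \<and> (\<exists>B. basis_of M A B \<and> indep M (J \<union> B))}"
  (is "is_matroid _ ?I")
proof -
  have empty: "{} \<in> ?I"
    using ex_basis_of[of M A] by (auto simp: basis_of_def)
  have sub: "K \<in> ?I" if "J \<in> ?I" "K \<subseteq> J" for J K
  proof -
    from that obtain B where "basis_of M A B" "indep M (J \<union> B)" by auto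
    moreover have "indep M (K \<union> B)"
      by (rule indep_subset[OF \<open>indep M (J \<union> B)\<close>]) (use that in auto)
    ultimately show ?thesis using that by blast
  qed
  have aug: "\<exists>x\<in>K - J. insert x J \<in> ?I" if "J \<in> ?I" "K \<in> ?I" "card J < card K" for J K
  proof -
    from that obtain B where B: "basis_of M A B" "indep M (J \<union> B)" by auto
    from that obtain B' where B': "basis_of M A B'" "indep M (K \<union> B')" by auto
    have K: "indep M (K \<union> B)"
      by (rule basis_of_exchange[OF B'(1) B(1) _ B'(2)]) (use that in auto)
    have fin: "finite (J \<union> B)" "finite (K \<union> B)"
      using B(2) K finite_indep by blast+
    have "J \<inter> B = {}" "K \<inter> B = {}"
      using B that by (auto simp: basis_of_def)
    then have "card (J \<union> B) < card (K \<union> B)"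
      using fin that(3) by (simp add: card_Un_disjoint)
    then obtain x where x: "x \<in> (K \<union> B) - (J \<union> B)" "indep M (insert x (J \<union> B))"
      using indep_augment B(2) K by metis
    then have "x \<in> K - J" "insert x J \<subseteq> ground M - A" "indep M (insert x J \<union> B)"
      using that by auto
    then show ?thesis
      using B(1) by blast
  qed
  show ?thesis
  proof (rule is_matroidI)
    show "finite (ground M - A)"
      by (simp add: finite_ground)
    show "\<And>I. I \<in> ?I \<Longrightarrow> I \<subseteq> ground M - A"
      by simp
  qed (fact empty sub aug)+
qed

text \<open>
  The contraction \<open>M/A\<close>: a set \<open>J\<close> disjoint from \<open>A\<close> is independent in \<open>M/A\<close> iff \<open>J \<union> B\<close> is
  independent in \<open>M\<close> for some, equivalently every, basis \<open>B\<close> of \<open>A\<close>.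
\<close>

lift_definition contr :: "'a matroid \<Rightarrow> 'a set \<Rightarrow> 'a matroid"
  is "\<lambda>M A. (ground M - A, {J. J \<subseteq> ground M - A \<and> (\<exists>B. basis_of M A B \<and> indep M (J \<union> B))})"
  by (simp add: is_matroid_contr)

lemma ground_contr: "ground (contr M A) = ground M - A"
  by transfer simp


section \<open>Moebius function and characteristic polynomial\<close>

text \<open>
  The Moebius function of a family \<open>L\<close> of finite sets ordered by inclusion; \<open>finite G\<close> only
  serves termination.
\<close>

function moebius :: "'a set set \<Rightarrow> 'a set \<Rightarrow> 'a set \<Rightarrow> int" where
  "moebius L F G =
     (if F = G then 1
      else if F \<subset> G \<and> finite G then - (\<Sum>H\<in>{H\<in>L. F \<subseteq> H \<and> H \<subset> G}. moebius L F H)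
      else 0)"
  by pat_completeness auto
termination
  by (relation "inv_image less_than (\<lambda>(L, F, G). card G)") (auto intro: psubset_card_mono)

declare moebius.simps [simp del]

definition char_poly :: "'a matroid \<Rightarrow> int poly" where
  "char_poly M = (\<Sum>F\<in>flats M. monom (moebius (flats M) {} F) (mrank M - rk M F))"


section \<open>Kazhdan--Lusztig polynomials\<close>

text \<open>\<open>t\<^sup>r p(t\<^sup>-\<^sup>1)\<close>, for \<open>degree p \<le> r\<close>.\<close>

definition reverse_poly :: "nat \<Rightarrow> int poly \<Rightarrow> int poly" where
  "reverse_poly r p = monom 1 (r - degree p) * reflect_poly p"

text \<open>
  The conditions that determine \<open>M \<mapsto> P\<^sub>M\<close> on loopless matroids. The summand for \<open>F = {}\<close> is
  \<open>P\<^sub>M\<close> itself.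
\<close>

definition KL_family :: "('a matroid \<Rightarrow> int poly) \<Rightarrow> bool" where
  "KL_family P \<longleftrightarrow> (\<forall>M. loopless M \<longrightarrow>
     (mrank M = 0 \<longrightarrow> P M = 1) \<and>
     (mrank M > 0 \<longrightarrow> 2 * degree (P M) < mrank M) \<and>
     reverse_poly (mrank M) (P M) =
       (\<Sum>F\<in>flats M. char_poly (restr M F) * P (contr M F)))"

text \<open>Unspecified if \<open>M\<close> has loops.\<close>

definition KL_poly :: "'a matroid \<Rightarrow> int poly" where
  "KL_poly M = (THE p. \<exists>P. KL_family P \<and> P M = p)"

function inv_KL_poly :: "'a matroid \<Rightarrow> int poly" where
  "inv_KL_poly M =
     (if mrank M = 0 then 1
      else \<Sum>F\<in>flats M - {{}}.
        (-1) ^ (rk M F + 1) * KL_poly (restr M F) * inv_KL_poly (contr M F))"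
  by pat_completeness auto
termination
proof (relation "inv_image less_than (\<lambda>M. card (ground M))")
  fix M :: "'a matroid" and F
  assume "F \<in> flats M - {{}}"
  then have "F \<subseteq> ground M" "F \<noteq> {}"
    by (auto simp: flats_def)
  then show "(contr M F, M) \<in> inv_image less_than (\<lambda>M. card (ground M))"
    by (auto simp: ground_contr finite_ground intro!: psubset_card_mono)
qed simp

declare inv_KL_poly.simps [simp del]

definition Delta2 :: "'a matroid \<Rightarrow> int" where
  "Delta2 M = (coeff (inv_KL_poly M) 2)\<^sup>2 - coeff (inv_KL_poly M) 1 * coeff (inv_KL_poly M) 3"


section \<open>Binary matroids\<close>

instance bit :: finite
proof
  have "(UNIV :: bit set) = {0, 1}"
    using bit_not_zero_iff by blast
  then show "finite (UNIV :: bit set)"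
    by (metis finite.emptyI finite.insertI)
qed

lemma is_matroid_vec:
  fixes E :: "(bit ^ 'n) set"
  shows "is_matroid E {I. I \<subseteq> E \<and> vec.independent I}"
proof -
  have aug: "\<exists>x\<in>J - I. vec.independent (insert x I)"
    if "vec.independent I" "vec.independent J" "card I < card J" for I J :: "(bit ^ 'n) set"
  proof -
    have "\<not> J \<subseteq> vec.span I"
      using vec.independent_span_bound[of I J] that by auto
    then obtain x where "x \<in> J" "x \<notin> vec.span I" by blast
    then show ?thesis
      using that(1) vec.span_base[of x I] vec.independent_insert[of x I] by (metis DiffI)
  qed
  show ?thesis
  proof (rule is_matroidI)
    fix I J
    assume IJ: "I \<in> {I. I \<subseteq> E \<and> vec.independent I}" "J \<in> {I. I \<subseteq> E \<and> vec.independent I}"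
      "card I < card J"
    then obtain x where "x \<in> J - I" "vec.independent (insert x I)"
      using aug by blast
    with IJ show "\<exists>x\<in>J - I. insert x I \<in> {I. I \<subseteq> E \<and> vec.independent I}"
      by blast
  qed (auto simp: vec.independent_empty dest: vec.independent_mono)
qed

text \<open>The matroid on a set of vectors over \<open>\<F>\<^sub>2\<close>, one column for each vector.\<close>

lift_definition binary_matroid :: "(bit ^ 'n) set \<Rightarrow> (bit ^ 'n) matroid"
  is "\<lambda>E. (E, {I. I \<subseteq> E \<and> vec.independent I})"
  by (simp add: is_matroid_vec)

text \<open>
  The standard basis \<open>e\<^sub>1, \<dots>, e\<^sub>1\<^sub>0\<close>. The index type \<open>10\<close> is arithmetic modulo 10, so the index of
  \<open>e\<^sub>1\<^sub>0\<close> is \<open>0\<close>.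
\<close>

definition std_vec :: "nat \<Rightarrow> bit ^ 10" where
  "std_vec i = axis (of_nat i) 1"

end

theory Submission
  imports Defs
begin

text \<open>
  Put \<open>Z(M) = (\<Sum>F. t^rk F * P(M/F))\<close>. Moebius inversion turns the defining identity of the
  Kazhdan--Lusztig polynomials into the palindromicity of \<open>Z\<close>, and this determines \<open>P(M)\<close> from the
  proper contractions because \<open>deg P(M) < r/2\<close>; existence and uniqueness follow.

  The flats of \<open>M\<close> are the subspaces of \<open>V\<close> spanned by their points of \<open>E\<close>. A subspace fails to be
  spanned only if it is a nonzero subspace of \<open>W\<close>, a subspace of \<open>X\<close> outside \<open>H\<close>, or of the form
  \<open>{0, w, x, w + x}\<close> with \<open>w \<in> W\<close> and \<open>x \<in> X - H\<close>. Since the lattice of all subspaces is modular,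
  \<open>P\<close> of an interval \<open>[A, B]\<close> differs from \<open>1\<close> only through these exceptions, and only if \<open>A\<close> is
  \<open>0\<close>, a subspace of \<open>H\<close>, or \<open>{0, w + x}\<close>. Up to sign, \<open>Q\<close> is the inverse of \<open>P\<close> in the incidence
  algebra, so \<open>Q(M)\<close> is the Moebius invariant of \<open>M\<close> plus a correction that is linear in \<open>P - 1\<close>.
  Interchanging summations reduces it to alternating sums of Gaussian binomial coefficients.
\<close>

section \<open>Rank, restriction and contraction\<close>

text \<open>\<open>KL_poly\<close> is a definite description over whole families, so nothing can be
  computed from it directly. The recursion \<open>KL_rec\<close> supplies a family, and
  \<open>KL_poly_contr_eqI\<close> then reduces every computation to guessing polynomials and
  checking a degree bound and a palindromic sum. The guess \<open>p\<close> compares the flats with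
  all subspaces: a missing subspace is compensated at its spanned part.

  The correction is linear because the two ends of an interval separate. If \<open>p A B\<close> is
  nonzero, then \<open>A\<close> is \<open>special\<close> and \<open>B\<close> is not; above a flat
  that is not special no subspace is missing, so there \<open>Q B\<close> is a Moebius value of the
  projective geometry.

  The two deleted pieces have different tasks. \<open>W\<close> alone produces the terms of degree 2
  and 3, through \<open>phi\<close>; all that \<open>X - H\<close> contributes is linear in t. It
  supplies 3839700762624 of the coefficient c_1 = 4194859712512, and this lifts c_1 c_3 above
  c_2^2.\<close>

lemma matroid_eqI:
  assumes "ground M = ground N" "\<And>I. indep M I \<longleftrightarrow> indep N I"
  shows "M = N"
  using assms by transfer (auto simp: prod_eq_iff)

lemma ground_restr: "ground (restr M A) = ground M \<inter> A"
  by transfer simp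

lemma indep_restr: "indep (restr M A) I \<longleftrightarrow> indep M I \<and> I \<subseteq> A"
  by transfer simp

lemma indep_contr:
  "indep (contr M A) J \<longleftrightarrow> J \<subseteq> ground M - A \<and> (\<exists>B. basis_of M A B \<and> indep M (J \<union> B))"
  by (subst indep.rep_eq, subst contr.rep_eq) simp

lemma finite_indep_sets: "finite {I. indep M I \<and> I \<subseteq> A}"
  by (rule finite_subset[of _ "Pow (ground M)"])
     (auto simp: finite_ground dest: indep_subset_ground)

lemma card_le_rk: "indep M I \<Longrightarrow> I \<subseteq> A \<Longrightarrow> card I \<le> rk M A"
  unfolding rk_def by (intro Max_ge) (auto simp: finite_indep_sets)

lemma rk_le:
  assumes "\<And>I. indep M I \<Longrightarrow> I \<subseteq> A \<Longrightarrow> card I \<le> k"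
  shows "rk M A \<le> k"
proof -
  have "{I. indep M I \<and> I \<subseteq> A} \<noteq> {}"
    using indep_empty[of M] by blast
  with assms show ?thesis
    unfolding rk_def by (subst Max_le_iff) (auto simp: finite_indep_sets)
qed

lemma rk_mono: "A \<subseteq> B \<Longrightarrow> rk M A \<le> rk M B"
  by (rule rk_le) (auto intro: card_le_rk)

lemma basis_of_extend:
  assumes "indep M I" "I \<subseteq> A"
  obtains B where "basis_of M A B" "I \<subseteq> B"
proof -
  have "I \<in> {I. indep M I \<and> I \<subseteq> A}"
    using assms by simp
  from finite_has_maximal2[OF finite_indep_sets this] obtain B where
    B: "indep M B" "B \<subseteq> A" "I \<subseteq> B" "\<forall>C\<in>{I. indep M I \<and> I \<subseteq> A}. B \<subseteq> C \<longrightarrow> B = C"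
    by auto
  then have "basis_of M A B"
    unfolding basis_of_def by blast
  with B(3) show thesis by (rule that[rotated])
qed

lemma card_basis_of:
  assumes "basis_of M A B"
  shows "card B = rk M A"
proof (rule antisym)
  show "card B \<le> rk M A"
    using assms by (auto simp: basis_of_def intro: card_le_rk)
  show "rk M A \<le> card B"
  proof (rule rk_le)
    fix I assume "indep M I" "I \<subseteq> A"
    then show "card I \<le> card B"
      using assms indep_augment[of M B I] unfolding basis_of_def
      by (metis Diff_iff in_mono not_le)
  qed
qed

lemma rk_indep: "indep M I \<Longrightarrow> rk M I = card I"
  by (rule card_basis_of[symmetric]) (auto simp: basis_of_def)

lemma rk_empty [simp]: "rk M {} = 0"
  using rk_indep[OF indep_empty] by simp

lemma rk_restr: "A \<subseteq> F \<Longrightarrow> rk (restr M F) A = rk M A"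
  unfolding rk_def indep_restr by (rule arg_cong[where f = "\<lambda>S. Max (card ` S)"]) auto

lemma mrank_restr: "F \<subseteq> ground M \<Longrightarrow> mrank (restr M F) = rk M F"
  by (simp add: mrank_def ground_restr rk_restr Int_absorb1)

lemma basis_of_restr: "A \<subseteq> F \<Longrightarrow> basis_of (restr M F) A = basis_of M A"
  unfolding basis_of_def indep_restr fun_eq_iff by blast

lemma basis_of_Int:
  assumes B: "basis_of M F B" and C: "B \<subseteq> C" "indep M C"
  shows "C \<inter> F = B"
proof (rule ccontr)
  have "B \<subseteq> F" using B by (simp add: basis_of_def)
  moreover assume "C \<inter> F \<noteq> B"
  ultimately obtain x where x: "x \<in> F - B" "x \<in> C" using C by auto
  then have "indep M (insert x B)"
    using C by (intro indep_subset[OF C(2)]) simp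
  with x B show False by (simp add: basis_of_def)
qed

text \<open>\<open>basis_of_exchange\<close> lets the existentially quantified basis in
  \<open>contr\<close> be any prescribed one. Later proofs choose it inside a larger basis.\<close>

lemma indep_contr_basis:
  assumes "basis_of M A B"
  shows "indep (contr M A) J \<longleftrightarrow> J \<subseteq> ground M - A \<and> indep M (J \<union> B)"
proof
  assume J: "indep (contr M A) J"
  then obtain C where C: "basis_of M A C" "indep M (J \<union> C)" "J \<subseteq> ground M - A"
    unfolding indep_contr by auto
  then have "indep M (J \<union> B)"
    by (intro basis_of_exchange[OF C(1) assms]) auto
  with C show "J \<subseteq> ground M - A \<and> indep M (J \<union> B)" by simp
next
  assume "J \<subseteq> ground M - A \<and> indep M (J \<union> B)"
  with assms show "indep (contr M A) J"
    unfolding indep_contr by (intro conjI exI[of _ B]) simp_all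
qed

text \<open>A basis \<open>B\<close> of \<open>F\<close> extends to a basis \<open>C\<close> of
  \<open>A \<union> F\<close>. Maximality of \<open>B\<close> gives \<open>C \<inter> F = B\<close>,
  so \<open>C - B\<close> lies in \<open>A\<close> and realises the rank in the contraction.\<close>

lemma rk_contr:
  assumes "A \<subseteq> ground M - F" "F \<subseteq> ground M"
  shows "rk (contr M F) A = rk M (A \<union> F) - rk M F"
proof -
  obtain B where B: "basis_of M F B" using ex_basis_of by blast
  then have BF: "B \<subseteq> F" "indep M B" by (auto simp: basis_of_def)
  obtain C where C: "basis_of M (A \<union> F) C" "B \<subseteq> C"
    using basis_of_extend[of M B "A \<union> F"] BF by (metis le_supI2)
  have iC: "indep M C" "C \<subseteq> A \<union> F" using C by (auto simp: basis_of_def)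
  have CF: "C \<inter> F = B"
    by (rule basis_of_Int[OF B C(2) iC(1)])
  have fin: "finite C" "finite B" using iC BF finite_indep by blast+
  show ?thesis
  proof (rule antisym)
    show "rk (contr M F) A \<le> rk M (A \<union> F) - rk M F"
    proof (rule rk_le)
      fix I assume I: "indep (contr M F) I" "I \<subseteq> A"
      then have IB: "indep M (I \<union> B)" "I \<inter> B = {}"
        using indep_contr_basis[OF B] BF by auto
      then have "card (I \<union> B) = card I + card B"
        using finite_indep by (metis card_Un_disjoint finite_Un)
      moreover have "card (I \<union> B) \<le> rk M (A \<union> F)"
        using I BF by (intro card_le_rk IB) auto
      ultimately show "card I \<le> rk M (A \<union> F) - rk M F"
        using card_basis_of[OF B] by simp
    qed
  next
    have "C - B \<subseteq> A" using iC CF by blast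
    moreover have "indep (contr M F) (C - B)"
      unfolding indep_contr_basis[OF B] using CF iC C(2) indep_subset_ground[OF iC(1)]
      by (auto simp: Un_absorb2)
    ultimately have "card (C - B) \<le> rk (contr M F) A" by (intro card_le_rk)
    then show "rk M (A \<union> F) - rk M F \<le> rk (contr M F) A"
      using fin C(2) card_basis_of[OF B] card_basis_of[OF C(1)] by (simp add: card_Diff_subset)
  qed
qed

lemma mrank_contr:
  assumes "F \<subseteq> ground M"
  shows "mrank (contr M F) = mrank M - rk M F"
  using rk_contr[OF order.refl assms] assms
  by (simp add: mrank_def ground_contr Un_absorb2)

lemma contr_empty [simp]: "contr M {} = M"
proof (rule matroid_eqI)
  have "basis_of M {} {}" by (simp add: basis_of_def indep_empty)
  then show "indep (contr M {}) I = indep M I" for I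
    using indep_contr_basis indep_subset_ground by fastforce
qed (simp add: ground_contr)

lemma restr_contr:
  assumes "A \<subseteq> B"
  shows "restr (contr M A) (B - A) = contr (restr M B) A"
proof (rule matroid_eqI)
  obtain C where C: "basis_of M A C" using ex_basis_of by blast
  then have "basis_of (restr M B) A C" using assms by (simp add: basis_of_restr)
  moreover have "C \<subseteq> A" using C by (simp add: basis_of_def)
  ultimately show "indep (restr (contr M A) (B - A)) I = indep (contr (restr M B) A) I" for I
    using assms C by (auto simp: indep_restr indep_contr_basis ground_restr)
qed (auto simp: ground_restr ground_contr)

text \<open>For nested bases \<open>B\<close> of \<open>F\<close> and \<open>C\<close> of
  \<open>G\<close>, the set \<open>C - F\<close> is a basis of \<open>G - F\<close> in the first
  contraction, and adding \<open>B\<close> to it gives back \<open>C\<close>. Both sides therefore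
  test the independence of \<open>I \<union> C\<close>.\<close>

lemma contr_contr:
  assumes "F \<subseteq> G" "G \<subseteq> ground M"
  shows "contr (contr M F) (G - F) = contr M G"
proof (rule matroid_eqI)
  obtain B where B: "basis_of M F B" using ex_basis_of by blast
  then have BF: "B \<subseteq> F" "indep M B" by (auto simp: basis_of_def)
  obtain C where C: "basis_of M G C" "B \<subseteq> C"
    using basis_of_extend[of M B G] BF assms by (metis order.trans)
  have iC: "indep M C" "C \<subseteq> G" using C by (auto simp: basis_of_def)
  have CF: "C \<inter> F = B"
    by (rule basis_of_Int[OF B C(2) iC(1)])
  then have un: "(C - F) \<union> B = C" using C by blast
  have "basis_of (contr M F) (G - F) (C - F)"
    unfolding basis_of_def indep_contr_basis[OF B] using un iC C(1) assms
    by (auto simp: basis_of_def insert_is_Un[symmetric])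
  then show "indep (contr (contr M F) (G - F)) I = indep (contr M G) I" for I
    unfolding indep_contr_basis[OF C(1)]
    using un assms iC BF by (auto simp: indep_contr_basis[OF B] indep_contr_basis ground_contr Un_assoc)
qed (use assms in \<open>auto simp: ground_contr\<close>)

section \<open>Flats\<close>

lemma finite_flats: "finite (flats M)"
  by (rule finite_subset[of _ "Pow (ground M)"]) (auto simp: finite_ground flats_def)

lemma flats_subset: "F \<in> flats M \<Longrightarrow> F \<subseteq> ground M"
  by (simp add: flats_def)

lemma rk_le_mrank: "F \<subseteq> ground M \<Longrightarrow> rk M F \<le> mrank M"
  unfolding mrank_def by (rule rk_mono)

lemma rk_psubset_flat:
  assumes "F \<in> flats M" "F \<subset> G" "G \<subseteq> ground M"
  shows "rk M F < rk M G"
proof -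
  from assms obtain x where "x \<in> G - F" by blast
  then have "rk M F < rk M (insert x F)" "insert x F \<subseteq> G"
    using assms by (auto simp: flats_def)
  then show ?thesis using rk_mono[of "insert x F" G M] by simp
qed

lemma indep_insert_flat:
  assumes F: "F \<in> flats M" and B: "basis_of M F B" and x: "x \<in> ground M - F"
  shows "indep M (insert x B)"
proof (rule ccontr)
  assume "\<not> indep M (insert x B)"
  then have "basis_of M (insert x F) B"
    using B by (auto simp: basis_of_def)
  then have "rk M (insert x F) = rk M F"
    using card_basis_of B by metis
  moreover have "rk M F < rk M (insert x F)"
    using F x by (simp add: flats_def)
  ultimately show False by simp
qed

lemma flats_restr:
  assumes F: "F \<in> flats M"
  shows "flats (restr M F) = {G \<in> flats M. G \<subseteq> F}"
proof -
  have Fg: "F \<subseteq> ground M" using F by (rule flats_subset)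
  \<comment> \<open>As \<open>F\<close> is a flat, an element outside \<open>F\<close> raises the
    rank of every subset of \<open>F\<close>. So only elements of \<open>F\<close> decide whether
    \<open>G\<close> is a flat of \<open>M\<close>.\<close>
  have "rk M G < rk M (insert x G)"
    if G: "G \<subseteq> F" and x: "x \<in> ground M - F" for G x
  proof -
    obtain B where B: "basis_of M G B" using ex_basis_of by blast
    then have BG: "B \<subseteq> G" "indep M B" by (auto simp: basis_of_def)
    obtain C where C: "basis_of M F C" "B \<subseteq> C"
      using basis_of_extend[of M B F] BG G by (metis order.trans)
    have "indep M (insert x B)"
      by (rule indep_subset[OF indep_insert_flat[OF F C(1) x]]) (use C in auto)
    then have "card (insert x B) \<le> rk M (insert x G)"
      using BG by (intro card_le_rk) auto
    moreover have "x \<notin> B" using BG G x by blast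
    ultimately show ?thesis
      using card_basis_of[OF B] finite_indep[OF BG(2)] by simp
  qed
  with Fg show ?thesis
    by (auto simp: flats_def ground_restr rk_restr Int_absorb1) (metis DiffI)
qed

lemma flats_contr_iff:
  assumes "F \<subseteq> ground M"
  shows "A \<in> flats (contr M F) \<longleftrightarrow> A \<inter> F = {} \<and> A \<union> F \<in> flats M"
proof (cases "A \<subseteq> ground M - F")
  case True
  have "rk (contr M F) A < rk (contr M F) (insert x A) \<longleftrightarrow> rk M (A \<union> F) < rk M (insert x (A \<union> F))"
    if "x \<in> ground M - (A \<union> F)" for x
  proof -
    have "rk M F \<le> rk M (A \<union> F)" by (rule rk_mono) simp
    moreover have "rk (contr M F) (insert x A) = rk M (insert x (A \<union> F)) - rk M F"
      using rk_contr[of "insert x A" M F] that True assms by auto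
    ultimately show ?thesis
      using rk_contr[OF True assms] by linarith
  qed
  with True assms show ?thesis
    by (auto simp: flats_def ground_contr)
qed (auto simp: flats_def ground_contr)

lemma bij_betw_flats_contr:
  assumes "F \<subseteq> ground M"
  shows "bij_betw (\<lambda>G. G - F) {G \<in> flats M. F \<subseteq> G} (flats (contr M F))"
  by (rule bij_betw_byWitness[where f' = "\<lambda>A. A \<union> F"])
     (auto simp: flats_contr_iff[OF assms] Un_absorb2)

lemma sum_flats_contr:
  assumes "F \<subseteq> ground M"
  shows "(\<Sum>A\<in>flats (contr M F). f A) = (\<Sum>G\<in>{G \<in> flats M. F \<subseteq> G}. f (G - F))"
  by (rule sum.reindex_bij_betw[OF bij_betw_flats_contr[OF assms], symmetric])

lemma loopless_restr: "loopless M \<Longrightarrow> loopless (restr M F)"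
  by (auto simp: loopless_def ground_restr indep_restr)

lemma loopless_contr:
  assumes "F \<in> flats M"
  shows "loopless (contr M F)"
proof -
  obtain B where B: "basis_of M F B" using ex_basis_of by blast
  show ?thesis
    unfolding loopless_def
    by (auto simp: ground_contr indep_contr_basis[OF B] intro: indep_insert_flat[OF assms B])
qed

lemma empty_in_flats: "loopless M \<Longrightarrow> {} \<in> flats M"
  by (auto simp: flats_def loopless_def rk_indep)

lemma mrank_eq_0:
  assumes "loopless M" "mrank M = 0"
  shows "ground M = {}"
  using rk_psubset_flat[OF empty_in_flats[OF assms(1)], of "ground M"] assms(2)
  by (auto simp: mrank_def)

lemma flats_mrank_0:
  assumes "loopless M" "mrank M = 0"
  shows "flats M = {{}}"
  using mrank_eq_0[OF assms] empty_in_flats[OF assms(1)] flats_subset[of _ M] by blast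

section \<open>The Moebius function\<close>

lemma moebius_refl [simp]: "moebius L F F = 1"
  by (simp add: moebius.simps)

lemma sum_moebius:
  assumes "finite L" "F \<in> L" "G \<in> L" "F \<subset> G" "finite G"
  shows "(\<Sum>H\<in>{H \<in> L. F \<subseteq> H \<and> H \<subseteq> G}. moebius L F H) = 0"
proof -
  have "{H \<in> L. F \<subseteq> H \<and> H \<subseteq> G} = insert G {H \<in> L. F \<subseteq> H \<and> H \<subset> G}"
    using assms by auto
  then show ?thesis
    using assms moebius.simps[of L F G] by simp
qed

text \<open>The recursion visits only sets below \<open>G\<close>. This carries Moebius values from
  the flats of a restriction over to the flats of the whole matroid.\<close>

lemma moebius_cong:
  assumes "\<And>H. H \<subseteq> G \<Longrightarrow> H \<in> L \<longleftrightarrow> H \<in> L'"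
  shows "moebius L F G = moebius L' F G"
  using assms
proof (induction L F G rule: moebius.induct)
  case (1 L F G)
  have set: "{H \<in> L. F \<subseteq> H \<and> H \<subset> G} = {H \<in> L'. F \<subseteq> H \<and> H \<subset> G}"
    using 1(2) by auto
  have "moebius L F H = moebius L' F H" if "F \<noteq> G" "F \<subset> G \<and> finite G" "H \<in> {H \<in> L. F \<subseteq> H \<and> H \<subset> G}" for H
    by (rule 1(1)[OF that]) (use that 1(2) in auto)
  then show ?case
    unfolding moebius.simps[of L F G] moebius.simps[of L' F G] set[symmetric]
    by (auto intro!: sum.cong)
qed

lemma char_poly_restr:
  assumes "F \<in> flats M"
  shows "char_poly (restr M F) =
    (\<Sum>G\<in>{G \<in> flats M. G \<subseteq> F}. monom (moebius (flats M) {} G) (rk M F - rk M G))"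
  unfolding char_poly_def flats_restr[OF assms] mrank_restr[OF flats_subset[OF assms]]
  by (intro sum.cong refl arg_cong2[where f = monom] moebius_cong)
     (auto simp: rk_restr)

section \<open>Palindromic polynomials\<close>

text \<open>This is t^n p(1/t) = p. The zero branch builds in that the degree is at most
  \<open>n\<close>, and it keeps \<open>n - k\<close> from being truncated.\<close>

definition palindromic :: "nat \<Rightarrow> int poly \<Rightarrow> bool" where
  "palindromic n p \<longleftrightarrow> (\<forall>k. coeff p k = (if k \<le> n then coeff p (n - k) else 0))"

lemma palindromic_0 [simp]: "palindromic n 0"
  by (simp add: palindromic_def)

lemma palindromic_add: "palindromic n p \<Longrightarrow> palindromic n q \<Longrightarrow> palindromic n (p + q)"
  unfolding palindromic_def by (metis add.right_neutral coeff_add)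

lemma palindromic_minus: "palindromic n p \<Longrightarrow> palindromic n (- p)"
  unfolding palindromic_def by (metis coeff_minus neg_equal_0_iff_equal)

lemma palindromic_diff: "palindromic n p \<Longrightarrow> palindromic n q \<Longrightarrow> palindromic n (p - q)"
  using palindromic_add[of n p "- q"] palindromic_minus[of n q] by simp

lemma palindromic_sum: "(\<And>x. x \<in> A \<Longrightarrow> palindromic n (f x)) \<Longrightarrow> palindromic n (\<Sum>x\<in>A. f x)"
  by (induction A rule: infinite_finite_induct) (auto intro: palindromic_add)

lemma palindromic_smult: "palindromic n p \<Longrightarrow> palindromic n (smult c p)"
  unfolding palindromic_def by (metis coeff_smult mult_zero_right)

text \<open>Every exponent up to the degree lies below n/2 and is mirrored to one above the degree.
  This is why a guess that passes the checks of \<open>KL_poly_contr_eqI\<close> is correct.\<close>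

lemma palindromic_eq_0:
  assumes "palindromic n p" "2 * degree p < n"
  shows "p = 0"
proof (rule poly_eqI)
  fix k
  show "coeff p k = coeff 0 k"
  proof (cases "k \<le> degree p")
    case True
    then have "degree p < n - k" "k \<le> n" using assms(2) by auto
    then show ?thesis using assms(1) coeff_eq_0 unfolding palindromic_def by (metis coeff_0)
  qed (simp add: coeff_eq_0)
qed

lemma coeff_reverse_poly:
  assumes "degree p \<le> r"
  shows "coeff (reverse_poly r p) k = (if k \<le> r then coeff p (r - k) else 0)"
proof -
  have "degree p - (k - (r - degree p)) = r - k" if "r - degree p \<le> k" "k \<le> r"
    using that assms by simp
  moreover have "coeff p (r - k) = 0" if "\<not> r - degree p \<le> k"
    using that assms by (intro coeff_eq_0) simp
  moreover have "k - (r - degree p) \<le> degree p \<longleftrightarrow> k \<le> r" if "r - degree p \<le> k"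
    using that assms by auto
  ultimately show ?thesis
    unfolding reverse_poly_def using assms
    by (auto simp: coeff_monom_mult coeff_reflect_poly)
qed

lemma palindromic_iff_reverse_poly:
  assumes "degree p \<le> r"
  shows "palindromic r p \<longleftrightarrow> reverse_poly r p = p"
  unfolding palindromic_def poly_eq_iff coeff_reverse_poly[OF assms] by metis

lemma palindromic_degree_le: "palindromic n p \<Longrightarrow> degree p \<le> n"
  by (rule degree_le) (auto simp: palindromic_def)

section \<open>Kazhdan--Lusztig polynomials via palindromicity\<close>

text \<open>
  The coefficients below half the rank are chosen to make \<open>KL_rec M + S\<close> palindromic.
\<close>

function KL_rec :: "'a matroid \<Rightarrow> int poly" where
  "KL_rec M =
     (if mrank M = 0 then 1
      else let S = (\<Sum>F\<in>flats M - {{}}. monom 1 (rk M F) * KL_rec (contr M F))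
           in \<Sum>k | 2 * k < mrank M. monom (coeff S (mrank M - k) - coeff S k) k)"
  by pat_completeness auto
termination
proof (relation "inv_image less_than (\<lambda>M. card (ground M))")
  fix M :: "'a matroid" and F
  assume "F \<in> flats M - {{}}"
  then have "F \<subseteq> ground M" "F \<noteq> {}"
    by (auto simp: flats_def)
  then show "(contr M F, M) \<in> inv_image less_than (\<lambda>M. card (ground M))"
    by (auto simp: ground_contr finite_ground intro!: psubset_card_mono)
qed simp

declare KL_rec.simps [simp del]

lemma coeff_KL_rec:
  assumes "mrank M > 0"
    and "S = (\<Sum>F\<in>flats M - {{}}. monom 1 (rk M F) * KL_rec (contr M F))"
  shows "coeff (KL_rec M) k = (if 2 * k < mrank M then coeff S (mrank M - k) - coeff S k else 0)"
proof -
  have "finite {k. 2 * k < mrank M}"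
    by (rule finite_subset[of _ "{..mrank M}"]) auto
  then show ?thesis
    using assms by (simp add: KL_rec.simps[of M] Let_def coeff_sum if_distrib[of "\<lambda>p. coeff p k"]
        cong: if_cong)
qed

lemma degree_KL_rec_less: "mrank M > 0 \<Longrightarrow> 2 * degree (KL_rec M) < mrank M"
proof -
  assume r: "mrank M > 0"
  show ?thesis
  proof (cases "KL_rec M = 0")
    case False
    then have "coeff (KL_rec M) (degree (KL_rec M)) \<noteq> 0" by simp
    then show ?thesis
      unfolding coeff_KL_rec[OF r refl] by (meson)
  qed (simp add: r)
qed

lemma KL_rec_mrank_0: "mrank M = 0 \<Longrightarrow> KL_rec M = 1"
  by (simp add: KL_rec.simps)

lemma degree_KL_rec_le: "2 * degree (KL_rec M) \<le> mrank M"
  by (cases "mrank M = 0") (auto simp: KL_rec_mrank_0 dest: degree_KL_rec_less)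

lemma degree_monom_mult_le: "degree p \<le> n \<Longrightarrow> degree (monom c k * p) \<le> k + n" for p :: "int poly"
  using degree_mult_le[of "monom c k" p] degree_monom_le[of c k] by linarith

lemma sum_flats_split:
  assumes "loopless M"
  shows "(\<Sum>F\<in>flats M. f F) = f {} + (\<Sum>F\<in>flats M - {{}}. f F)"
  by (rule sum.remove[OF finite_flats empty_in_flats[OF assms]])

lemma palindromic_KL_rec:
  assumes M: "loopless M"
  shows "palindromic (mrank M) (\<Sum>F\<in>flats M. monom 1 (rk M F) * KL_rec (contr M F))"
proof (cases "mrank M = 0")
  case True
  then show ?thesis
    using flats_mrank_0[OF M True] by (simp add: KL_rec_mrank_0 palindromic_def)
next
  case False
  define S where "S = (\<Sum>F\<in>flats M - {{}}. monom 1 (rk M F) * KL_rec (contr M F))"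
  have deg: "degree S \<le> mrank M"
    unfolding S_def
  proof (rule degree_sum_le)
    fix F assume "F \<in> flats M - {{}}"
    then have "F \<subseteq> ground M" by (simp add: flats_subset)
    then have "rk M F \<le> mrank M" "mrank (contr M F) = mrank M - rk M F"
      by (simp_all add: rk_le_mrank mrank_contr)
    then show "degree (monom 1 (rk M F) * KL_rec (contr M F)) \<le> mrank M"
      using degree_monom_mult_le[of "KL_rec (contr M F)" "mrank M - rk M F" 1 "rk M F"]
        degree_KL_rec_le[of "contr M F"] by simp
  qed (simp add: finite_flats)
  have "coeff (KL_rec M + S) k = (if k \<le> mrank M then coeff (KL_rec M + S) (mrank M - k) else 0)" for k
  proof -
    have "coeff S k = 0" if "\<not> k \<le> mrank M"
      using that deg by (intro coeff_eq_0) simp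
    \<comment> \<open>If neither \<open>k\<close> nor its mirror lies below the middle, then
      \<open>k\<close> is the middle exponent and its own mirror.\<close>
    moreover have "k = mrank M - k" if "\<not> 2 * k < mrank M" "\<not> 2 * (mrank M - k) < mrank M" "k \<le> mrank M"
      using that by auto
    ultimately show ?thesis
      using False by (auto simp: coeff_KL_rec[OF _ S_def])
  qed
  then show ?thesis
    unfolding sum_flats_split[OF M] S_def[symmetric] by (simp add: palindromic_def)
qed

lemma palindromic_KL_rec_contr:
  assumes A: "A \<in> flats M"
  shows "palindromic (mrank M - rk M A)
    (\<Sum>F\<in>{F \<in> flats M. A \<subseteq> F}. monom 1 (rk M F - rk M A) * KL_rec (contr M F))"
proof -
  have Ag: "A \<subseteq> ground M" using A by (rule flats_subset)
  have "(\<Sum>F\<in>flats (contr M A). monom 1 (rk (contr M A) F) * KL_rec (contr (contr M A) F)) =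
    (\<Sum>F\<in>{F \<in> flats M. A \<subseteq> F}. monom 1 (rk M F - rk M A) * KL_rec (contr M F))"
    unfolding sum_flats_contr[OF Ag]
  proof (rule sum.cong[OF refl])
    fix F assume F: "F \<in> {F \<in> flats M. A \<subseteq> F}"
    then have "F \<subseteq> ground M" by (simp add: flats_subset)
    then show "monom 1 (rk (contr M A) (F - A)) * KL_rec (contr (contr M A) (F - A)) =
        monom 1 (rk M F - rk M A) * KL_rec (contr M F)"
      using F by (simp add: contr_contr rk_contr[OF _ Ag] Un_absorb2 Diff_mono)
  qed
  then show ?thesis
    using palindromic_KL_rec[OF loopless_contr[OF A]] by (simp add: mrank_contr[OF Ag])
qed

section \<open>From the palindromic sum to the defining identity\<close>

lemma reverse_poly_sum:
  assumes "finite A" "\<And>x. x \<in> A \<Longrightarrow> degree (f x) \<le> n"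
  shows "reverse_poly n (\<Sum>x\<in>A. f x) = (\<Sum>x\<in>A. reverse_poly n (f x))"
proof (rule poly_eqI)
  fix k
  have "degree (\<Sum>x\<in>A. f x) \<le> n"
    using assms by (intro degree_sum_le) auto
  then show "coeff (reverse_poly n (\<Sum>x\<in>A. f x)) k = coeff (\<Sum>x\<in>A. reverse_poly n (f x)) k"
    using assms by (auto simp: coeff_sum coeff_reverse_poly intro!: sum.cong sum.neutral)
qed

lemma reverse_poly_monom_mult:
  assumes "a + degree p \<le> n"
  shows "reverse_poly n (monom 1 a * p) = reverse_poly (n - a) p"
proof (rule poly_eqI)
  fix k
  have "degree (monom 1 a * p) \<le> n"
    using degree_monom_mult_le[of p "degree p" 1 a] assms by simp
  then show "coeff (reverse_poly n (monom 1 a * p)) k = coeff (reverse_poly (n - a) p) k"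
    using assms by (auto simp: coeff_reverse_poly coeff_monom_mult add.commute[of k a])
qed

lemma sum_below_swap:
  fixes f :: "'a set \<Rightarrow> 'a set \<Rightarrow> 'b::comm_monoid_add"
  assumes "finite L"
  shows "(\<Sum>F\<in>L. \<Sum>G\<in>{G \<in> L. G \<subseteq> F}. f F G) = (\<Sum>G\<in>L. \<Sum>F\<in>{F \<in> L. G \<subseteq> F}. f F G)"
  using sum.swap_restrict[OF assms assms, of f "\<lambda>F G. G \<subseteq> F"] .

lemma smult_sum_right: "smult c (\<Sum>x\<in>A. f x) = (\<Sum>x\<in>A. smult c (f x))"
  by (induction A rule: infinite_finite_induct) (auto simp: smult_add_right)

lemma smult_sum_left: "smult (\<Sum>x\<in>A. f x) p = (\<Sum>x\<in>A. smult (f x) p)"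
  by (induction A rule: infinite_finite_induct) (auto simp: smult_add_left)

text \<open>After expanding \<open>char_poly\<close> and swapping the sums, the inner sum over
  \<open>F\<close> above \<open>G\<close> is Z of \<open>contr M G\<close>. It equals its own
  reversal, and reversing turns its summands into \<open>reverse_poly (mrank M - rk M F)\<close> of
  \<open>KL_rec (contr M F)\<close>, which no longer depend on \<open>G\<close>. So the Moebius
  values can be summed over all \<open>G\<close> below \<open>F\<close>, and only
  \<open>F = {}\<close> survives.\<close>

lemma KL_rec_identity:
  assumes M: "loopless M"
  shows "reverse_poly (mrank M) (KL_rec M) =
    (\<Sum>F\<in>flats M. char_poly (restr M F) * KL_rec (contr M F))"
proof -
  let ?r = "mrank M" and ?mu = "moebius (flats M) {}"
  have "(\<Sum>F\<in>flats M. char_poly (restr M F) * KL_rec (contr M F)) =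
    (\<Sum>F\<in>flats M. \<Sum>G\<in>{G \<in> flats M. G \<subseteq> F}.
       smult (?mu G) (monom 1 (rk M F - rk M G) * KL_rec (contr M F)))"
    by (intro sum.cong refl) (simp add: char_poly_restr sum_distrib_right smult_monom flip: mult_smult_left)
  also have "\<dots> = (\<Sum>G\<in>flats M. smult (?mu G)
       (\<Sum>F\<in>{F \<in> flats M. G \<subseteq> F}. monom 1 (rk M F - rk M G) * KL_rec (contr M F)))"
    unfolding sum_below_swap[OF finite_flats] smult_sum_right ..
  also have "\<dots> = (\<Sum>G\<in>flats M. smult (?mu G)
       (\<Sum>F\<in>{F \<in> flats M. G \<subseteq> F}. reverse_poly (?r - rk M F) (KL_rec (contr M F))))"
  proof (rule sum.cong[OF refl])
    fix G assume G: "G \<in> flats M"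
    let ?Z = "\<Sum>F\<in>{F \<in> flats M. G \<subseteq> F}. monom 1 (rk M F - rk M G) * KL_rec (contr M F)"
    have le: "rk M G \<le> rk M F \<and> rk M F \<le> ?r \<and> 2 * degree (KL_rec (contr M F)) \<le> ?r - rk M F"
      if "F \<in> {F \<in> flats M. G \<subseteq> F}" for F
      using that degree_KL_rec_le[of "contr M F"]
      by (auto simp: mrank_contr flats_subset intro: rk_mono rk_le_mrank[OF flats_subset])
    have pal: "palindromic (?r - rk M G) ?Z"
      by (rule palindromic_KL_rec_contr[OF G])
    have "?Z = reverse_poly (?r - rk M G) ?Z"
      using palindromic_iff_reverse_poly[OF palindromic_degree_le[OF pal]] pal by simp
    also have "\<dots> = (\<Sum>F\<in>{F \<in> flats M. G \<subseteq> F}.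
        reverse_poly (?r - rk M G) (monom 1 (rk M F - rk M G) * KL_rec (contr M F)))"
    proof (rule reverse_poly_sum)
      fix F assume "F \<in> {F \<in> flats M. G \<subseteq> F}"
      from le[OF this] show "degree (monom 1 (rk M F - rk M G) * KL_rec (contr M F)) \<le> ?r - rk M G"
        using degree_monom_mult_le[of "KL_rec (contr M F)" "?r - rk M F" 1 "rk M F - rk M G"] by simp
    qed (simp add: finite_flats)
    also have "\<dots> = (\<Sum>F\<in>{F \<in> flats M. G \<subseteq> F}. reverse_poly (?r - rk M F) (KL_rec (contr M F)))"
    proof (rule sum.cong[OF refl])
      fix F assume F: "F \<in> {F \<in> flats M. G \<subseteq> F}"
      have "?r - rk M G - (rk M F - rk M G) = ?r - rk M F"
        using le[OF F] by simp
      moreover have "rk M F - rk M G + degree (KL_rec (contr M F)) \<le> ?r - rk M G"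
        using le[OF F] by linarith
      ultimately show "reverse_poly (?r - rk M G) (monom 1 (rk M F - rk M G) * KL_rec (contr M F)) =
          reverse_poly (?r - rk M F) (KL_rec (contr M F))"
        by (simp add: reverse_poly_monom_mult)
    qed
    finally show "smult (?mu G) ?Z =
        smult (?mu G) (\<Sum>F\<in>{F \<in> flats M. G \<subseteq> F}. reverse_poly (?r - rk M F) (KL_rec (contr M F)))"
      by (rule arg_cong)
  qed
  also have "\<dots> = (\<Sum>F\<in>flats M. smult (\<Sum>G\<in>{G \<in> flats M. G \<subseteq> F}. ?mu G)
      (reverse_poly (?r - rk M F) (KL_rec (contr M F))))"
    unfolding smult_sum_right smult_sum_left sum_below_swap[OF finite_flats] ..
  also have "\<dots> = (\<Sum>F\<in>flats M. if F = {} then reverse_poly ?r (KL_rec M) else 0)"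
  proof (rule sum.cong[OF refl])
    fix F assume F: "F \<in> flats M"
    show "smult (\<Sum>G\<in>{G \<in> flats M. G \<subseteq> F}. ?mu G) (reverse_poly (?r - rk M F) (KL_rec (contr M F))) =
        (if F = {} then reverse_poly ?r (KL_rec M) else 0)"
    proof (cases "F = {}")
      case True
      then have "{G \<in> flats M. G \<subseteq> F} = {{}}" using empty_in_flats[OF M] by auto
      with True show ?thesis by simp
    next
      case False
      have "finite F"
        using finite_subset[OF flats_subset[OF F] finite_ground] .
      then have "(\<Sum>G\<in>{G \<in> flats M. G \<subseteq> F}. ?mu G) = 0"
        using sum_moebius[OF finite_flats empty_in_flats[OF M] F] False by auto
      with False show ?thesis by simp
    qed
  qed
  also have "\<dots> = reverse_poly ?r (KL_rec M)"
    by (simp add: finite_flats empty_in_flats[OF M])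
  finally show ?thesis ..
qed

lemma KL_family_KL_rec: "KL_family KL_rec"
  unfolding KL_family_def
  using KL_rec_mrank_0 degree_KL_rec_less KL_rec_identity by blast

section \<open>Uniqueness and the passage to \<open>KL_poly\<close>\<close>

lemma char_poly_restr_empty:
  assumes "loopless M"
  shows "char_poly (restr M {}) = 1"
proof -
  have "{G \<in> flats M. G \<subseteq> {}} = {{}}" using empty_in_flats[OF assms] by auto
  then show ?thesis
    by (simp add: char_poly_restr[OF empty_in_flats[OF assms]])
qed

text \<open>The reversal of a polynomial of degree below r/2 has no terms below r/2. So the lower
  half of the difference is minus the polynomial itself.\<close>

lemma poly_eq_of_reverse_poly_diff:
  fixes p q :: "int poly"
  assumes "2 * degree p < r" "2 * degree q < r"
    and eq: "reverse_poly r p - p = reverse_poly r q - q"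
  shows "p = q"
proof (rule poly_eqI)
  fix k
  have deg: "degree p \<le> r" "degree q \<le> r" using assms by auto
  show "coeff p k = coeff q k"
  proof (cases "2 * k < r")
    case True
    have "coeff (reverse_poly r p - p) k = coeff (reverse_poly r q - q) k"
      by (simp add: eq)
    moreover have "coeff p (r - k) = 0" "coeff q (r - k) = 0"
      using assms True by (auto intro!: coeff_eq_0)
    ultimately show ?thesis
      using True by (simp add: coeff_reverse_poly deg)
  next
    case False
    then show ?thesis using assms by (simp add: coeff_eq_0)
  qed
qed

lemma KL_familyD:
  assumes "KL_family P" "loopless M"
  shows "mrank M = 0 \<Longrightarrow> P M = 1"
    and "mrank M > 0 \<Longrightarrow> 2 * degree (P M) < mrank M"
    and "reverse_poly (mrank M) (P M) = (\<Sum>F\<in>flats M. char_poly (restr M F) * P (contr M F))"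
  using assms(1)[unfolded KL_family_def, THEN spec, THEN mp, OF assms(2)] by blast+

lemma KL_family_unique:
  assumes P: "KL_family P" and P': "KL_family P'" and M: "loopless M"
  shows "P M = P' M"
  using M
proof (induction "card (ground M)" arbitrary: M rule: less_induct)
  case less
  show ?case
  proof (cases "mrank M = 0")
    case True
    then show ?thesis
      using KL_familyD(1)[OF P less.prems] KL_familyD(1)[OF P' less.prems] by simp
  next
    case False
    \<comment> \<open>The summand for \<open>F = {}\<close> is \<open>R M\<close> itself; moving it
      to the left leaves only proper contractions on the right, which the induction hypothesis
      covers.\<close>
    have eq: "reverse_poly (mrank M) (R M) - R M =
        (\<Sum>F\<in>flats M - {{}}. char_poly (restr M F) * R (contr M F))" if "KL_family R" for R
      using KL_familyD(3)[OF that less.prems]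
      by (simp add: sum_flats_split[OF less.prems] char_poly_restr_empty[OF less.prems])
    have "P (contr M F) = P' (contr M F)" if "F \<in> flats M - {{}}" for F
    proof (rule less.hyps)
      have "F \<subseteq> ground M" "F \<noteq> {}" using that by (auto simp: flats_def)
      then show "card (ground (contr M F)) < card (ground M)"
        by (auto simp: ground_contr finite_ground intro!: psubset_card_mono)
    qed (use that in \<open>simp add: loopless_contr\<close>)
    then have "reverse_poly (mrank M) (P M) - P M = reverse_poly (mrank M) (P' M) - P' M"
      unfolding eq[OF P] eq[OF P'] by simp
    then show ?thesis
      using KL_familyD(2)[OF P less.prems] KL_familyD(2)[OF P' less.prems] False
      by (intro poly_eq_of_reverse_poly_diff[of "P M" "mrank M" "P' M"]) simp_all
  qed
qed

lemma KL_poly_eq_KL_rec: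
  assumes M: "loopless M"
  shows "KL_poly M = KL_rec M"
  unfolding KL_poly_def
proof (rule the_equality)
  show "\<exists>P. KL_family P \<and> P M = KL_rec M"
    using KL_family_KL_rec by (intro exI[of _ KL_rec]) simp
  fix p assume "\<exists>P. KL_family P \<and> P M = p"
  then obtain P where P: "KL_family P" "P M = p" by blast
  show "p = KL_rec M"
    using KL_family_unique[OF P(1) KL_family_KL_rec M] P(2) by simp
qed

text \<open>The verification principle for guessed polynomials. Going down from the ground set, the
  two palindromic sums at \<open>A\<close> agree except in the summand for \<open>A\<close>, so the
  difference of the true and the guessed polynomial is palindromic of degree below half the rank,
  hence 0.\<close>

lemma KL_poly_contr_eqI:
  assumes deg: "\<And>A. A \<in> flats M \<Longrightarrow> A \<noteq> ground M \<Longrightarrow> 2 * degree (f A) < mrank M - rk M A"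
    and ground: "f (ground M) = 1"
    and pal: "\<And>A. A \<in> flats M \<Longrightarrow> A \<noteq> ground M \<Longrightarrow> palindromic (mrank M - rk M A)
      (\<Sum>F\<in>{F \<in> flats M. A \<subseteq> F}. monom 1 (rk M F - rk M A) * f F)"
    and A: "A \<in> flats M"
  shows "KL_poly (contr M A) = f A"
proof -
  have "KL_rec (contr M A) = f A"
    using A
  proof (induction "card (ground M - A)" arbitrary: A rule: less_induct)
    case less
    have Ag: "A \<subseteq> ground M" using less.prems by (rule flats_subset)
    show ?case
    proof (cases "A = ground M")
      case True
      then have "mrank (contr M A) = 0" by (simp add: mrank_contr) (simp add: mrank_def)
      with True ground show ?thesis by (simp add: KL_rec_mrank_0)
    next
      case False
      let ?n = "mrank M - rk M A" and ?L = "{F \<in> flats M. A \<subseteq> F}"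
      have split: "(\<Sum>F\<in>?L. monom 1 (rk M F - rk M A) * h F) =
          h A + (\<Sum>F\<in>?L - {A}. monom 1 (rk M F - rk M A) * h F)" for h :: "'a set \<Rightarrow> int poly"
        using sum.remove[of ?L A "\<lambda>F. monom 1 (rk M F - rk M A) * h F"] less.prems
        by (simp add: finite_flats)
      have "KL_rec (contr M F) = f F" if "F \<in> ?L - {A}" for F
        using that flats_subset[of F M] Ag finite_ground[of M]
        by (intro less.hyps psubset_card_mono) auto
      then have "(\<Sum>F\<in>?L - {A}. monom 1 (rk M F - rk M A) * KL_rec (contr M F)) =
          (\<Sum>F\<in>?L - {A}. monom 1 (rk M F - rk M A) * f F)"
        by simp
      then have "palindromic ?n (KL_rec (contr M A) - f A)"
        using palindromic_diff[OF palindromic_KL_rec_contr[OF less.prems] pal[OF less.prems False]]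
        unfolding split by simp
      moreover have "2 * degree (KL_rec (contr M A) - f A) < ?n"
      proof -
        have "2 * degree (f A) < ?n" by (rule deg[OF less.prems False])
        moreover have "2 * degree (KL_rec (contr M A)) < ?n"
          using degree_KL_rec_less[of "contr M A"] mrank_contr[OF Ag] calculation by simp
        ultimately show ?thesis
          using degree_diff_le_max[of "KL_rec (contr M A)" "f A"] by linarith
      qed
      ultimately show ?thesis
        using palindromic_eq_0 by fastforce
    qed
  qed
  then show ?thesis
    using KL_poly_eq_KL_rec[OF loopless_contr[OF A]] by simp
qed

section \<open>The recursion for inverse Kazhdan--Lusztig polynomials\<close>

text \<open>
  With this sign the defining recursion says that \<open>Q\<close> is inverse to \<open>P\<close> in the incidence algebra.
\<close>

definition signed_inv_KL :: "'a matroid \<Rightarrow> 'a set \<Rightarrow> int poly" where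
  "signed_inv_KL M A = (- 1) ^ (mrank M - rk M A) * inv_KL_poly (contr M A)"

lemma signed_inv_KL_ground: "signed_inv_KL M (ground M) = 1"
proof -
  have "mrank (contr M (ground M)) = 0" by (simp add: mrank_contr) (simp add: mrank_def)
  then show ?thesis by (simp add: signed_inv_KL_def inv_KL_poly.simps mrank_def)
qed

lemma sum_signed_inv_KL:
  assumes A: "A \<in> flats M" "A \<noteq> ground M"
  shows "(\<Sum>B\<in>{B \<in> flats M. A \<subseteq> B}. KL_poly (contr (restr M B) A) * signed_inv_KL M B) = 0"
proof -
  have Ag: "A \<subseteq> ground M" using A by (simp add: flats_subset)
  let ?L = "{B \<in> flats M. A \<subseteq> B}"
  let ?N = "contr M A"
  have lt: "rk M A < mrank M"
    unfolding mrank_def using A Ag by (intro rk_psubset_flat) auto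
  then have r: "mrank ?N \<noteq> 0" by (simp add: mrank_contr[OF Ag])
  \<comment> \<open>The summand for \<open>B = A\<close> thus has coefficient 1: it is the left-hand
    side of the recursion, moved into the sum.\<close>
  have KL1: "KL_poly (contr (restr M A) A) = 1"
  proof -
    have "contr (restr M A) A = restr ?N {}"
      using restr_contr[of A A M] by simp
    moreover have "loopless (restr ?N {})"
      by (rule loopless_restr[OF loopless_contr[OF A(1)]])
    moreover have "mrank (restr ?N {}) = 0" by (simp add: mrank_restr)
    ultimately show ?thesis by (simp add: KL_poly_eq_KL_rec KL_rec_mrank_0)
  qed
  have "inv_KL_poly ?N = (\<Sum>F\<in>flats ?N - {{}}.
      (- 1) ^ (rk ?N F + 1) * KL_poly (restr ?N F) * inv_KL_poly (contr ?N F))"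
    using r by (simp add: inv_KL_poly.simps)
  also have "\<dots> = (\<Sum>B\<in>?L - {A}. (- 1) ^ (rk ?N (B - A) + 1) * KL_poly (restr ?N (B - A)) *
      inv_KL_poly (contr ?N (B - A)))"
  proof (rule sum.reindex_bij_betw[symmetric])
    have "bij_betw (\<lambda>G. G - A) (?L - {A}) (flats ?N - {A - A})"
      by (rule bij_betw_DiffI[OF bij_betw_flats_contr[OF Ag]]) (use A empty_in_flats[OF loopless_contr[OF A(1)]] in auto)
    then show "bij_betw (\<lambda>G. G - A) (?L - {A}) (flats ?N - {{}})" by simp
  qed
  also have "\<dots> = (\<Sum>B\<in>?L - {A}. (- 1) ^ (rk M B - rk M A + 1) * KL_poly (contr (restr M B) A) *
      inv_KL_poly (contr M B))"
  proof (rule sum.cong[OF refl])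
    fix B assume B: "B \<in> ?L - {A}"
    then have "B \<subseteq> ground M" by (simp add: flats_subset)
    then show "(- 1) ^ (rk ?N (B - A) + 1) * KL_poly (restr ?N (B - A)) * inv_KL_poly (contr ?N (B - A)) =
        (- 1) ^ (rk M B - rk M A + 1) * KL_poly (contr (restr M B) A) * inv_KL_poly (contr M B)"
      using B by (simp add: contr_contr restr_contr rk_contr[OF _ Ag] Un_absorb2 Diff_mono)
  qed
  finally have "signed_inv_KL M A = (\<Sum>B\<in>?L - {A}. (- 1) ^ (mrank M - rk M A) *
      ((- 1) ^ (rk M B - rk M A + 1) * KL_poly (contr (restr M B) A) * inv_KL_poly (contr M B)))"
    by (simp add: signed_inv_KL_def sum_distrib_left)
  also have "\<dots> = (\<Sum>B\<in>?L - {A}. - (KL_poly (contr (restr M B) A) * signed_inv_KL M B))"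
  proof (rule sum.cong[OF refl])
    fix B assume B: "B \<in> ?L - {A}"
    then have "rk M A \<le> rk M B" "rk M B \<le> mrank M"
      by (auto intro: rk_mono rk_le_mrank[OF flats_subset])
    then obtain i j where "rk M B = rk M A + i" "mrank M = rk M A + i + j"
      by (metis le_Suc_ex)
    \<comment> \<open>The exponents are i + j and i + 1; the two powers with exponent i cancel,
      leaving minus the sign that belongs to \<open>B\<close>.\<close>
    then have "(- 1) ^ (mrank M - rk M A) * (- 1) ^ (rk M B - rk M A + 1) =
        - ((- 1) ^ (mrank M - rk M B) :: int poly)"
      by (simp add: power_add flip: power_mult_distrib)
    then show "(- 1) ^ (mrank M - rk M A) *
      ((- 1) ^ (rk M B - rk M A + 1) * KL_poly (contr (restr M B) A) * inv_KL_poly (contr M B)) =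
      - (KL_poly (contr (restr M B) A) * signed_inv_KL M B)"
      by (simp add: signed_inv_KL_def mult.assoc[symmetric])
  qed
  finally have "signed_inv_KL M A + (\<Sum>B\<in>?L - {A}. KL_poly (contr (restr M B) A) * signed_inv_KL M B) = 0"
    by (simp add: sum_negf)
  then show ?thesis
    using sum.remove[of ?L A "\<lambda>B. KL_poly (contr (restr M B) A) * signed_inv_KL M B"] A KL1
    by (simp add: finite_flats)
qed

section \<open>Counting subspaces over the two-element field\<close>

lemma bit_vec_add_self [simp]: "x + x = (0 :: bit ^ 'n)"
  by (simp add: vec_eq_iff)

lemma bit_vec_diff [simp]: "x - y = x + (y :: bit ^ 'n)"
  by (simp add: vec_eq_iff)

lemma bit_vec_add_cancel [simp]: "x + (x + y) = (y :: bit ^ 'n)"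
  by (simp add: add.assoc[symmetric])

lemma bit_vec_add_eq_0_iff: "x + y = 0 \<longleftrightarrow> x = (y :: bit ^ 'n)"
  by (metis bit_vec_add_self bit_vec_diff eq_iff_diff_eq_0)

lemma vec_subspace_bit:
  "vec.subspace (S :: (bit ^ 'n) set) \<longleftrightarrow> 0 \<in> S \<and> (\<forall>x\<in>S. \<forall>y\<in>S. x + y \<in> S)"
proof -
  have "c *s x \<in> S" if "0 \<in> S" "x \<in> S" for c :: bit and x :: "bit ^ 'n"
    using that by (cases c) auto
  then show ?thesis
    unfolding vec.subspace_def by blast
qed

lemma finite_bit_vec_sets [simp]: "finite (S :: (bit ^ 'n) set)"
  by (rule finite_subset[OF subset_UNIV]) (rule finite)

lemma finite_bit_vec_set_sets [simp]: "finite (S :: (bit ^ 'n) set set)"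
  by (rule finite_subset[OF subset_UNIV]) (rule finite)

lemma span_insert_bit:
  assumes "vec.subspace (S :: (bit ^ 'n) set)"
  shows "vec.span (insert v S) = S \<union> (+) v ` S"
proof -
  have "x \<in> vec.span (insert v S) \<longleftrightarrow> x \<in> S \<or> x + v \<in> S" for x
  proof -
    have "vec.span S = S" using assms by simp
    then have "x \<in> vec.span (insert v S) \<longleftrightarrow> (\<exists>k. x - k *s v \<in> S)"
      by (simp only: vec.span_insert mem_Collect_eq)
    also have "\<dots> \<longleftrightarrow> x - 0 *s v \<in> S \<or> x - 1 *s v \<in> S"
      by (metis bit.exhaust)
    finally show ?thesis by simp
  qed
  moreover have "x + v \<in> S \<longleftrightarrow> x \<in> (+) v ` S" for x
    by (metis (no_types, lifting) add.commute bit_vec_add_cancel image_iff)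
  ultimately show ?thesis by blast
qed

lemma dim_insert_subspace:
  assumes "vec.subspace S" "v \<notin> S"
  shows "vec.dim (insert v S) = Suc (vec.dim S)"
proof -
  have eq: "vec.span S = S" using assms by simp
  show ?thesis using assms(2) by (simp add: vec.dim_insert eq)
qed

lemma card_subspace_bit:
  assumes "vec.subspace (S :: (bit ^ 'n) set)"
  shows "card S = 2 ^ vec.dim S"
proof -
  have "card (vec.span B) = 2 ^ card B" if "vec.independent B" for B :: "(bit ^ 'n) set"
  proof -
    have "finite B" by simp
    then show ?thesis using that
    proof (induction B)
      case (insert b B)
      have b: "b \<notin> vec.span B" and B: "vec.independent B"
        using insert vec.independent_insert[of b B] by auto
      let ?S = "vec.span B"
      have "?S \<inter> (+) b ` ?S = {}"
      proof (rule ccontr)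
        assume "?S \<inter> (+) b ` ?S \<noteq> {}"
        then obtain y where y: "y \<in> ?S" "b + y \<in> ?S" by auto
        then have "(b + y) + y \<in> ?S" by (metis vec.span_add)
        with b show False by (simp add: add.assoc)
      qed
      moreover have "card ((+) b ` ?S) = card ?S" by (intro card_image) simp
      moreover have "vec.span (insert b B) = ?S \<union> (+) b ` ?S"
      proof -
        have "vec.span (insert b B) = vec.span (insert b ?S)"
        proof (rule antisym)
          show "vec.span (insert b B) \<subseteq> vec.span (insert b ?S)"
            by (rule vec.span_mono) (use vec.span_superset in auto)
          show "vec.span (insert b ?S) \<subseteq> vec.span (insert b B)"
            using vec.span_mono[of B "insert b B"] vec.span_superset[of "insert b B"]
            by (intro vec.span_minimal) auto
        qed
        then show ?thesis by (simp add: span_insert_bit)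
      qed
      ultimately show ?case
        using insert.IH[OF B] insert.hyps by (simp add: card_Un_disjoint)
    qed simp
  qed
  moreover obtain B where "B \<subseteq> S" "vec.independent B" "S \<subseteq> vec.span B" "card B = vec.dim S"
    using vec.basis_exists[of S] by blast
  ultimately show ?thesis
    using vec.span_subspace[of B S] assms by metis
qed

section \<open>Intervals of subspaces and Gaussian binomial coefficients\<close>

definition interval :: "(bit ^ 'n) set \<Rightarrow> (bit ^ 'n) set \<Rightarrow> (bit ^ 'n) set set" where
  "interval A B = {K. vec.subspace K \<and> A \<subseteq> K \<and> K \<subseteq> B}"

definition layer :: "(bit ^ 'n) set \<Rightarrow> (bit ^ 'n) set \<Rightarrow> nat \<Rightarrow> (bit ^ 'n) set set" where
  "layer A B k = {K \<in> interval A B. vec.dim K = vec.dim A + k}"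

text \<open>The Gaussian binomial coefficient at q = 2. This multiplicative recursion mirrors the
  double counting in \<open>card_layer\<close> and makes one recursive call per value; the division
  is exact.\<close>

fun gauss :: "nat \<Rightarrow> nat \<Rightarrow> nat" where
  "gauss n 0 = 1"
| "gauss 0 (Suc k) = 0"
| "gauss (Suc n) (Suc k) = (2 ^ Suc n - 1) * gauss n k div (2 ^ Suc k - 1)"

text \<open>The sets \<open>L - A\<close>, for \<open>L\<close> one dimension above
  \<open>A\<close>, partition \<open>B - A\<close> into classes of \<open>2 ^ vec.dim A\<close>
  vectors each.\<close>

lemma card_layer_1:
  assumes A: "vec.subspace A" and B: "vec.subspace B" and AB: "A \<subseteq> B"
  shows "card (layer A B 1) = 2 ^ (vec.dim B - vec.dim A) - 1"
proof -
  have un: "B - A = (\<Union>L\<in>layer A B 1. L - A)"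
  proof (intro equalityI subsetI)
    fix v assume v: "v \<in> B - A"
    let ?L = "vec.span (insert v A)"
    have "?L \<subseteq> B" using v AB B by (intro vec.span_minimal) auto
    then have "?L \<in> layer A B 1"
      using A v vec.span_superset[of "insert v A"] by (auto simp: layer_def interval_def dim_insert_subspace)
    moreover have "v \<in> ?L - A" using v vec.span_base[of v "insert v A"] by simp
    ultimately show "v \<in> (\<Union>L\<in>layer A B 1. L - A)" by blast
  qed (auto simp: layer_def interval_def)
  have disj: "(L - A) \<inter> (L' - A) = {}"
    if "L \<in> layer A B 1" "L' \<in> layer A B 1" "L \<noteq> L'" for L L'
  proof (rule ccontr)
    assume "(L - A) \<inter> (L' - A) \<noteq> {}"
    then obtain v where v: "v \<in> L" "v \<in> L'" "v \<notin> A" by auto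
    have "vec.span (insert v A) = K" if "K \<in> layer A B 1" "v \<in> K" for K
    proof (rule vec.subspace_dim_equal)
      show "vec.span (insert v A) \<subseteq> K"
        using that by (intro vec.span_minimal) (auto simp: layer_def interval_def)
      show "vec.dim K \<le> vec.dim (vec.span (insert v A))"
        using that v A by (simp add: layer_def dim_insert_subspace)
    qed (use that in \<open>auto simp: layer_def interval_def\<close>)
    with that v show False by metis
  qed
  have "card (L - A) = 2 ^ vec.dim A" if "L \<in> layer A B 1" for L
    using that card_subspace_bit[of L] card_subspace_bit[OF A]
    by (simp add: layer_def interval_def card_Diff_subset)
  then have "card (B - A) = card (layer A B 1) * 2 ^ vec.dim A"
    unfolding un using disj by (subst card_UN_disjoint) auto
  moreover have "card (B - A) = 2 ^ vec.dim B - 2 ^ vec.dim A"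
    using AB by (simp add: card_Diff_subset card_subspace_bit A B)
  moreover have "(2::nat) ^ vec.dim B = 2 ^ (vec.dim B - vec.dim A) * 2 ^ vec.dim A"
    using vec.dim_subset[OF AB] by (simp flip: power_add)
  ultimately have "card (layer A B 1) * 2 ^ vec.dim A = (2 ^ (vec.dim B - vec.dim A) - 1) * 2 ^ vec.dim A"
    by (simp add: diff_mult_distrib)
  then show ?thesis by simp
qed

text \<open>Double counting of the pairs of a line of \<open>B/A\<close> and a \<open>(k+1)\<close>-space containing it.\<close>

lemma card_layer:
  assumes "vec.subspace A" "vec.subspace B" "A \<subseteq> B"
  shows "card (layer A B k) = gauss (vec.dim B - vec.dim A) k"
  using assms
proof (induction k arbitrary: A)
  case 0
  have "K = A" if "K \<in> layer A B 0" for K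
    using that 0 vec.subspace_dim_equal[of A K] by (simp add: layer_def interval_def)
  moreover have "A \<in> layer A B 0"
    using 0 by (simp add: layer_def interval_def)
  ultimately have "layer A B 0 = {A}" by blast
  then show ?case by simp
next
  case (Suc k)
  note A = Suc.prems(1) and B = Suc.prems(2) and AB = Suc.prems(3)
  show ?case
  proof (cases "vec.dim B - vec.dim A")
    case 0
    have "K \<notin> layer A B (Suc k)" for K
      using 0 vec.dim_subset[of K B] by (auto simp: layer_def interval_def)
    then have "layer A B (Suc k) = {}" by blast
    then show ?thesis using 0 by simp
  next
    case (Suc n)
    have lines: "card {L \<in> layer A B 1. L \<subseteq> K} = 2 ^ Suc k - 1" if "K \<in> layer A B (Suc k)" for K
    proof -
      have "{L \<in> layer A B 1. L \<subseteq> K} = layer A K 1"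
        using that by (auto simp: layer_def interval_def)
      moreover have "card (layer A K 1) = 2 ^ (vec.dim K - vec.dim A) - 1"
        using that A by (intro card_layer_1) (auto simp: layer_def interval_def)
      moreover have "vec.dim K - vec.dim A = Suc k" using that by (simp add: layer_def)
      ultimately show ?thesis by simp
    qed
    have above: "card {K \<in> layer A B (Suc k). L \<subseteq> K} = gauss n k" if "L \<in> layer A B 1" for L
    proof -
      have "{K \<in> layer A B (Suc k). L \<subseteq> K} = layer L B k"
        using that by (auto simp: layer_def interval_def)
      moreover have "card (layer L B k) = gauss (vec.dim B - vec.dim L) k"
        using that B by (intro Suc.IH) (auto simp: layer_def interval_def)
      moreover have "vec.dim B - vec.dim L = n" using that Suc by (simp add: layer_def)
      ultimately show ?thesis by simp
    qed
    have "card (layer A B (Suc k)) * (2 ^ Suc k - 1) =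
        (\<Sum>K\<in>layer A B (Suc k). \<Sum>L\<in>{L \<in> layer A B 1. L \<subseteq> K}. 1)"
      using lines by simp
    also have "\<dots> = (\<Sum>L\<in>layer A B 1. \<Sum>K\<in>{K \<in> layer A B (Suc k). L \<subseteq> K}. 1)"
      by (rule sum.swap_restrict) simp_all
    also have "\<dots> = (2 ^ Suc n - 1) * gauss n k"
      using above card_layer_1[OF A B AB] Suc by simp
    finally have "card (layer A B (Suc k)) * (2 ^ Suc k - 1) = (2 ^ Suc n - 1) * gauss n k" .
    moreover have "(2::nat) ^ Suc k - 1 \<noteq> 0"
      using one_less_power[of "2::nat" "Suc k"] by simp
    ultimately have "card (layer A B (Suc k)) = (2 ^ Suc n - 1) * gauss n k div (2 ^ Suc k - 1)"
      by (metis nonzero_mult_div_cancel_right)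
    then show ?thesis using Suc by simp
  qed
qed

lemma sum_interval:
  fixes f :: "nat \<Rightarrow> 'b::comm_semiring_1"
  assumes A: "vec.subspace A" and B: "vec.subspace B" and AB: "A \<subseteq> B"
  shows "(\<Sum>K\<in>interval A B. f (vec.dim K)) =
    (\<Sum>j\<le>vec.dim B - vec.dim A. of_nat (gauss (vec.dim B - vec.dim A) j) * f (vec.dim A + j))"
proof -
  have dim: "vec.dim A \<le> vec.dim K \<and> vec.dim K \<le> vec.dim B" if "K \<in> interval A B" for K
    using that by (auto simp: interval_def intro: vec.dim_subset)
  have "(\<Sum>K\<in>interval A B. f (vec.dim K)) =
      (\<Sum>j\<le>vec.dim B - vec.dim A. \<Sum>K\<in>{K \<in> interval A B. vec.dim K - vec.dim A = j}. f (vec.dim K))"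
    by (rule sum.group[symmetric]) (use dim in \<open>auto intro: diff_le_mono\<close>)
  also have "\<dots> = (\<Sum>j\<le>vec.dim B - vec.dim A. of_nat (gauss (vec.dim B - vec.dim A) j) * f (vec.dim A + j))"
  proof (rule sum.cong[OF refl])
    fix j
    have "{K \<in> interval A B. vec.dim K - vec.dim A = j} = layer A B j"
      using dim by (force simp: layer_def)
    moreover have "(\<Sum>K\<in>layer A B j. f (vec.dim K)) = (\<Sum>K\<in>layer A B j. f (vec.dim A + j))"
      by (rule sum.cong) (auto simp: layer_def)
    ultimately show "(\<Sum>K\<in>{K \<in> interval A B. vec.dim K - vec.dim A = j}. f (vec.dim K)) =
        of_nat (gauss (vec.dim B - vec.dim A) j) * f (vec.dim A + j)"
      by (simp add: card_layer[OF A B AB])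
  qed
  finally show ?thesis .
qed

lemma gauss_1 [simp]: "gauss n (Suc 0) = 2 ^ n - 1"
  by (cases n) auto

lemma gauss_0_pos [simp]: "k > 0 \<Longrightarrow> gauss 0 k = 0"
  by (cases k) auto

text \<open>Rules for evaluation by the simplifier. The value 1 is normalised to
  \<open>Suc 0\<close>, which does not match \<open>numeral m\<close> and gets its own rule.\<close>

lemma gauss_numeral [simp]:
  "gauss (Suc 0) (numeral l) = 2 ^ 0 * gauss 0 (pred_numeral l) div (2 ^ numeral l - 1)"
  "gauss (numeral m) (numeral l) =
    (2 ^ numeral m - 1) * gauss (pred_numeral m) (pred_numeral l) div (2 ^ numeral l - 1)"
  by (simp_all add: numeral_eq_Suc del: power_Suc)

text \<open>No interval is longer than the dimension 10 of the space, so a finite check is enough.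
  The symmetry makes the rank generating function of an interval palindromic.\<close>

lemma gauss_symmetric:
  assumes "n \<le> 10" "k \<le> n"
  shows "gauss n (n - k) = gauss n k"
proof -
  have "\<forall>n\<in>{..10}. \<forall>k\<in>{..10}. k \<le> n \<longrightarrow> gauss n (n - k) = gauss n k"
    by (simp add: atMost_nat_numeral atMost_Suc)
  then show ?thesis using assms by auto
qed

section \<open>The lattice of flats as a family of subspaces\<close>

lemma add_mem_subspace_iff:
  "vec.subspace (S :: (bit ^ 'n) set) \<Longrightarrow> x \<in> S \<Longrightarrow> x + y \<in> S \<longleftrightarrow> y \<in> S"
  by (metis bit_vec_add_cancel vec.subspace_add)

lemma subspace_line: "vec.subspace {0, w, x, w + x :: bit ^ 'n}"
  unfolding vec_subspace_bit by (auto simp: add_ac)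

lemma subspace_pair: "vec.subspace {0, u :: bit ^ 'n}"
  unfolding vec_subspace_bit by auto

lemma subspace_psubset_translate:
  fixes L K :: "(bit ^ 'n) set"
  assumes "vec.subspace L" "vec.subspace K" "L \<subseteq> K" "v \<in> K - L" "l \<in> L"
  shows "v + l \<in> K - L"
  using assms add_mem_subspace_iff[of L l v] vec.subspace_add[of K v l]
  by (auto simp: add.commute)

text \<open>The whole computation rests on these relative positions and dimensions; coordinates
  return only in \<open>deleted_geometry_std\<close>.\<close>

locale deleted_geometry =
  fixes W X H :: "(bit ^ 10) set"
  assumes W: "vec.subspace W" and X: "vec.subspace X" and H: "vec.subspace H"
    and HX: "H \<subseteq> X" and WX: "W \<inter> X = {0}"
    and dim_W: "vec.dim W = 3" and dim_X: "vec.dim X = 7" and dim_H: "vec.dim H = 6"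
begin

definition E :: "(bit ^ 10) set" where
  "E = (UNIV - {0}) - ((W - {0}) \<union> (X - H))"

definition spanned :: "(bit ^ 10) set set" where
  "spanned = {U. vec.subspace U \<and> vec.span (U \<inter> E) = U}"

definition line :: "(bit ^ 10) \<times> (bit ^ 10) \<Rightarrow> (bit ^ 10) set" where
  "line p = {0, fst p, snd p, fst p + snd p}"

text \<open>Of the three nonzero vectors of \<open>line (w, x)\<close> only \<open>w + x\<close>
  survives the deletion, so \<open>mid\<close> is the spanned part of the exceptional
  \<open>line\<close>.\<close>

definition mid :: "(bit ^ 10) \<times> (bit ^ 10) \<Rightarrow> (bit ^ 10) set" where
  "mid p = {0, fst p + snd p}"

definition pairs :: "(bit ^ 10) set \<Rightarrow> ((bit ^ 10) \<times> (bit ^ 10)) set" where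
  "pairs B = ((W - {0}) \<inter> B) \<times> ((X - H) \<inter> B)"

lemma zero_mem [simp]: "0 \<in> W" "0 \<in> X" "0 \<in> H"
  using W X H by (auto simp: vec_subspace_bit)

lemma mem_E: "v \<in> E \<longleftrightarrow> v \<notin> W \<and> (v \<in> X \<longrightarrow> v \<in> H)"
  by (auto simp: E_def)

lemma WX_eq_0: "v \<in> W \<Longrightarrow> v \<in> X \<Longrightarrow> v = 0"
  using WX by blast

text \<open>\<open>H\<close> is a hyperplane of \<open>X\<close>, so \<open>X - H\<close> is a
  single coset of \<open>H\<close>.\<close>

lemma X_minus_H_add:
  assumes "x \<in> X - H" "y \<in> X - H"
  shows "x + y \<in> H"
proof -
  have sub: "vec.span (insert x H) \<subseteq> X"
    using assms HX X by (intro vec.span_minimal) auto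
  have "vec.dim (vec.span (insert x H)) = 7"
    using assms H dim_H dim_insert_subspace[of H x] by (simp only: vec.dim_span) simp
  then have "vec.span (insert x H) = X"
    using dim_X by (intro vec.subspace_dim_equal[OF _ X sub]) auto
  then have "y \<in> H \<union> (+) x ` H"
    using span_insert_bit[OF H, of x] assms by auto
  then show ?thesis using assms by auto
qed

lemma pairsD:
  assumes "(w, x) \<in> pairs B"
  shows "w \<in> W" "w \<noteq> 0" "x \<in> X" "x \<notin> H" "w \<in> B" "x \<in> B"
    "w \<notin> X" "x \<notin> W" "x \<noteq> 0" "w + x \<notin> W" "w + x \<notin> X" "w + x \<noteq> 0" "w \<noteq> x"
proof -
  show *: "w \<in> W" "w \<noteq> 0" "x \<in> X" "x \<notin> H" "w \<in> B" "x \<in> B"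
    using assms by (auto simp: pairs_def)
  show **: "w \<notin> X" "x \<notin> W" "x \<noteq> 0"
    using * WX_eq_0[of w] WX_eq_0[of x] zero_mem(3) by auto
  show "w + x \<notin> W"
    using * ** add_mem_subspace_iff[OF W] by blast
  show "w + x \<notin> X"
    using * ** add_mem_subspace_iff[OF X, of x w] by (simp add: add.commute)
  show "w + x \<noteq> 0" "w \<noteq> x"
    using * ** by (auto simp: bit_vec_add_eq_0_iff)
qed

lemma subspace_mid: "vec.subspace (mid p)"
  by (simp add: mid_def subspace_pair)

lemma subspace_line': "vec.subspace (line p)"
  by (simp add: line_def subspace_line)

lemma subspace_spanned: "A \<in> spanned \<Longrightarrow> vec.subspace A"
  by (simp add: spanned_def)

lemma zero_in_spanned_elem: "A \<in> spanned \<Longrightarrow> 0 \<in> A"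
  using subspace_spanned vec.subspace_0 by blast

lemma spanned_subset_span: "A \<in> spanned \<Longrightarrow> A \<subseteq> K \<Longrightarrow> A \<subseteq> vec.span (K \<inter> E)"
  unfolding spanned_def using vec.span_mono[of "A \<inter> E" "K \<inter> E"] by blast

lemma spanned_subset_W: "A \<in> spanned \<Longrightarrow> A \<subseteq> W \<Longrightarrow> A = {0}"
proof -
  assume A: "A \<in> spanned" "A \<subseteq> W"
  then have "A \<inter> E = {}" by (auto simp: mem_E)
  with A show "A = {0}" unfolding spanned_def by force
qed

lemma spanned_subset_X: "A \<in> spanned \<Longrightarrow> A \<subseteq> X \<Longrightarrow> A \<subseteq> H"
proof -
  assume A: "A \<in> spanned" "A \<subseteq> X"
  then have "A \<inter> E \<subseteq> H" by (auto simp: mem_E)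
  then have "vec.span (A \<inter> E) \<subseteq> H" using H by (rule vec.span_minimal)
  with A show "A \<subseteq> H" by (simp add: spanned_def)
qed

lemma spanned_subset_line:
  assumes "A \<in> spanned" "A \<subseteq> line p" "p \<in> pairs B"
  shows "A = {0} \<or> A = mid p"
proof -
  obtain w x where p: "p = (w, x)" by force
  have "A \<inter> E \<subseteq> mid p"
    using assms(2) pairsD[OF assms(3)[unfolded p]] by (auto simp: p mid_def line_def mem_E)
  then have "vec.span (A \<inter> E) \<subseteq> mid p" using subspace_mid by (rule vec.span_minimal)
  then show ?thesis
    using assms(1) zero_in_spanned_elem[OF assms(1)] by (auto simp: spanned_def mid_def)
qed

lemma spanned_zero [simp]: "{0} \<in> spanned"
proof -
  have "{0} \<inter> E = {}" by (auto simp: mem_E)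
  then show ?thesis by (simp add: spanned_def vec.subspace_single_0)
qed

lemma spanned_below_H: "vec.subspace A \<Longrightarrow> A \<subseteq> H \<Longrightarrow> A \<in> spanned"
proof -
  assume A: "vec.subspace A" "A \<subseteq> H"
  have "v \<in> vec.span (A \<inter> E)" if "v \<in> A" for v
  proof (cases "v = 0")
    case False
    then have "v \<in> A \<inter> E" using A that HX WX_eq_0 by (auto simp: mem_E)
    then show ?thesis by (rule vec.span_base)
  qed (simp add: vec.span_zero)
  moreover have "vec.span (A \<inter> E) \<subseteq> A" using A by (intro vec.span_minimal) auto
  ultimately show "A \<in> spanned" using A by (auto simp: spanned_def)
qed

lemma spanned_mid: "p \<in> pairs B \<Longrightarrow> mid p \<in> spanned"
proof -
  assume p: "p \<in> pairs B"
  obtain w x where wx: "p = (w, x)" by force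
  have "w + x \<in> mid p \<inter> E"
    using pairsD[OF p[unfolded wx]] by (auto simp: mid_def wx mem_E)
  then have "{0, w + x} \<subseteq> vec.span (mid p \<inter> E)"
    using vec.span_base vec.span_zero by blast
  moreover have "vec.span (mid p \<inter> E) \<subseteq> mid p"
    using subspace_mid by (intro vec.span_minimal) auto
  ultimately show "mid p \<in> spanned" using subspace_mid by (auto simp: spanned_def mid_def wx)
qed

text \<open>
  If \<open>K\<close> is not spanned by its points of \<open>E\<close> and \<open>L\<close> is the span of these, then all of \<open>K - L\<close> is
  deleted. So each translate of \<open>L\<close> in \<open>K\<close> is covered by \<open>W\<close> and \<open>X - H\<close>.
\<close>

lemma not_spanned_cases:
  assumes K: "vec.subspace K" and nK: "K \<notin> spanned"
  shows "(K \<subseteq> W \<and> K \<noteq> {0}) \<or> (K \<subseteq> X \<and> \<not> K \<subseteq> H) \<or> (\<exists>p\<in>pairs UNIV. K = line p)"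
proof -
  define L where "L = vec.span (K \<inter> E)"
  have L: "vec.subspace L" by (simp add: L_def)
  have LK: "L \<subseteq> K" unfolding L_def using K by (intro vec.span_minimal) auto
  have "L \<noteq> K" using nK K by (auto simp: L_def spanned_def)
  then obtain v where v: "v \<in> K - L" using LK by blast
  have del: "u \<in> W \<or> u \<in> X - H" if "u \<in> K - L" for u
    using that vec.span_base[of u "K \<inter> E"] by (auto simp: L_def mem_E)
  have tr: "u + l \<in> K - L" if "u \<in> K - L" "l \<in> L" for u l
    by (rule subspace_psubset_translate[OF L K LK that])
  have L0: "0 \<in> L" using L by (rule vec.subspace_0)
  \<comment> \<open>\<open>K - L\<close> generates \<open>K\<close>: an element \<open>k\<close> of
    \<open>L\<close> is the sum of \<open>v\<close> and \<open>v + k\<close>, both outside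
    \<open>L\<close>.\<close>
  have gen: "K \<subseteq> S" if S: "vec.subspace S" and KL: "K - L \<subseteq> S" for S
  proof
    fix k assume k: "k \<in> K"
    show "k \<in> S"
    proof (cases "k \<in> L")
      case True
      then have "v + k \<in> S" "v \<in> S" using tr[OF v] v KL by auto
      then show ?thesis using add_mem_subspace_iff[OF S] by blast
    qed (use k KL in blast)
  qed
  consider "K - L \<subseteq> W" | "K - L \<subseteq> X - H"
    | w x where "w \<in> K - L" "w \<in> W" "x \<in> K - L" "x \<in> X - H"
    using del by blast
  then show ?thesis
  proof cases
    case 1
    then show ?thesis using gen[OF W] v L0 by auto
  next
    case 2
    then have "K \<subseteq> X" by (intro gen X) auto
    then show ?thesis using 2 v by blast
  next
    case 3
    have w0: "w \<noteq> 0" using 3 L0 by auto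
    then have p: "(w, x) \<in> pairs UNIV" using 3 by (simp add: pairs_def)
    \<comment> \<open>A sum of a nonzero vector of \<open>W\<close> and a vector of
      \<open>X - H\<close> lies in neither \<open>W\<close> nor \<open>X\<close>; it is a point of
      \<open>E\<close> and so belongs to \<open>L\<close>.\<close>
    have sumL: "a + b \<in> L" if "a \<in> K - L" "a \<in> W" "b \<in> K - L" "b \<in> X - H" for a b
    proof (rule ccontr)
      assume "a + b \<notin> L"
      moreover have "a + b \<in> K" using that K by (auto intro: vec.subspace_add)
      moreover have "(a, b) \<in> pairs UNIV" using that L0 by (auto simp: pairs_def)
      ultimately show False using del[of "a + b"] pairsD[of a b UNIV] by blast
    qed
    \<comment> \<open>The translates \<open>w + l\<close> and \<open>x + l\<close> are deleted, so
      each lies in \<open>W\<close> or \<open>X\<close>. Three of the four combinations force a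
      vector into \<open>W \<inter> X = {0}\<close> or \<open>x\<close> into \<open>W\<close>; the
      fourth puts \<open>w + x + l\<close> there and yields the claim.\<close>
    have Leq: "l = w + x" if l: "l \<in> L" "l \<noteq> 0" for l
    proof -
      have xl: "x + l \<in> W \<or> x + l \<in> X" and wl: "w + l \<in> W \<or> w + l \<in> X"
        using tr[OF 3(3) l(1)] tr[OF 3(1) l(1)] del by blast+
      note pD = pairsD[OF p]
      from wl show ?thesis
      proof
        assume "w + l \<in> W"
        then have lW: "l \<in> W" using add_mem_subspace_iff[OF W] pD by blast
        from xl show ?thesis
        proof
          assume "x + l \<in> W"
          then have "x \<in> W" using lW add_mem_subspace_iff[OF W, of l x] by (simp add: add.commute)
          then show ?thesis using pD by simp
        next
          assume "x + l \<in> X"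
          then have "l \<in> X" using add_mem_subspace_iff[OF X] pD by blast
          then show ?thesis using lW l WX_eq_0 by blast
        qed
      next
        assume wlX: "w + l \<in> X"
        from xl show ?thesis
        proof
          assume "x + l \<in> W"
          then have "w + (x + l) \<in> W" using add_mem_subspace_iff[OF W] pD by blast
          moreover have "x + (w + l) \<in> X" using wlX add_mem_subspace_iff[OF X] pD by blast
          ultimately have "w + (x + l) = 0" using WX_eq_0 by (simp add: add.left_commute)
          then show ?thesis by (simp add: bit_vec_add_eq_0_iff add.assoc[symmetric])
        next
          assume "x + l \<in> X"
          then have "l \<in> X" using add_mem_subspace_iff[OF X] pD by blast
          then have "w \<in> X" using wlX add_mem_subspace_iff[OF X, of l w] by (simp add: add.commute)
          then show ?thesis using pD by simp
        qed
      qed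
    qed
    have "K \<subseteq> line (w, x)"
    proof
      fix k assume k: "k \<in> K"
      consider "k \<in> L" | "k \<in> K - L" "k \<in> W" | "k \<in> K - L" "k \<in> X - H" using k del by blast
      then show "k \<in> line (w, x)"
      proof cases
        case 1
        then show ?thesis using Leq by (auto simp: line_def)
      next
        case 2
        then have "k + x \<in> L" using sumL 3 by blast
        moreover have "k + x \<noteq> 0" using 2 pairsD(8)[OF p] by (auto simp: bit_vec_add_eq_0_iff)
        ultimately have "k + x = w + x" by (rule Leq)
        then show ?thesis by (simp add: line_def)
      next
        case k: 3
        then have "w + k \<in> L" using sumL 3 by blast
        moreover have "w + k \<noteq> 0" using k 3 WX_eq_0 w0 by (auto simp: bit_vec_add_eq_0_iff)
        ultimately have "w + k = w + x" by (rule Leq)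
        then show ?thesis by (simp add: line_def)
      qed
    qed
    moreover have "line (w, x) \<subseteq> K"
      using 3 L0 LK K by (auto simp: line_def intro: vec.subspace_add)
    ultimately show ?thesis using p by blast
  qed
qed

lemma not_spanned_iff:
  assumes K: "vec.subspace K"
  shows "K \<notin> spanned \<longleftrightarrow>
    (K \<subseteq> W \<and> K \<noteq> {0}) \<or> (K \<subseteq> X \<and> \<not> K \<subseteq> H) \<or> (\<exists>p\<in>pairs UNIV. K = line p)"
proof -
  have "line p \<notin> spanned" if "p \<in> pairs UNIV" for p
  proof
    assume "line p \<in> spanned"
    from spanned_subset_line[OF this order.refl that] show False
      using pairsD[of "fst p" "snd p" UNIV] that by (auto simp: line_def mid_def)
  qed
  then show ?thesis
    using not_spanned_cases[OF K] spanned_subset_W spanned_subset_X by metis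
qed

lemma dim_mid:
  assumes "p \<in> pairs B"
  shows "vec.dim (mid p) = 1"
proof -
  have "card (mid p) = 2"
    using pairsD(12)[of "fst p" "snd p" B] assms by (simp add: mid_def card_insert_if)
  then have "(2::nat) ^ vec.dim (mid p) = 2 ^ 1"
    using card_subspace_bit[OF subspace_mid] by simp
  then show ?thesis by (simp only: power_inject_exp)
qed

lemma dim_line:
  assumes "p \<in> pairs B"
  shows "vec.dim (line p) = 2"
proof -
  obtain w x where p: "p = (w, x)" by force
  note pD = pairsD[OF assms[unfolded p]]
  have "card (line p) = 4"
    using pD by (auto simp: p line_def card_insert_if)
  then have "(2::nat) ^ vec.dim (line p) = 2 ^ 2"
    using card_subspace_bit[OF subspace_line'] by simp
  then show ?thesis by (simp only: power_inject_exp)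
qed

text \<open>All exceptional subspaces have dimension at most 7.\<close>

lemma spanned_UNIV: "UNIV \<in> spanned"
proof (rule ccontr)
  assume "UNIV \<notin> spanned"
  then consider "vec.dim (UNIV :: (bit ^ 10) set) \<le> vec.dim W"
    | "vec.dim (UNIV :: (bit ^ 10) set) \<le> vec.dim X"
    | "vec.dim (UNIV :: (bit ^ 10) set) = 2"
    using not_spanned_cases[of UNIV] dim_line vec.dim_subset by (metis vec.subspace_UNIV)
  then show False
    unfolding vec_dim_card using dim_W dim_X by cases auto
qed

text \<open>The sum of \<open>W\<close> and \<open>X\<close> is direct, so \<open>w + x\<close>
  determines both summands.\<close>

lemma inj_on_mid: "inj_on mid (pairs B)"
proof (rule inj_onI)
  fix p q assume pq: "p \<in> pairs B" "q \<in> pairs B" "mid p = mid q"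
  obtain w x w' x' where [simp]: "p = (w, x)" "q = (w', x')" by force
  note p = pairsD[OF pq(1)[simplified]] and q = pairsD[OF pq(2)[simplified]]
  have "w + x = w' + x'" using pq p q by (auto simp: mid_def)
  then have "w + w' = x + x'" by (metis add.assoc add.commute bit_vec_add_cancel)
  moreover have "w + w' \<in> W" "x + x' \<in> X"
    using p q W X by (auto intro: vec.subspace_add)
  ultimately have "w + w' = 0" "x + x' = 0" using WX_eq_0 by auto
  then show "p = q" by (simp add: bit_vec_add_eq_0_iff)
qed

lemma inj_on_line: "inj_on line (pairs B)"
proof (rule inj_onI)
  fix p q assume pq: "p \<in> pairs B" "q \<in> pairs B" "line p = line q"
  obtain w x w' x' where [simp]: "p = (w, x)" "q = (w', x')" by force
  note p = pairsD[OF pq(1)[simplified]] and q = pairsD[OF pq(2)[simplified]]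
  have "line p \<inter> W = {0, w}" "line q \<inter> W = {0, w'}" "line p \<inter> X = {0, x}" "line q \<inter> X = {0, x'}"
    using p q by (auto simp: line_def)
  then have "{0, w} = {0, w'}" "{0, x} = {0, x'}" using pq(3) by metis+
  then show "p = q" using p q by (auto simp: doubleton_eq_iff)
qed

end

section \<open>The Kazhdan--Lusztig polynomials of the intervals\<close>

context deleted_geometry begin

text \<open>For a subspace \<open>A\<close> of \<open>H\<close> these are the non-spanned subspaces
  of \<open>B \<inter> X\<close> whose spanned part is \<open>A\<close>, that is, whose trace on
  \<open>H\<close> is \<open>A\<close> (\<open>transversal_iff\<close>).\<close>

definition transversal :: "(bit ^ 10) set \<Rightarrow> (bit ^ 10) set \<Rightarrow> (bit ^ 10) set set" where
  "transversal A B = {K \<in> layer A (B \<inter> X) 1. \<not> K \<subseteq> H}"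

text \<open>In this case \<open>vec.dim B = vec.dim (B \<inter> H) + 2\<close>, so t times the
  generating function of the interval from \<open>A\<close> to \<open>B \<inter> H\<close> is itself
  palindromic for the interval from \<open>A\<close> to \<open>B\<close>. Hence \<open>pX\<close>
  may be lowered by 1 throughout, and it has to be: otherwise intervals of length 2 would keep a
  linear term.\<close>

definition codim_one :: "(bit ^ 10) set \<Rightarrow> bool" where
  "codim_one B \<longleftrightarrow> \<not> B \<inter> X \<subseteq> H \<and> vec.dim B = vec.dim (B \<inter> X) + 1"

definition pX :: "(bit ^ 10) set \<Rightarrow> (bit ^ 10) set \<Rightarrow> int" where
  "pX A B = int (card (transversal A B)) - of_bool (codim_one B)"

text \<open>For 0 < k \<le> n this is the only polynomial of degree below n/2 that differs from t^k
  by a palindromic polynomial for n.\<close>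

definition phi :: "nat \<Rightarrow> nat \<Rightarrow> int poly" where
  "phi k n = (if 2 * k < n then monom 1 k else if 2 * k = n then 0 else monom (- 1) (n - k))"

text \<open>
  \<open>1 + p A B\<close> is the Kazhdan--Lusztig polynomial of the interval \<open>[A, B]\<close>. Each non-spanned \<open>K\<close> below
  \<open>B\<close> whose spanned part is \<open>A\<close> contributes \<open>phi\<close>, which cancels the missing term of the rank
  generating function modulo palindromic polynomials; the remaining terms occur in small codimension.
\<close>

definition p :: "(bit ^ 10) set \<Rightarrow> (bit ^ 10) set \<Rightarrow> int poly" where
  "p A B =
    (if A = {0} then monom (pX {0} B - of_bool (vec.dim B = 3) * int (card (pairs B))) 1
        + (\<Sum>K\<in>interval {0} (W \<inter> B) - {{0}}. phi (vec.dim K) (vec.dim B))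
     else if A \<subseteq> H then monom (pX A B) 1
     else if (\<exists>q\<in>pairs B. A = mid q) \<and> vec.dim B \<ge> 4 then monom 1 1
     else 0)"

section \<open>Traces of subspaces of \<open>X\<close> on the hyperplane \<open>H\<close>\<close>

lemma Int_subspace: "vec.subspace S \<Longrightarrow> vec.subspace T \<Longrightarrow> vec.subspace (S \<inter> T)"
  by (rule vec.subspace_inter)

lemma dim_Int_H:
  assumes K: "vec.subspace K" "K \<subseteq> X" "\<not> K \<subseteq> H"
  shows "vec.dim K = vec.dim (K \<inter> H) + 1"
proof -
  obtain x where x: "x \<in> K" "x \<notin> H" using K by blast
  let ?S = "vec.span (insert x (K \<inter> H))"
  have sub: "vec.subspace (K \<inter> H)" by (rule Int_subspace[OF K(1) H])
  have "?S = K"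
  proof (rule antisym)
    show "?S \<subseteq> K" using K x by (intro vec.span_minimal) auto
    show "K \<subseteq> ?S"
    proof
      fix y assume y: "y \<in> K"
      show "y \<in> ?S"
      proof (cases "y \<in> H")
        case True
        then show ?thesis using y by (intro vec.span_base) simp
      next
        case False
        then have "x + y \<in> K \<inter> H"
          using x y K X_minus_H_add[of x y] by (auto intro: vec.subspace_add)
        then have "x + (x + y) \<in> ?S"
          by (metis vec.span_add vec.span_base insertI1 insertI2)
        then show ?thesis by simp
      qed
    qed
  qed
  then have "vec.dim K = vec.dim (insert x (K \<inter> H))" by (metis vec.dim_span)
  then show ?thesis using dim_insert_subspace[OF sub, of x] x by simp
qed

lemma transversal_iff:
  assumes A: "vec.subspace A" "A \<subseteq> H"
  shows "K \<in> transversal A B \<longleftrightarrow> vec.subspace K \<and> K \<subseteq> B \<inter> X \<and> \<not> K \<subseteq> H \<and> K \<inter> H = A"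
proof
  assume K: "K \<in> transversal A B"
  then have K': "vec.subspace K" "A \<subseteq> K" "K \<subseteq> B \<inter> X" "\<not> K \<subseteq> H" "vec.dim K = vec.dim A + 1"
    by (auto simp: transversal_def layer_def interval_def)
  have "A = K \<inter> H"
    using K' A dim_Int_H[of K]
    by (intro vec.subspace_dim_equal[OF A(1) Int_subspace[OF K'(1) H]]) auto
  with K' show "vec.subspace K \<and> K \<subseteq> B \<inter> X \<and> \<not> K \<subseteq> H \<and> K \<inter> H = A" by simp
next
  assume K: "vec.subspace K \<and> K \<subseteq> B \<inter> X \<and> \<not> K \<subseteq> H \<and> K \<inter> H = A"
  then have "vec.dim K = vec.dim A + 1" using dim_Int_H[of K] by auto
  then show "K \<in> transversal A B" using K by (auto simp: transversal_def layer_def interval_def)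
qed

text \<open>The sum is grouped along \<open>K \<mapsto> K \<inter> H\<close>, whose fibre over
  \<open>C\<close> is \<open>transversal C B\<close>.\<close>

lemma sum_transversal:
  assumes A: "vec.subspace A" "A \<subseteq> H"
  shows "(\<Sum>C\<in>interval A (B \<inter> H). \<Sum>K\<in>transversal C B. f K) = (\<Sum>K\<in>{K \<in> interval A (B \<inter> X). \<not> K \<subseteq> H}. f K)"
proof -
  have transversal: "K \<in> transversal C B \<longleftrightarrow> vec.subspace K \<and> K \<subseteq> B \<inter> X \<and> \<not> K \<subseteq> H \<and> K \<inter> H = C"
    if "C \<in> interval A (B \<inter> H)" for C K
    using transversal_iff[of C K B] that by (auto simp: interval_def)
  have "(\<Union>C\<in>interval A (B \<inter> H). transversal C B) = {K \<in> interval A (B \<inter> X). \<not> K \<subseteq> H}"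
  proof (intro equalityI subsetI)
    fix K assume "K \<in> (\<Union>C\<in>interval A (B \<inter> H). transversal C B)"
    then obtain C where "C \<in> interval A (B \<inter> H)" "K \<in> transversal C B" by blast
    then show "K \<in> {K \<in> interval A (B \<inter> X). \<not> K \<subseteq> H}"
      using transversal by (auto simp: interval_def)
  next
    fix K assume K: "K \<in> {K \<in> interval A (B \<inter> X). \<not> K \<subseteq> H}"
    then have "K \<inter> H \<in> interval A (B \<inter> H)"
      using A Int_subspace[OF _ H, of K] by (auto simp: interval_def)
    moreover from this have "K \<in> transversal (K \<inter> H) B" using K transversal by (auto simp: interval_def)
    ultimately show "K \<in> (\<Union>C\<in>interval A (B \<inter> H). transversal C B)" by blast
  qed
  moreover have "(\<Sum>K\<in>(\<Union>C\<in>interval A (B \<inter> H). transversal C B). f K) =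
      (\<Sum>C\<in>interval A (B \<inter> H). \<Sum>K\<in>transversal C B. f K)"
    using transversal by (intro sum.UNION_disjoint) auto
  ultimately show ?thesis by simp
qed

lemma palindromic_monom_mult:
  assumes "palindromic n q" "m = n + 2 * k"
  shows "palindromic m (monom 1 k * q)"
proof -
  have eq: "coeff q j = (if j \<le> n then coeff q (n - j) else 0)" for j
    using assms(1) unfolding palindromic_def by blast
  have "coeff (monom 1 k * q) j = (if j \<le> m then coeff (monom 1 k * q) (m - j) else 0)" for j
  proof (cases "j < k")
    case True
    then show ?thesis using eq[of "m - j - k"] by (simp add: assms(2) coeff_monom_mult)
  next
    case False
    have "n - (j - k) = m - j - k" if "j - k \<le> n" using that False by (simp add: assms(2))
    then show ?thesis using False eq[of "j - k"] by (auto simp: assms(2) coeff_monom_mult)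
  qed
  then show ?thesis by (simp add: palindromic_def)
qed

lemma palindromic_interval:
  assumes A: "vec.subspace A" and B: "vec.subspace B" and AB: "(A :: (bit ^ 10) set) \<subseteq> B"
  shows "palindromic (vec.dim B - vec.dim A) (\<Sum>C\<in>interval A B. monom 1 (vec.dim C - vec.dim A))"
proof -
  let ?n = "vec.dim B - vec.dim A"
  have n: "?n \<le> 10"
    using vec.dim_subset[of B UNIV] unfolding vec_dim_card by simp
  have "(\<Sum>C\<in>interval A B. monom 1 (vec.dim C - vec.dim A)) =
      (\<Sum>j\<le>?n. of_nat (gauss ?n j) * monom (1::int) j)"
    using sum_interval[OF A B AB, of "\<lambda>k. monom 1 (k - vec.dim A)"] by simp
  also have "\<dots> = (\<Sum>j\<le>?n. monom (int (gauss ?n j)) j)"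
    by (simp add: of_nat_poly smult_monom)
  finally show ?thesis
    using gauss_symmetric[OF n] by (auto simp: palindromic_def coeff_sum)
qed

lemma palindromic_phi: "k \<le> n \<Longrightarrow> palindromic n (phi k n - monom 1 k)"
  by (auto simp: palindromic_def phi_def split: if_splits)

lemma pairs_subset: "q \<in> pairs B \<Longrightarrow> vec.subspace B \<Longrightarrow> line q \<subseteq> B \<and> mid q \<subseteq> B"
  by (auto simp: pairs_def line_def mid_def intro: vec.subspace_add vec.subspace_0)

lemma line_subset_iff:
  assumes "q \<in> pairs UNIV" "vec.subspace B"
  shows "line q \<subseteq> B \<longleftrightarrow> q \<in> pairs B"
  using assms pairs_subset[of q B] by (auto simp: pairs_def line_def)

lemma mid_not_subset_H: "q \<in> pairs B \<Longrightarrow> \<not> mid q \<subseteq> H"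
  using pairsD(11)[of "fst q" "snd q" B] HX by (auto simp: mid_def)

lemma mid_neq_zero: "q \<in> pairs B \<Longrightarrow> mid q \<noteq> {0}"
  using mid_not_subset_H zero_mem(3) by (metis empty_subsetI insert_subset)

lemma line_not_subset:
  assumes "q \<in> pairs B"
  shows "\<not> line q \<subseteq> W" "\<not> line q \<subseteq> X"
  using pairsD(10,11)[of "fst q" "snd q" B] assms by (auto simp: line_def)

lemma subset_mid:
  assumes "A \<subseteq> mid q" "0 \<in> A"
  shows "A = {0} \<or> A = mid q"
  using assms by (auto simp: mid_def)

lemma dim_Int_X_less:
  assumes B: "vec.subspace B" "\<not> B \<subseteq> X"
  shows "vec.dim (B \<inter> X) < vec.dim B"
proof -
  have "B \<inter> X \<subset> B" using B by blast
  moreover have "vec.span (B \<inter> X) = B \<inter> X" "vec.span B = B"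
    using Int_subspace[OF B(1) X] B(1) by auto
  ultimately show ?thesis using vec.dim_psubset by metis
qed

text \<open>
  The lattice of all subspaces has a palindromic rank generating function, so only the subspaces
  outside \<open>spanned\<close> have to be compensated.
\<close>

lemma sum_spanned_interval:
  fixes f :: "(bit ^ 10) set \<Rightarrow> 'b::ab_group_add"
  shows "(\<Sum>C\<in>interval A B \<inter> spanned. f C) = (\<Sum>C\<in>interval A B. f C) - (\<Sum>C\<in>interval A B - spanned. f C)"
  by (subst sum.Int_Diff[of "interval A B" _ spanned]) simp_all

section \<open>The missing subspaces above each kind of flat\<close>

lemma not_spanned_above_zero:
  assumes B: "B \<in> spanned"
  shows "interval {0} B - spanned = (interval {0} (W \<inter> B) - {{0}}) \<union> {K \<in> interval {0} (B \<inter> X). \<not> K \<subseteq> H}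
    \<union> line ` pairs B"
    (is "_ = ?R")
proof (rule set_eqI)
  fix K
  show "K \<in> interval {0} B - spanned \<longleftrightarrow> K \<in> ?R"
  proof (cases "vec.subspace K")
    case True
    have "0 \<in> K" using True by (rule vec.subspace_0)
    then have 1: "K \<in> interval {0} B - spanned \<longleftrightarrow> K \<subseteq> B \<and> K \<notin> spanned"
      and 2: "K \<in> ?R \<longleftrightarrow> K \<subseteq> W \<and> K \<subseteq> B \<and> K \<noteq> {0} \<or> K \<subseteq> B \<and> K \<subseteq> X \<and> \<not> K \<subseteq> H \<or> K \<in> line ` pairs B"
      using True by (simp_all add: interval_def)
    have 3: "K \<in> line ` pairs B \<longleftrightarrow> (\<exists>q\<in>pairs UNIV. K = line q) \<and> K \<subseteq> B"
    proof -
      have "pairs B \<subseteq> pairs UNIV" by (auto simp: pairs_def)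
      then show ?thesis using line_subset_iff[OF _ subspace_spanned[OF B]] by blast
    qed
    show ?thesis
      unfolding 1 2 3 not_spanned_iff[OF True] by argo
  next
    case False
    then have "K \<notin> line ` pairs B" using subspace_line' by blast
    with False show ?thesis by (simp add: interval_def)
  qed
qed

lemma sum_not_spanned_above_zero:
  fixes f :: "(bit ^ 10) set \<Rightarrow> 'b::comm_monoid_add"
  assumes B: "B \<in> spanned"
  shows "(\<Sum>K\<in>interval {0} B - spanned. f K) = (\<Sum>K\<in>interval {0} (W \<inter> B) - {{0}}. f K)
    + (\<Sum>K\<in>{K \<in> interval {0} (B \<inter> X). \<not> K \<subseteq> H}. f K) + (\<Sum>q\<in>pairs B. f (line q))"
proof -
  let ?U = "interval {0} (W \<inter> B) - {{0}}" and ?T = "{K \<in> interval {0} (B \<inter> X). \<not> K \<subseteq> H}"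
  have UW: "K \<subseteq> W" if "K \<in> ?U" for K
    using that by (simp add: interval_def)
  have TX: "K \<subseteq> X \<and> \<not> K \<subseteq> H" if "K \<in> ?T" for K
    using that by (simp add: interval_def)
  have 1: "?U \<inter> ?T = {}"
  proof (rule Int_emptyI)
    fix K assume "K \<in> ?U" "K \<in> ?T"
    then have "K \<subseteq> W \<inter> X" "\<not> K \<subseteq> H" using UW TX by blast+
    then show False using WX zero_mem(3) by auto
  qed
  have 2: "(?U \<union> ?T) \<inter> line ` pairs B = {}"
  proof (rule Int_emptyI)
    fix K assume K: "K \<in> ?U \<union> ?T" "K \<in> line ` pairs B"
    from K(1) have "K \<subseteq> W \<or> K \<subseteq> X" using UW TX by (elim UnE) simp_all
    with K(2) show False using line_not_subset by auto
  qed
  have "sum f (interval {0} B - spanned) = sum f (?U \<union> ?T) + sum f (line ` pairs B)"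
    unfolding not_spanned_above_zero[OF B] by (rule sum.union_disjoint[OF _ _ 2]) simp_all
  also have "sum f (?U \<union> ?T) = sum f ?U + sum f ?T"
    by (rule sum.union_disjoint[OF _ _ 1]) simp_all
  also have "sum f (line ` pairs B) = (\<Sum>q\<in>pairs B. f (line q))"
    by (rule sum.reindex[OF inj_on_line, unfolded o_def])
  finally show ?thesis .
qed

lemma not_spanned_above_H:
  assumes A: "A \<in> spanned" "A \<subseteq> H" "A \<noteq> {0}" and B: "B \<in> spanned"
  shows "interval A B - spanned = {K \<in> interval A (B \<inter> X). \<not> K \<subseteq> H}"
proof (rule set_eqI)
  fix K
  have nW: "\<not> K \<subseteq> W" if "A \<subseteq> K"
    using that A spanned_subset_W order.trans by metis
  have nL: "K \<noteq> line q" if "A \<subseteq> K" "q \<in> pairs UNIV" for q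
    using that spanned_subset_line[OF A(1) _ that(2)] A mid_not_subset_H[OF that(2)] by metis
  show "K \<in> interval A B - spanned \<longleftrightarrow> K \<in> {K \<in> interval A (B \<inter> X). \<not> K \<subseteq> H}"
  proof (cases "vec.subspace K \<and> A \<subseteq> K")
    case True
    then show ?thesis using not_spanned_iff[of K] nW nL by (simp add: interval_def)
  next
    case False
    then show ?thesis unfolding interval_def by simp argo
  qed
qed

lemma not_spanned_above_mid:
  assumes q: "q \<in> pairs UNIV" and B: "B \<in> spanned"
  shows "interval (mid q) B - spanned = (if q \<in> pairs B then {line q} else {})"
proof -
  obtain w x where wx: "q = (w, x)" by force
  note qD = pairsD[OF q[unfolded wx]]
  have "\<not> mid q \<subseteq> W" "\<not> mid q \<subseteq> X" using qD by (auto simp: mid_def wx)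
  moreover have "q' = q" if "q' \<in> pairs UNIV" "mid q \<subseteq> line q'" for q'
  proof -
    have "mid q = mid q'"
      using spanned_subset_line[OF spanned_mid[OF q] that(2,1)] mid_neq_zero[OF q] by simp
    from inj_onD[OF inj_on_mid this q that(1)] show ?thesis by simp
  qed
  moreover have "mid q \<subseteq> line q" by (auto simp: mid_def line_def)
  moreover have "\<And>K. mid q \<subseteq> K \<Longrightarrow> K \<subseteq> W \<Longrightarrow> mid q \<subseteq> W" "\<And>K. mid q \<subseteq> K \<Longrightarrow> K \<subseteq> X \<Longrightarrow> mid q \<subseteq> X"
    by (erule (1) order.trans)+
  ultimately have eq: "vec.subspace K \<and> mid q \<subseteq> K \<and> K \<notin> spanned \<longleftrightarrow> K = line q" for K
    using not_spanned_iff[of K] q subspace_line' by metis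
  have "K \<in> interval (mid q) B - spanned \<longleftrightarrow> K = line q \<and> K \<subseteq> B" for K
    unfolding eq[symmetric] interval_def by (simp only: mem_Collect_eq Diff_iff) argo
  then show ?thesis
    using line_subset_iff[OF q subspace_spanned[OF B]] by auto
qed

text \<open>The flats above which a subspace can be missing. They are closed downwards among the
  flats (\<open>special_below\<close>), so the remaining ones are closed upwards and admit an
  induction from the top.\<close>

definition special :: "(bit ^ 10) set \<Rightarrow> bool" where
  "special A \<longleftrightarrow> A \<subseteq> H \<or> A \<in> mid ` pairs UNIV"

lemma not_spanned_above_nonspecial:
  assumes A: "A \<in> spanned" "\<not> special A"
  shows "interval A B \<subseteq> spanned"
proof
  fix K assume K: "K \<in> interval A B"
  have "A \<noteq> {0}" using A by (auto simp: special_def)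
  then have "\<not> A \<subseteq> W" "\<not> A \<subseteq> X" "\<And>q. q \<in> pairs UNIV \<Longrightarrow> \<not> A \<subseteq> line q"
    using A spanned_subset_W spanned_subset_X spanned_subset_line unfolding special_def by (metis imageI)+
  moreover have "vec.subspace K" "A \<subseteq> K" using K by (simp_all add: interval_def)
  ultimately show "K \<in> spanned" using not_spanned_cases[of K] order.trans by metis
qed

section \<open>Vanishing and degree of \<open>p\<close>\<close>

lemma p_nonspecial: "A \<in> spanned \<Longrightarrow> \<not> special A \<Longrightarrow> p A B = 0"
  unfolding p_def special_def by (auto simp: pairs_def image_iff)

lemma pX_eq_0: "B \<inter> X \<subseteq> H \<Longrightarrow> pX A B = 0"
proof -
  assume B: "B \<inter> X \<subseteq> H"
  then have "K \<notin> transversal A B" for K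
    using order.trans[OF _ B] by (simp add: transversal_def layer_def interval_def)
  then have "transversal A B = {}" by blast
  with B show ?thesis by (simp add: pX_def codim_one_def)
qed

lemma dim_B_Int_H:
  assumes "vec.subspace B" "\<not> B \<inter> X \<subseteq> H"
  shows "vec.dim (B \<inter> X) = vec.dim (B \<inter> H) + 1"
proof -
  have "B \<inter> X \<inter> H = B \<inter> H" using HX by blast
  then show ?thesis
    using dim_Int_H[OF Int_subspace[OF assms(1) X]] assms by simp
qed

text \<open>On so short an interval either \<open>B \<inter> X\<close> lies in \<open>H\<close>, or
  \<open>B \<inter> X\<close> is the only transversal and the \<open>codim_one\<close> term cancels
  it.\<close>

lemma pX_eq_0_small:
  assumes A: "vec.subspace A" "A \<subseteq> H"
    and B: "vec.subspace B" "A \<subseteq> B" "vec.dim B - vec.dim A \<le> 2" "\<not> B \<subseteq> X"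
  shows "pX A B = 0"
proof (cases "B \<inter> X \<subseteq> H")
  case False
  have lt: "vec.dim (B \<inter> X) < vec.dim B" using dim_Int_X_less[OF B(1,4)] .
  have eq: "vec.dim (B \<inter> X) = vec.dim (B \<inter> H) + 1"
    using dim_B_Int_H[OF B(1) False] .
  have "vec.dim A \<le> vec.dim (B \<inter> H)" using A B by (intro vec.dim_subset) auto
  with lt eq B(3) have dims: "vec.dim (B \<inter> X) = vec.dim A + 1" "vec.dim B = vec.dim (B \<inter> X) + 1"
    by linarith+
  have sub: "vec.subspace (B \<inter> X)" using Int_subspace[OF B(1) X] .
  have "K \<in> transversal A B \<longleftrightarrow> K = B \<inter> X" for K
  proof
    assume "K \<in> transversal A B"
    then show "K = B \<inter> X"
      using dims sub vec.subspace_dim_equal[of K "B \<inter> X"] by (simp add: transversal_def layer_def interval_def)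
  next
    assume "K = B \<inter> X"
    then show "K \<in> transversal A B"
      using dims sub False A B HX by (auto simp: transversal_def layer_def interval_def)
  qed
  then have "transversal A B = {B \<inter> X}" by blast
  then show ?thesis using False dims by (simp add: pX_def codim_one_def)
qed (rule pX_eq_0)

lemma dim_of_pairs:
  assumes B: "B \<in> spanned" and q: "q \<in> pairs B"
  shows "vec.dim B \<ge> 3"
proof -
  have "q \<in> pairs UNIV" using q by (auto simp: pairs_def)
  then have "line q \<notin> spanned" using not_spanned_iff[OF subspace_line'] by blast
  moreover have "line q \<subseteq> B" using pairs_subset[OF q subspace_spanned[OF B]] by simp
  ultimately have "line q \<subset> B" using B by blast
  moreover have "vec.span (line q) = line q" "vec.span B = B"
    using subspace_line' subspace_spanned[OF B] by simp_all
  ultimately have "vec.dim (line q) < vec.dim B" using vec.dim_psubset by metis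
  then show ?thesis using dim_line[OF q] by simp
qed

lemma mid_in_mid_pairs_iff:
  assumes "q \<in> pairs UNIV"
  shows "(\<exists>q'\<in>pairs B. mid q = mid q') \<longleftrightarrow> q \<in> pairs B"
proof -
  have "pairs B \<subseteq> pairs UNIV" by (auto simp: pairs_def)
  then show ?thesis using inj_onD[OF inj_on_mid, of q _ UNIV] assms by blast
qed

lemma p_mid:
  assumes "q \<in> pairs UNIV"
  shows "p (mid q) B = (if q \<in> pairs B \<and> vec.dim B \<ge> 4 then monom 1 1 else 0)"
proof -
  show ?thesis
    using mid_neq_zero[OF assms] mid_not_subset_H[OF assms] mid_in_mid_pairs_iff[OF assms]
    by (simp add: p_def)
qed

lemma p_below_H: "A \<subseteq> H \<Longrightarrow> A \<noteq> {0} \<Longrightarrow> p A B = monom (pX A B) 1"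
  by (simp add: p_def)

text \<open>A special \<open>B\<close> lies in \<open>H\<close> or has a single nonzero vector,
  which is in \<open>E\<close>; either way all its subspaces are spanned. This makes the correction
  of \<open>Q\<close> linear in \<open>p\<close>.\<close>

lemma p_special_right:
  assumes B: "B \<in> spanned" "special B"
  shows "p A B = 0"
proof -
  have *: "B \<inter> X \<subseteq> H \<and> B \<inter> W = {0} \<and> pairs B = {}"
  proof (cases "B \<subseteq> H")
    case True
    then have "B \<inter> W = {0}" using HX WX zero_in_spanned_elem[OF B(1)] by auto
    with True show ?thesis by (auto simp: pairs_def)
  next
    case False
    then obtain q where q: "q \<in> pairs UNIV" "B = mid q" using B by (auto simp: special_def)
    then show ?thesis
      using pairsD(10,11)[of "fst q" "snd q" UNIV] by (auto simp: mid_def pairs_def)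
  qed
  then have "W \<inter> B = {0}" by blast
  then have empty: "interval {0} (W \<inter> B) - {{0}} = {}"
    by (auto simp: interval_def)
  show ?thesis
    using * by (simp add: p_def pX_eq_0 empty)
qed

lemma degree_phi: "0 < k \<Longrightarrow> k \<le> n \<Longrightarrow> degree (phi k n) \<le> (n - 1) div 2"
  using degree_monom_le[of "1::int" k] degree_monom_le[of "- 1::int" "n - k"]
  by (auto simp: phi_def)

lemma dim_pos: "K \<in> interval {0} S - {{0}} \<Longrightarrow> 0 < vec.dim K"
  using vec.subspace_0 by (auto simp: interval_def intro!: gr0I)

text \<open>For \<open>A\<close> properly below \<open>B\<close> the bound says that twice the
  degree is less than the length of the interval. The delicate case is length at most 2, where the
  linear terms have to vanish.\<close>

lemma degree_p:
  assumes A: "A \<in> spanned" and B: "B \<in> spanned" and AB: "A \<subseteq> B"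
  shows "degree (p A B) \<le> (vec.dim B - vec.dim A - 1) div 2"
proof -
  let ?d = "(vec.dim B - vec.dim A - 1) div 2"
  have X: "degree (monom (pX A B) 1) \<le> ?d" if "A \<subseteq> H"
  proof (cases "vec.dim B - vec.dim A \<le> 2")
    case True
    show ?thesis
    proof (cases "B \<subseteq> X")
      case True
      then have "B \<inter> X \<subseteq> H" using spanned_subset_X[OF B] by blast
      then show ?thesis by (simp add: pX_eq_0)
    next
      case False
      then show ?thesis
        using pX_eq_0_small[OF subspace_spanned[OF A] that subspace_spanned[OF B] AB True] by simp
    qed
  next
    case False
    then show ?thesis using degree_monom_le[of "pX A B" 1] by linarith
  qed
  consider "A = {0}" | "A \<subseteq> H" "A \<noteq> {0}" | q where "q \<in> pairs UNIV" "A = mid q" | "\<not> special A"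
    unfolding special_def by blast
  then show ?thesis
  proof cases
    case 1
    let ?e = "of_bool (vec.dim B = 3) * int (card (pairs B))"
    have "degree (monom ?e 1) \<le> ?d"
      using degree_monom_le[of ?e 1] 1 by (cases "vec.dim B = 3") auto
    moreover have "degree (\<Sum>K\<in>interval {0} (W \<inter> B) - {{0}}. phi (vec.dim K) (vec.dim B)) \<le> ?d"
    proof (rule degree_sum_le)
      fix K assume K: "K \<in> interval {0} (W \<inter> B) - {{0}}"
      then have "vec.dim K \<le> vec.dim B" by (intro vec.dim_subset) (simp add: interval_def)
      then show "degree (phi (vec.dim K) (vec.dim B)) \<le> ?d"
        using degree_phi[OF dim_pos[OF K]] 1 by simp
    qed simp
    moreover have "degree (monom (pX {0} B) 1) \<le> ?d" using X 1 by simp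
    ultimately show ?thesis
      using 1 by (simp add: p_def diff_monom[symmetric] degree_add_le degree_diff_le)
  next
    case 2
    then show ?thesis using X by (simp add: p_below_H)
  next
    case 3
    then show ?thesis
      using degree_monom_le[of "1::int" 1] by (auto simp: p_mid dim_mid)
  next
    case 4
    then show ?thesis using A by (simp add: p_nonspecial)
  qed
qed

text \<open>A transversal of \<open>C\<close> has dimension \<open>vec.dim C + 1\<close>, so the
  \<open>card\<close> part of \<open>pX\<close> cancels the missing terms exactly. What is left is
  the \<open>codim_one\<close> term, palindromic by itself.\<close>

lemma palindromic_X_part:
  assumes A: "vec.subspace A" "A \<subseteq> H" "A \<subseteq> B" and B: "B \<in> spanned"
  shows "palindromic (vec.dim B - vec.dim A)
    ((\<Sum>C\<in>interval A (B \<inter> H). monom 1 (vec.dim C - vec.dim A) * monom (pX C B) 1) -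
     (\<Sum>K\<in>{K \<in> interval A (B \<inter> X). \<not> K \<subseteq> H}. monom 1 (vec.dim K - vec.dim A)))"
proof -
  let ?a = "vec.dim A"
  let ?S = "\<Sum>C\<in>interval A (B \<inter> H). monom (1::int) (vec.dim C - ?a)"
  have "monom 1 (vec.dim C - ?a) * monom (pX C B) 1 =
      (\<Sum>K\<in>transversal C B. monom 1 (vec.dim K - ?a)) - smult (of_bool (codim_one B)) (monom 1 1 * monom 1 (vec.dim C - ?a))"
    if C: "C \<in> interval A (B \<inter> H)" for C
  proof -
    have "?a \<le> vec.dim C" using C by (intro vec.dim_subset) (simp add: interval_def)
    then have "(\<Sum>K\<in>transversal C B. monom (1::int) (vec.dim K - ?a)) = (\<Sum>K\<in>transversal C B. monom 1 (Suc (vec.dim C - ?a)))"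
      by (intro sum.cong refl) (auto simp: transversal_def layer_def Suc_diff_le)
    also have "\<dots> = monom (int (card (transversal C B))) (Suc (vec.dim C - ?a))"
      by (simp add: of_nat_poly smult_monom)
    finally show ?thesis
      by (simp add: mult_monom smult_monom pX_def diff_monom)
  qed
  then have "(\<Sum>C\<in>interval A (B \<inter> H). monom 1 (vec.dim C - ?a) * monom (pX C B) 1) =
      (\<Sum>C\<in>interval A (B \<inter> H). \<Sum>K\<in>transversal C B. monom 1 (vec.dim K - ?a)) -
      smult (of_bool (codim_one B)) (monom 1 1 * ?S)"
    by (simp add: sum_subtractf smult_sum_right sum_distrib_left)
  moreover have "palindromic (vec.dim B - ?a) (smult (of_bool (codim_one B)) (monom 1 1 * ?S))"
  proof (cases "codim_one B")
    case True
    then have dims: "vec.dim B = vec.dim (B \<inter> H) + 2"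
      using dim_B_Int_H[OF subspace_spanned[OF B]] by (simp add: codim_one_def)
    have "?a \<le> vec.dim (B \<inter> H)" using A by (intro vec.dim_subset) auto
    moreover have "palindromic (vec.dim (B \<inter> H) - ?a) ?S"
      using A by (intro palindromic_interval Int_subspace[OF subspace_spanned[OF B] H]) auto
    ultimately show ?thesis
      using dims by (intro palindromic_smult palindromic_monom_mult[of "vec.dim (B \<inter> H) - ?a"]) auto
  qed simp
  ultimately show ?thesis
    by (simp add: sum_transversal[OF A(1,2)] palindromic_minus)
qed

lemma sum_zero_interval_spanned:
  fixes f :: "(bit ^ 10) set \<Rightarrow> 'b::comm_monoid_add"
  assumes B: "B \<in> spanned" and f: "\<And>C. C \<in> spanned \<Longrightarrow> C \<subseteq> B \<Longrightarrow> \<not> C \<subseteq> H \<Longrightarrow> C \<notin> mid ` pairs B \<Longrightarrow> f C = 0"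
  shows "(\<Sum>C\<in>interval {0} B \<inter> spanned. f C) = (\<Sum>C\<in>interval {0} (B \<inter> H). f C) + (\<Sum>q\<in>pairs B. f (mid q))"
proof -
  have "interval {0} (B \<inter> H) \<union> mid ` pairs B \<subseteq> interval {0} B \<inter> spanned"
    using pairs_subset[OF _ subspace_spanned[OF B]] spanned_below_H spanned_mid subspace_mid zero_in_spanned_elem
    by (auto simp: interval_def)
  moreover have "f C = 0" if "C \<in> interval {0} B \<inter> spanned - (interval {0} (B \<inter> H) \<union> mid ` pairs B)" for C
    using that by (intro f) (auto simp: interval_def)
  ultimately have "(\<Sum>C\<in>interval {0} B \<inter> spanned. f C) = (\<Sum>C\<in>interval {0} (B \<inter> H) \<union> mid ` pairs B. f C)"
    by (intro sum.mono_neutral_right) auto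
  also have "\<dots> = (\<Sum>C\<in>interval {0} (B \<inter> H). f C) + (\<Sum>C\<in>mid ` pairs B. f C)"
    using mid_not_subset_H by (intro sum.union_disjoint) (auto simp: interval_def)
  also have "(\<Sum>C\<in>mid ` pairs B. f C) = (\<Sum>q\<in>pairs B. f (mid q))"
    by (rule sum.reindex[OF inj_on_mid, unfolded o_def])
  finally show ?thesis .
qed

lemma p_zero_outside:
  assumes "C \<in> spanned" "\<not> C \<subseteq> H" "C \<notin> mid ` pairs B"
  shows "p C B = 0"
  using assms by (auto simp: p_def)

lemma sum_H_interval_spanned:
  fixes f :: "(bit ^ 10) set \<Rightarrow> int poly"
  assumes A: "A \<in> spanned" "A \<subseteq> H" "A \<noteq> {0}"
  shows "(\<Sum>C\<in>interval A B \<inter> spanned. f C * p C B) = (\<Sum>C\<in>interval A (B \<inter> H). f C * monom (pX C B) 1)"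
proof -
  have "(\<Sum>C\<in>interval A B \<inter> spanned. f C * p C B) = (\<Sum>C\<in>interval A (B \<inter> H). f C * p C B)"
  proof (rule sum.mono_neutral_right)
    show "interval A (B \<inter> H) \<subseteq> interval A B \<inter> spanned"
      using spanned_below_H by (auto simp: interval_def)
    show "\<forall>C\<in>interval A B \<inter> spanned - interval A (B \<inter> H). f C * p C B = 0"
    proof
      fix C assume C: "C \<in> interval A B \<inter> spanned - interval A (B \<inter> H)"
      then have AC: "A \<subseteq> C" and nH: "\<not> C \<subseteq> H" and CL: "C \<in> spanned" by (auto simp: interval_def)
      have "C \<notin> mid ` pairs B"
      proof
        assume "C \<in> mid ` pairs B"
        then obtain q where q: "q \<in> pairs B" "C = mid q" by blast
        then show False
          using subset_mid[of A q] AC A zero_in_spanned_elem[OF A(1)] nH by auto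
      qed
      then show "f C * p C B = 0" using p_zero_outside[OF CL nH] by simp
    qed
  qed simp
  also have "\<dots> = (\<Sum>C\<in>interval A (B \<inter> H). f C * monom (pX C B) 1)"
  proof (rule sum.cong[OF refl])
    fix C assume "C \<in> interval A (B \<inter> H)"
    then have "A \<subseteq> C" "C \<subseteq> H" by (simp_all add: interval_def)
    moreover from this have "C \<noteq> {0}" using A zero_in_spanned_elem[OF A(1)] by blast
    ultimately show "f C * p C B = f C * monom (pX C B) 1" by (simp add: p_below_H)
  qed
  finally show ?thesis .
qed

text \<open>\<open>mid q\<close> is one-dimensional and not contained in \<open>H\<close>, so no
  other special flat lies above it.\<close>

lemma sum_mid_interval_spanned:
  fixes f :: "(bit ^ 10) set \<Rightarrow> int poly"
  assumes q: "q \<in> pairs UNIV" and B: "mid q \<subseteq> B"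
  shows "(\<Sum>C\<in>interval (mid q) B \<inter> spanned. f C * p C B) = f (mid q) * p (mid q) B"
proof -
  have "p C B = 0" if C: "C \<in> interval (mid q) B \<inter> spanned" "C \<noteq> mid q" for C
  proof (rule p_zero_outside)
    show "\<not> C \<subseteq> H" using C mid_not_subset_H[OF q] by (auto simp: interval_def)
    show "C \<notin> mid ` pairs B"
    proof
      assume "C \<in> mid ` pairs B"
      then obtain q' where "C = mid q'" by blast
      then show False
        using C subset_mid[of "mid q" q'] mid_not_subset_H[OF q] by (auto simp: interval_def mid_def)
    qed
  qed (use C in simp)
  then have "(\<Sum>C\<in>interval (mid q) B \<inter> spanned. f C * p C B) = (\<Sum>C\<in>{mid q}. f C * p C B)"
    using B spanned_mid[OF q] subspace_mid
    by (intro sum.mono_neutral_right) (auto simp: interval_def)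
  then show ?thesis by simp
qed

text \<open>The full sum over the interval of all subspaces is palindromic. It remains to see that
  the \<open>p\<close> terms cancel the missing subspaces up to palindromic polynomials, for each
  kind of \<open>A\<close> separately.\<close>

lemma palindromic_Z:
  assumes A: "A \<in> spanned" and B: "B \<in> spanned" and AB: "A \<subseteq> B"
  shows "palindromic (vec.dim B - vec.dim A)
    (\<Sum>C\<in>interval A B \<inter> spanned. monom 1 (vec.dim C - vec.dim A) * (1 + p C B))"
proof -
  let ?a = "vec.dim A" and ?b = "vec.dim B"
  let ?t = "\<lambda>C. monom (1::int) (vec.dim C - ?a)"
  have sA: "vec.subspace A" and sB: "vec.subspace B" using A B subspace_spanned by auto
  have pal: "palindromic (?b - ?a) (\<Sum>C\<in>interval A B. ?t C)"
    by (rule palindromic_interval[OF sA sB AB])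
  have "(\<Sum>C\<in>interval A B \<inter> spanned. ?t C * (1 + p C B)) =
      (\<Sum>C\<in>interval A B \<inter> spanned. ?t C) + (\<Sum>C\<in>interval A B \<inter> spanned. ?t C * p C B)"
    by (simp add: distrib_left sum.distrib)
  also have "\<dots> = (\<Sum>C\<in>interval A B. ?t C) +
      ((\<Sum>C\<in>interval A B \<inter> spanned. ?t C * p C B) - (\<Sum>C\<in>interval A B - spanned. ?t C))"
    by (simp add: sum_spanned_interval)
  finally have Z: "(\<Sum>C\<in>interval A B \<inter> spanned. ?t C * (1 + p C B)) = \<dots>" .
  have "palindromic (?b - ?a) ((\<Sum>C\<in>interval A B \<inter> spanned. ?t C * p C B) - (\<Sum>C\<in>interval A B - spanned. ?t C))"
  proof -
    consider "A = {0}" | "A \<subseteq> H" "A \<noteq> {0}" | q where "q \<in> pairs UNIV" "A = mid q" | "\<not> special A"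
      unfolding special_def by blast
    then show ?thesis
    proof cases
      case 1
      then have a0: "?a = 0" by simp
      let ?N = "int (card (pairs B))" and ?U = "interval {0} (W \<inter> B) - {{0}}"
      let ?T = "{K \<in> interval {0} (B \<inter> X). \<not> K \<subseteq> H}"
      \<comment> \<open>\<open>D\<close> collects the part of \<open>p {0} B\<close> that occurs
        only at the bottom; the \<open>pX\<close> part has the same form for all \<open>C\<close> in
        \<open>H\<close>.\<close>
      define D where "D = (\<Sum>K\<in>?U. phi (vec.dim K) ?b) - monom (of_bool (?b = 3) * ?N) 1"
      have pC: "p C B = monom (pX C B) 1 + (if C = {0} then D else 0)" if "C \<subseteq> H" for C
        using that by (simp add: p_def D_def diff_monom[symmetric])
      have "(\<Sum>C\<in>interval {0} (B \<inter> H). ?t C * p C B) =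
          (\<Sum>C\<in>interval {0} (B \<inter> H). ?t C * monom (pX C B) 1 + (if C = {0} then D else 0))"
        by (rule sum.cong[OF refl]) (auto simp: pC interval_def distrib_left a0)
      also have "\<dots> = (\<Sum>C\<in>interval {0} (B \<inter> H). ?t C * monom (pX C B) 1) + D"
        using zero_in_spanned_elem[OF B] by (simp add: sum.distrib interval_def vec.subspace_single_0)
      finally have H_part: "(\<Sum>C\<in>interval {0} (B \<inter> H). ?t C * p C B) = \<dots>" .
      have mid_part: "(\<Sum>q\<in>pairs B. ?t (mid q) * p (mid q) B) = monom (of_bool (?b \<ge> 4) * ?N) 2"
      proof -
        have "?t (mid q) * p (mid q) B = monom (of_bool (?b \<ge> 4)) 2" if "q \<in> pairs B" for q
        proof -
          have "q \<in> pairs UNIV" using that by (auto simp: pairs_def)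
          then show ?thesis using that by (simp add: a0 p_mid dim_mid mult_monom numeral_2_eq_2)
        qed
        then show ?thesis by (simp add: of_nat_poly smult_monom mult.commute)
      qed
      have line_part: "(\<Sum>q\<in>pairs B. ?t (line q)) = monom ?N 2"
        by (simp add: a0 dim_line of_nat_poly smult_monom)
      have L_part: "(\<Sum>C\<in>interval A B \<inter> spanned. ?t C * p C B) =
          (\<Sum>C\<in>interval {0} (B \<inter> H). ?t C * p C B) + (\<Sum>q\<in>pairs B. ?t (mid q) * p (mid q) B)"
        unfolding 1 by (rule sum_zero_interval_spanned[OF B]) (simp add: p_zero_outside)
      have notL_part: "(\<Sum>C\<in>interval A B - spanned. ?t C) =
          (\<Sum>K\<in>?U. ?t K) + (\<Sum>K\<in>?T. ?t K) + (\<Sum>q\<in>pairs B. ?t (line q))"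
        unfolding 1 by (rule sum_not_spanned_above_zero[OF B])
      have U_part: "(\<Sum>K\<in>?U. ?t K) = (\<Sum>K\<in>?U. monom 1 (vec.dim K))"
        by (simp add: a0)
      have "(\<Sum>C\<in>interval A B \<inter> spanned. ?t C * p C B) - (\<Sum>C\<in>interval A B - spanned. ?t C) =
          ((\<Sum>C\<in>interval {0} (B \<inter> H). ?t C * monom (pX C B) 1) - (\<Sum>K\<in>?T. ?t K)) +
          (\<Sum>K\<in>?U. phi (vec.dim K) ?b - monom 1 (vec.dim K)) +
          (monom (of_bool (?b \<ge> 4) * ?N) 2 - monom ?N 2 - monom (of_bool (?b = 3) * ?N) 1)"
        unfolding L_part notL_part U_part H_part mid_part line_part D_def sum_subtractf
        by (simp only: algebra_simps)
      moreover have "palindromic (?b - ?a)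
          ((\<Sum>C\<in>interval {0} (B \<inter> H). ?t C * monom (pX C B) 1) - (\<Sum>K\<in>?T. ?t K))"
        using palindromic_X_part[OF sA _ AB B] 1 by simp
      moreover have "palindromic (?b - ?a) (\<Sum>K\<in>?U. phi (vec.dim K) ?b - monom 1 (vec.dim K))"
        by (auto intro!: palindromic_sum palindromic_phi vec.dim_subset simp: a0 interval_def)
      \<comment> \<open>If \<open>?b \<ge> 4\<close>, the product t * t at \<open>mid q\<close>
        cancels the t^2 missing for \<open>line q\<close>. If \<open>?b = 3\<close>, then
        \<open>p (mid q) B\<close> is 0, and the uncancelled -t^2 is paired with the -t put into
        \<open>p {0} B\<close> for each pair.\<close>
      moreover have "palindromic (?b - ?a)
          (monom (of_bool (?b \<ge> 4) * ?N) 2 - monom ?N 2 - monom (of_bool (?b = 3) * ?N) 1)"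
      proof (cases "pairs B = {}")
        case False
        then have "?b \<ge> 3" using dim_of_pairs[OF B] by blast
        then consider "?b \<ge> 4" | "?b = 3" by linarith
        then show ?thesis by cases (auto simp: palindromic_def a0)
      qed simp
      ultimately show ?thesis by (simp add: palindromic_add)
    next
      case 2
      show ?thesis
        unfolding sum_H_interval_spanned[OF A 2] not_spanned_above_H[OF A 2 B]
        by (rule palindromic_X_part[OF sA 2(1) AB B])
    next
      case 3
      have "(\<Sum>C\<in>interval A B \<inter> spanned. ?t C * p C B) = p A B"
        using sum_mid_interval_spanned[OF 3(1), of B ?t] AB 3(2) by (simp add: one_pCons[symmetric] monom_0)
      moreover have "(\<Sum>C\<in>interval A B - spanned. ?t C) = (if q \<in> pairs B then monom 1 1 else 0)"
        unfolding 3(2) not_spanned_above_mid[OF 3(1) B] using dim_mid[OF 3(1)] dim_line[OF 3(1)] by simp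
      moreover have "palindromic (?b - ?a)
          (p A B - (if q \<in> pairs B then monom 1 1 else 0))"
      proof (cases "q \<in> pairs B")
        case True
        \<comment> \<open>In the first case \<open>p\<close> cancels the missing t; in the second,
          -t is palindromic because the interval has length 2.\<close>
        then have "?b \<ge> 4 \<or> ?b = 3" using dim_of_pairs[OF B True] by linarith
        then show ?thesis
          using True 3 dim_mid[OF 3(1)] by (auto simp: p_mid palindromic_def)
      qed (simp add: 3 p_mid)
      ultimately show ?thesis by simp
    next
      case 4
      have "p C B = 0" if "C \<in> interval A B \<inter> spanned" for C
      proof (rule p_nonspecial)
        show "\<not> special C"
        proof
          assume "special C"
          moreover have "A \<subseteq> C" using that by (simp add: interval_def)
          ultimately consider "A \<subseteq> H" | q where "q \<in> pairs UNIV" "A \<subseteq> mid q"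
            unfolding special_def by blast
          then show False
          proof cases
            case 2
            then have "A = {0} \<or> A = mid q"
              using subset_mid zero_in_spanned_elem[OF A] by blast
            then show False using 4 2(1) by (auto simp: special_def)
          qed (use 4 in \<open>simp add: special_def\<close>)
        qed
      qed (use that in simp)
      then show ?thesis using not_spanned_above_nonspecial[OF A 4, of B] by (simp add: Diff_eq_empty_iff[THEN iffD2])
    qed
  qed
  then show ?thesis unfolding Z by (intro palindromic_add pal)
qed

end

section \<open>Binary matroids\<close>

lemma ground_binary: "ground (binary_matroid E) = E"
  by (subst ground.rep_eq, subst binary_matroid.rep_eq) simp

lemma indep_binary: "indep (binary_matroid E) I \<longleftrightarrow> I \<subseteq> E \<and> vec.independent I"
  by (subst indep.rep_eq, subst binary_matroid.rep_eq) simp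

lemma rk_binary:
  assumes "A \<subseteq> E"
  shows "rk (binary_matroid E) A = vec.dim A"
proof (rule antisym)
  show "rk (binary_matroid E) A \<le> vec.dim A"
    by (rule rk_le) (auto simp: indep_binary intro: vec.independent_card_le_dim)
  obtain B where B: "B \<subseteq> A" "vec.independent B" "card B = vec.dim A"
    using vec.basis_exists[of A] by metis
  then have "indep (binary_matroid E) B" using assms by (simp add: indep_binary)
  from card_le_rk[OF this B(1)] B(3) show "vec.dim A \<le> rk (binary_matroid E) A" by simp
qed

lemma flats_binary: "F \<in> flats (binary_matroid E) \<longleftrightarrow> F = E \<inter> vec.span F"
proof (cases "F \<subseteq> E")
  case True
  have "rk (binary_matroid E) F < rk (binary_matroid E) (insert x F) \<longleftrightarrow> x \<notin> vec.span F" if "x \<in> E" for x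
    using that True by (simp add: rk_binary vec.dim_insert)
  then have "F \<in> flats (binary_matroid E) \<longleftrightarrow> (\<forall>x\<in>E - F. x \<notin> vec.span F)"
    using True by (simp add: flats_def ground_binary)
  also have "\<dots> \<longleftrightarrow> F = E \<inter> vec.span F"
    using True vec.span_superset[of F] by blast
  finally show ?thesis .
qed (auto simp: flats_def ground_binary)

lemma simple_binary:
  assumes "0 \<notin> (E :: (bit ^ 'n) set)"
  shows "simple (binary_matroid E)"
proof -
  have single: "vec.independent {x}" if "x \<noteq> 0" for x :: "bit ^ 'n"
    using that by (simp add: vec.independent_insert vec.independent_empty)
  have pair: "vec.independent {x, y}" if "x \<noteq> 0" "y \<noteq> 0" "x \<noteq> y" for x y :: "bit ^ 'n"
  proof -
    have "vec.span {y} \<subseteq> {0, y}"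
      by (rule vec.span_minimal) (simp_all add: subspace_pair)
    then have "x \<notin> vec.span {y}" using that by blast
    then show ?thesis using that single[of y] by (simp add: vec.independent_insert)
  qed
  have nz: "x \<noteq> 0" if "x \<in> E" for x
    using assms that by blast
  show ?thesis
    unfolding simple_def loopless_def ground_binary indep_binary
    using single pair nz by simp
qed

section \<open>The recursion on subspaces\<close>

context deleted_geometry begin

abbreviation M :: "(bit ^ 10) matroid" where
  "M \<equiv> binary_matroid E"

lemma zero_notin_E: "0 \<notin> E"
  by (simp add: E_def)

lemma span_Int_E: "U \<in> spanned \<Longrightarrow> vec.span (U \<inter> E) = U"
  by (simp add: spanned_def)

lemma flat_of_spanned:
  assumes "U \<in> spanned"
  shows "U \<inter> E \<in> flats M"
  unfolding flats_binary span_Int_E[OF assms] by blast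

lemma span_flat:
  assumes "F \<in> flats M"
  shows "vec.span F \<in> spanned" "vec.span F \<inter> E = F"
proof -
  show *: "vec.span F \<inter> E = F" using assms flats_binary[of F E] by (metis Int_commute)
  then show "vec.span F \<in> spanned" by (simp add: spanned_def)
qed

lemma spanned_Int_E_inject: "A \<in> spanned \<Longrightarrow> B \<in> spanned \<Longrightarrow> A \<inter> E = B \<inter> E \<longleftrightarrow> A = B"
  by (metis span_Int_E)

lemma rk_spanned: "U \<in> spanned \<Longrightarrow> rk M (U \<inter> E) = vec.dim U"
  using rk_binary[of "U \<inter> E" E] span_Int_E[of U] by (metis inf_le2 vec.dim_span)

lemma bij_betw_spanned_flats:
  assumes A: "A \<in> spanned" and B: "B \<in> spanned"
  shows "bij_betw (\<lambda>U. U \<inter> E) (interval A B \<inter> spanned) {F \<in> flats M. A \<inter> E \<subseteq> F \<and> F \<subseteq> B \<inter> E}"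
proof (rule bij_betw_byWitness[where f' = vec.span])
  show "\<forall>U\<in>interval A B \<inter> spanned. vec.span (U \<inter> E) = U" by (simp add: span_Int_E)
  show "\<forall>F\<in>{F \<in> flats M. A \<inter> E \<subseteq> F \<and> F \<subseteq> B \<inter> E}. vec.span F \<inter> E = F" by (simp add: span_flat)
  show "(\<lambda>U. U \<inter> E) ` (interval A B \<inter> spanned) \<subseteq> {F \<in> flats M. A \<inter> E \<subseteq> F \<and> F \<subseteq> B \<inter> E}"
    using flat_of_spanned by (auto simp: interval_def)
  show "vec.span ` {F \<in> flats M. A \<inter> E \<subseteq> F \<and> F \<subseteq> B \<inter> E} \<subseteq> interval A B \<inter> spanned"
  proof (rule image_subsetI)
    fix F assume F: "F \<in> {F \<in> flats M. A \<inter> E \<subseteq> F \<and> F \<subseteq> B \<inter> E}"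
    then have "vec.span (A \<inter> E) \<subseteq> vec.span F" "vec.span F \<subseteq> vec.span (B \<inter> E)"
      by (auto intro!: vec.span_mono)
    then show "vec.span F \<in> interval A B \<inter> spanned"
      using F span_flat(1)[of F] by (simp add: interval_def span_Int_E A B)
  qed
qed

lemma p_self: "B \<in> spanned \<Longrightarrow> p B B = 0"
  using p_special_right p_nonspecial by (cases "special B") auto

lemma dim_less_spanned: "A \<in> spanned \<Longrightarrow> B \<in> spanned \<Longrightarrow> A \<subset> B \<Longrightarrow> vec.dim A < vec.dim B"
  using vec.dim_psubset[of A B] subspace_spanned by (metis vec.span_eq_iff)

text \<open>An instance of \<open>KL_poly_contr_eqI\<close> for the restriction to
  \<open>B \<inter> E\<close>; \<open>degree_p\<close> and \<open>palindromic_Z\<close> discharge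
  the two checks.\<close>

lemma KL_poly_interval:
  assumes A: "A \<in> spanned" and B: "B \<in> spanned" and AB: "A \<subseteq> B"
  shows "KL_poly (contr (restr M (B \<inter> E)) (A \<inter> E)) = 1 + p A B"
proof -
  let ?N = "restr M (B \<inter> E)"
  have ground: "ground ?N = B \<inter> E" by (auto simp: ground_restr ground_binary)
  have flats: "flats ?N = {F \<in> flats M. F \<subseteq> B \<inter> E}"
    by (rule flats_restr[OF flat_of_spanned[OF B]])
  have rank: "mrank ?N = vec.dim B"
    using mrank_restr[of "B \<inter> E" M] by (simp add: ground_binary rk_spanned[OF B])
  have flatD: "vec.span F \<in> spanned \<and> vec.span F \<subseteq> B \<and> vec.span F \<inter> E = F \<and> rk ?N F = vec.dim (vec.span F)"
    if "F \<in> flats ?N" for F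
  proof -
    have F: "F \<in> flats M" "F \<subseteq> B \<inter> E" using that flats by auto
    then have "rk ?N F = rk M F" by (simp add: rk_restr)
    moreover have "vec.span F \<subseteq> B" using vec.span_mono[OF F(2)] span_Int_E[OF B] by simp
    ultimately show ?thesis using span_flat[OF F(1)] rk_spanned by metis
  qed
  have "KL_poly (contr ?N (A \<inter> E)) = 1 + p (vec.span (A \<inter> E)) B"
  proof (rule KL_poly_contr_eqI[where f = "\<lambda>F. 1 + p (vec.span F) B"])
    show "1 + p (vec.span (ground ?N)) B = 1"
      unfolding ground span_Int_E[OF B] by (simp add: p_self B)
    show "A \<inter> E \<in> flats ?N"
      unfolding flats using flat_of_spanned[OF A] AB by auto
  next
    fix F assume F: "F \<in> flats ?N" "F \<noteq> ground ?N"
    let ?C = "vec.span F"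
    note C = flatD[OF F(1)]
    then have "?C \<noteq> B" using F(2) ground by metis
    then have lt: "vec.dim ?C < vec.dim B" using C B by (intro dim_less_spanned) auto
    have "degree (1 + p ?C B) \<le> (vec.dim B - vec.dim ?C - 1) div 2"
      using degree_p[of ?C B] C B by (intro degree_add_le) auto
    then show "2 * degree (1 + p ?C B) < mrank ?N - rk ?N F"
      using lt C rank by linarith
    have "bij_betw (\<lambda>U. U \<inter> E) (interval ?C B \<inter> spanned) {G \<in> flats ?N. F \<subseteq> G}"
    proof -
      have "{G \<in> flats ?N. F \<subseteq> G} = {G \<in> flats M. ?C \<inter> E \<subseteq> G \<and> G \<subseteq> B \<inter> E}"
        using C flats by auto
      then show ?thesis using bij_betw_spanned_flats[of ?C B] C B by simp
    qed
    from sum.reindex_bij_betw[OF this, symmetric]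
    have "(\<Sum>G\<in>{G \<in> flats ?N. F \<subseteq> G}. monom 1 (rk ?N G - rk ?N F) * (1 + p (vec.span G) B)) =
      (\<Sum>U\<in>interval ?C B \<inter> spanned. monom 1 (rk ?N (U \<inter> E) - rk ?N F) * (1 + p (vec.span (U \<inter> E)) B))" .
    also have "\<dots> = (\<Sum>U\<in>interval ?C B \<inter> spanned. monom 1 (vec.dim U - vec.dim ?C) * (1 + p U B))"
    proof (rule sum.cong[OF refl])
      fix U assume U: "U \<in> interval ?C B \<inter> spanned"
      then have "U \<inter> E \<subseteq> B \<inter> E" by (auto simp: interval_def)
      then have "rk ?N (U \<inter> E) = vec.dim U" using U rk_spanned by (simp add: rk_restr)
      then show "monom 1 (rk ?N (U \<inter> E) - rk ?N F) * (1 + p (vec.span (U \<inter> E)) B) =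
          monom 1 (vec.dim U - vec.dim ?C) * (1 + p U B)"
        using U C span_Int_E[of U] by simp
    qed
    finally show "palindromic (mrank ?N - rk ?N F)
        (\<Sum>G\<in>{G \<in> flats ?N. F \<subseteq> G}. monom 1 (rk ?N G - rk ?N F) * (1 + p (vec.span G) B))"
      using palindromic_Z[of ?C B] C B rank by simp
  qed
  then show ?thesis by (simp add: span_Int_E[OF A])
qed

definition Q :: "(bit ^ 10) set \<Rightarrow> int poly" where
  "Q A = signed_inv_KL M (A \<inter> E)"

lemma mrank_M: "mrank M = 10"
  using rk_spanned[OF spanned_UNIV] unfolding vec_dim_card by (simp add: mrank_def ground_binary)

lemma Q_UNIV: "Q UNIV = 1"
  using signed_inv_KL_ground[of M] by (simp add: Q_def ground_binary)

text \<open>The rank 10 is even, so the sign in \<open>signed_inv_KL\<close> is trivial at the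
  bottom.\<close>

lemma inv_KL_eq_Q: "inv_KL_poly M = Q {0}"
proof -
  have "{0} \<inter> E = {}" using zero_notin_E by simp
  then show ?thesis by (simp add: Q_def signed_inv_KL_def mrank_M)
qed

lemma Q_recursion:
  assumes A: "A \<in> spanned" "A \<noteq> UNIV"
  shows "(\<Sum>B\<in>interval A UNIV \<inter> spanned. (1 + p A B) * Q B) = 0"
proof -
  have "A \<inter> E \<noteq> ground M"
    using spanned_Int_E_inject[OF A(1) spanned_UNIV] A(2) by (simp add: ground_binary)
  from sum_signed_inv_KL[OF flat_of_spanned[OF A(1)] this]
  have "(\<Sum>F\<in>{F \<in> flats M. A \<inter> E \<subseteq> F}. KL_poly (contr (restr M F) (A \<inter> E)) * signed_inv_KL M F) = 0" .
  moreover have "{F \<in> flats M. A \<inter> E \<subseteq> F} = {F \<in> flats M. A \<inter> E \<subseteq> F \<and> F \<subseteq> UNIV \<inter> E}"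
    using flats_subset[of _ M] by (auto simp: ground_binary)
  ultimately have "(\<Sum>B\<in>interval A UNIV \<inter> spanned.
      KL_poly (contr (restr M (B \<inter> E)) (A \<inter> E)) * signed_inv_KL M (B \<inter> E)) = 0"
    using sum.reindex_bij_betw[OF bij_betw_spanned_flats[OF A(1) spanned_UNIV],
        of "\<lambda>F. KL_poly (contr (restr M F) (A \<inter> E)) * signed_inv_KL M F"] by simp
  moreover have "(\<Sum>B\<in>interval A UNIV \<inter> spanned.
      KL_poly (contr (restr M (B \<inter> E)) (A \<inter> E)) * signed_inv_KL M (B \<inter> E)) =
      (\<Sum>B\<in>interval A UNIV \<inter> spanned. (1 + p A B) * Q B)"
    using A(1) by (intro sum.cong refl) (simp add: KL_poly_interval Q_def interval_def)
  ultimately show ?thesis by simp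
qed

end

section \<open>Summation over the projective geometry\<close>

text \<open>
  The Moebius function \<open>(- 1)^k * 2^(k choose 2)\<close> of the projective geometry in corank \<open>k = 10 - n\<close>.
\<close>

definition pg_moebius :: "nat \<Rightarrow> int" where
  "pg_moebius n = (- 1) ^ (10 - n) * 2 ^ ((10 - n) * (9 - n) div 2)"

lemma sum_atMost_numeral:
  "(\<Sum>j\<le>numeral n. f j) = (\<Sum>j\<le>pred_numeral n. f j) + (f (numeral n) :: 'b::comm_monoid_add)"
  by (simp add: numeral_eq_Suc)

lemma nat_le_10_cases:
  assumes "a \<le> (10::nat)"
  shows "a \<in> {10, 9, 8, 7, 6, 5, 4, 3, 2, 1, 0}"
proof -
  have "{..10::nat} = {10, 9, 8, 7, 6, 5, 4, 3, 2, 1, 0}"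
    by (simp add: atMost_nat_numeral atMost_Suc)
  with assms show ?thesis by blast
qed

text \<open>By the q-binomial theorem the sum is the product of the factors 1 - 2^i for i < 10 - a,
  and the factor for i = 0 vanishes. The eleven instances are evaluated;
  \<open>sum_gauss_moebius\<close> is the same identity counted from the bottom.\<close>

lemma sum_gauss_pg_moebius: "a \<le> 10 \<Longrightarrow> (\<Sum>j\<le>10 - a. int (gauss (10 - a) j) * pg_moebius (a + j)) = of_bool (a = 10)"
  by (drule nat_le_10_cases, elim insertE emptyE) (simp_all add: sum_atMost_numeral pg_moebius_def)

lemma sum_gauss_moebius:
  "d \<le> 10 \<Longrightarrow> (\<Sum>j\<le>d. int (gauss d j) * ((- 1) ^ j * 2 ^ (j * (j - 1) div 2))) = of_bool (d = 0)"
  by (drule nat_le_10_cases, elim insertE emptyE) (simp_all add: sum_atMost_numeral)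

lemma dim_le_10: "vec.dim (A :: (bit ^ 10) set) \<le> 10"
  using vec.dim_subset[of A UNIV] unfolding vec_dim_card by simp

lemma sum_interval_UNIV:
  fixes f :: "nat \<Rightarrow> 'b::comm_semiring_1"
  assumes "vec.subspace (A :: (bit ^ 10) set)"
  shows "(\<Sum>K\<in>interval A UNIV. f (vec.dim K)) =
    (\<Sum>j\<le>10 - vec.dim A. of_nat (gauss (10 - vec.dim A) j) * f (vec.dim A + j))"
  using sum_interval[OF assms vec.subspace_UNIV subset_UNIV, of f] unfolding vec_dim_card by simp

lemma sum_pg_moebius:
  assumes A: "vec.subspace (A :: (bit ^ 10) set)"
  shows "(\<Sum>K\<in>interval A UNIV. pg_moebius (vec.dim K)) = of_bool (A = UNIV)"
proof -
  have "A = UNIV \<longleftrightarrow> vec.dim A = 10"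
  proof
    assume "A = UNIV"
    then show "vec.dim A = 10" using vec_dim_card[where ?'n = 10 and ?'a = bit] by simp
  next
    assume "vec.dim A = 10"
    then show "A = UNIV"
      using vec.subspace_dim_equal[OF A vec.subspace_UNIV subset_UNIV] unfolding vec_dim_card by simp
  qed
  then show ?thesis
    using sum_interval_UNIV[OF A, of pg_moebius] sum_gauss_pg_moebius[OF dim_le_10, of A] by simp
qed

context deleted_geometry begin

lemma Q_split:
  assumes A: "A \<in> spanned"
  shows "(\<Sum>B\<in>interval A UNIV \<inter> spanned. f B) = f A + (\<Sum>B\<in>interval A UNIV \<inter> spanned - {A}. f B)"
  using A subspace_spanned[OF A] by (intro sum.remove) (simp_all add: interval_def)

lemma special_below:
  assumes "B \<in> spanned" "special B" "A \<in> spanned" "A \<subseteq> B"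
  shows "special A"
proof (cases "B \<subseteq> H")
  case True
  then show ?thesis using assms(4) by (simp add: special_def order.trans)
next
  case False
  then obtain q where q: "q \<in> pairs UNIV" "B = mid q" using assms(2) unfolding special_def by blast
  then have "A = {0} \<or> A = mid q" using assms subset_mid zero_in_spanned_elem by blast
  then show ?thesis using q(1) by (auto simp: special_def)
qed

text \<open>Above such a flat no subspace is missing and \<open>p A\<close> vanishes, so
  \<open>Q\<close> satisfies the recursion of the Moebius function of the projective
  geometry.\<close>

lemma Q_nonspecial:
  assumes "A \<in> spanned" "\<not> special A"
  shows "Q A = [:pg_moebius (vec.dim A):]"
  using assms
proof (induction "card (UNIV - A)" arbitrary: A rule: less_induct)
  case less
  have sA: "vec.subspace A" by (rule subspace_spanned[OF less.prems(1)])
  have int_eq: "interval A UNIV \<inter> spanned = interval A UNIV"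
    using not_spanned_above_nonspecial[OF less.prems] by blast
  have IH: "Q B = [:pg_moebius (vec.dim B):]" if B: "B \<in> interval A UNIV \<inter> spanned - {A}" for B
  proof (rule less.hyps)
    have AB: "A \<subset> B" using B by (auto simp: interval_def)
    then show "card (UNIV - B) < card (UNIV - A)" by (intro psubset_card_mono) auto
    show "B \<in> spanned" using B by simp
    show "\<not> special B" using special_below[of B A] B AB less.prems by auto
  qed
  show ?case
  proof (cases "A = UNIV")
    case True
    have "vec.dim (UNIV :: (bit ^ 10) set) = 10" unfolding vec_dim_card by simp
    then show ?thesis using True Q_UNIV by (simp add: pg_moebius_def one_pCons)
  next
    case False
    have "(\<Sum>B\<in>interval A UNIV \<inter> spanned. [:pg_moebius (vec.dim B):]) = 0"
    proof -
      have "(\<Sum>B\<in>interval A UNIV \<inter> spanned. [:pg_moebius (vec.dim B):]) = [:\<Sum>B\<in>interval A UNIV. pg_moebius (vec.dim B):]"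
        unfolding int_eq by (simp add: poly_eq_iff coeff_sum coeff_pCons split: nat.split)
      then show ?thesis using sum_pg_moebius[OF sA] False by simp
    qed
    moreover have "(\<Sum>B\<in>interval A UNIV \<inter> spanned. Q B) = 0"
      using Q_recursion[OF less.prems(1) False] by (simp add: p_nonspecial[OF less.prems])
    ultimately show ?thesis
      unfolding Q_split[OF less.prems(1)] using IH by simp
  qed
qed

text \<open>The sum of \<open>p A B * Q B\<close>, with the value of \<open>Q_nonspecial\<close> put
  for every \<open>Q B\<close>. This is legitimate at special \<open>B\<close> too, where
  \<open>p A B\<close> is 0.\<close>

definition R :: "(bit ^ 10) set \<Rightarrow> int poly" where
  "R A = (\<Sum>B\<in>interval A UNIV \<inter> spanned. smult (pg_moebius (vec.dim B)) (p A B))"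

lemma sum_Q:
  assumes A: "A \<in> spanned"
  shows "(\<Sum>B\<in>interval A UNIV \<inter> spanned. Q B) = of_bool (A = UNIV) - R A"
proof (cases "A = UNIV")
  case True
  have "interval UNIV UNIV \<inter> spanned = {UNIV :: (bit ^ 10) set}"
    using spanned_UNIV by (auto simp: interval_def)
  then show ?thesis using True by (simp add: R_def p_self[OF spanned_UNIV] Q_UNIV)
next
  case False
  have "p A B * Q B = smult (pg_moebius (vec.dim B)) (p A B)" if "B \<in> spanned" for B
    using that by (cases "special B") (simp_all add: p_special_right Q_nonspecial)
  then have "(\<Sum>B\<in>interval A UNIV \<inter> spanned. p A B * Q B) = R A"
    unfolding R_def by (intro sum.cong) auto
  then show ?thesis
    using Q_recursion[OF A False] False by (simp add: distrib_right sum.distrib eq_neg_iff_add_eq_0)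
qed

section \<open>Moebius inversion over the flats\<close>

definition nu :: "(bit ^ 10) set \<Rightarrow> int" where
  "nu A = moebius spanned {0} A"

lemma sum_nu:
  assumes B: "B \<in> spanned"
  shows "(\<Sum>A\<in>{A \<in> spanned. A \<subseteq> B}. nu A) = of_bool (B = {0})"
proof -
  have eq: "{A \<in> spanned. A \<subseteq> B} = {A \<in> spanned. {0} \<subseteq> A \<and> A \<subseteq> B}"
    using zero_in_spanned_elem by auto
  show ?thesis
  proof (cases "B = {0}")
    case True
    then have "{A \<in> spanned. A \<subseteq> B} = {{0}}" using zero_in_spanned_elem spanned_zero by blast
    then show ?thesis using True by (simp add: nu_def)
  next
    case False
    then have "{0} \<subset> B" using zero_in_spanned_elem[OF B] by blast
    then show ?thesis
      unfolding eq nu_def using sum_moebius[of spanned "{0}" B] B False by simp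
  qed
qed

lemma moebius_inversion:
  fixes f :: "(bit ^ 10) set \<Rightarrow> int poly"
  shows "(\<Sum>A\<in>spanned. smult (nu A) (\<Sum>B\<in>interval A UNIV \<inter> spanned. f B)) = f {0}"
proof -
  have int: "interval A UNIV \<inter> spanned = {B \<in> spanned. A \<subseteq> B}" for A
    using subspace_spanned by (auto simp: interval_def)
  have "(\<Sum>A\<in>spanned. smult (nu A) (\<Sum>B\<in>interval A UNIV \<inter> spanned. f B)) =
      (\<Sum>A\<in>spanned. \<Sum>B\<in>{B \<in> spanned. A \<subseteq> B}. smult (nu A) (f B))"
    by (simp add: int smult_sum_right)
  also have "\<dots> = (\<Sum>B\<in>spanned. \<Sum>A\<in>{A \<in> spanned. A \<subseteq> B}. smult (nu A) (f B))"
    by (rule sum.swap_restrict) simp_all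
  also have "\<dots> = (\<Sum>B\<in>spanned. if B = {0} then f B else 0)"
    by (rule sum.cong[OF refl]) (simp add: sum_nu flip: smult_sum_left)
  also have "\<dots> = f {0}" by simp
  finally show ?thesis .
qed

text \<open>
  The Moebius function of \<open>spanned\<close> at \<open>(A, UNIV)\<close> is the sum of that of the projective geometry over
  the subspaces with interior \<open>A\<close>.
\<close>

definition kappa :: "(bit ^ 10) set \<Rightarrow> int" where
  "kappa A = (\<Sum>K\<in>{K. vec.subspace K \<and> vec.span (K \<inter> E) = A}. pg_moebius (vec.dim K))"

lemma interior_spanned: "vec.subspace K \<Longrightarrow> vec.span (K \<inter> E) \<in> spanned \<and> vec.span (K \<inter> E) \<subseteq> K"
proof -
  assume K: "vec.subspace K"
  have sub: "vec.span (K \<inter> E) \<subseteq> K" using K by (intro vec.span_minimal) auto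
  have "vec.span (vec.span (K \<inter> E) \<inter> E) = vec.span (K \<inter> E)"
  proof (rule antisym)
    show "vec.span (vec.span (K \<inter> E) \<inter> E) \<subseteq> vec.span (K \<inter> E)"
      by (intro vec.span_minimal) auto
    show "vec.span (K \<inter> E) \<subseteq> vec.span (vec.span (K \<inter> E) \<inter> E)"
      using vec.span_superset[of "K \<inter> E"] by (intro vec.span_mono) auto
  qed
  with sub show ?thesis by (simp add: spanned_def)
qed

text \<open>As \<open>A\<close> is spanned, a subspace contains \<open>A\<close> exactly when its
  spanned part does. Grouping by spanned parts turns the vanishing sum of the projective geometry
  into one over flats.\<close>

lemma sum_kappa:
  assumes A: "A \<in> spanned"
  shows "(\<Sum>B\<in>interval A UNIV \<inter> spanned. kappa B) = of_bool (A = UNIV)"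
proof -
  have "(\<Sum>K\<in>interval A UNIV. pg_moebius (vec.dim K)) =
      (\<Sum>B\<in>interval A UNIV \<inter> spanned. \<Sum>K\<in>{K \<in> interval A UNIV. vec.span (K \<inter> E) = B}. pg_moebius (vec.dim K))"
    by (rule sum.group[symmetric])
       (use interior_spanned spanned_subset_span[OF A] in \<open>auto simp: interval_def\<close>)
  also have "\<dots> = (\<Sum>B\<in>interval A UNIV \<inter> spanned. kappa B)"
    unfolding kappa_def
  proof (intro sum.cong refl)
    fix B assume B: "B \<in> interval A UNIV \<inter> spanned"
    have "A \<subseteq> K" if "vec.subspace K" "vec.span (K \<inter> E) = B" for K
      using that B interior_spanned[OF that(1)] by (auto simp: interval_def)
    then show "{K \<in> interval A UNIV. vec.span (K \<inter> E) = B} = {K. vec.subspace K \<and> vec.span (K \<inter> E) = B}"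
      unfolding interval_def by blast
  qed
  finally show ?thesis using sum_pg_moebius[OF subspace_spanned[OF A]] by simp
qed

text \<open>Above every flat \<open>A\<close> the sums of \<open>Q\<close> and of
  \<open>kappa\<close> differ by \<open>R A\<close>; inversion from \<open>{0}\<close> converts this
  into the difference at \<open>{0}\<close>.\<close>

lemma Q_zero: "Q {0} = [:kappa {0}:] - (\<Sum>A\<in>spanned. smult (nu A) (R A))"
proof -
  have const: "(\<Sum>x\<in>S. [:f x:]) = [:\<Sum>x\<in>S. f x:]" for S and f :: "(bit ^ 10) set \<Rightarrow> int"
    by (induction S rule: infinite_finite_induct) simp_all
  have k: "(\<Sum>B\<in>interval A UNIV \<inter> spanned. [:kappa B:]) = of_bool (A = UNIV)" if "A \<in> spanned" for A
    unfolding const sum_kappa[OF that] by (simp add: one_pCons)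
  have "Q {0} = (\<Sum>A\<in>spanned. smult (nu A) (of_bool (A = UNIV) - R A))"
    unfolding moebius_inversion[of Q, symmetric] by (intro sum.cong refl) (simp add: sum_Q)
  moreover have "[:kappa {0}:] = (\<Sum>A\<in>spanned. smult (nu A) (of_bool (A = UNIV)))"
    unfolding moebius_inversion[of "\<lambda>A. [:kappa A:]", symmetric] by (intro sum.cong refl) (simp add: k)
  ultimately show ?thesis by (simp add: smult_diff_right sum_subtractf)
qed

end

section \<open>Evaluation of the inverse Kazhdan--Lusztig polynomial\<close>

text \<open>The sum of \<open>pX A B * pg_moebius (vec.dim B)\<close> over all flats
  \<open>B\<close> above \<open>A\<close>, with \<open>a\<close> the dimension of \<open>A\<close>.
  In the first line, each of the 2^(6 - a) transversals \<open>K\<close> gives minus the sum over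
  the interval from \<open>K\<close> to \<open>X\<close>. The rest sorts the \<open>B\<close> with
  \<open>codim_one B\<close> by Y = B \<inter> X, a subspace of \<open>X\<close> not in
  \<open>H\<close>; if its dimension is y, it has 2^(10 - y) - 2^(7 - y) extensions by one dimension
  outside \<open>X\<close>.\<close>

definition X_sum :: "nat \<Rightarrow> int" where
  "X_sum a = - (2 ^ (6 - a)) * (\<Sum>j\<le>6 - a. int (gauss (6 - a) j) * pg_moebius (a + 1 + j))
    - ((\<Sum>j\<le>7 - a. int (gauss (7 - a) j) * ((2 ^ (10 - (a + j)) - 2 ^ (7 - (a + j))) * pg_moebius (a + j + 1)))
     - (\<Sum>j\<le>6 - a. int (gauss (6 - a) j) * ((2 ^ (10 - (a + j)) - 2 ^ (7 - (a + j))) * pg_moebius (a + j + 1))))"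

context deleted_geometry begin

lemma dim_UNIV_10: "vec.dim (UNIV :: (bit ^ 10) set) = 10"
  unfolding vec_dim_card by simp

lemma card_transversal:
  assumes A: "vec.subspace A" "A \<subseteq> H"
  shows "card (transversal A UNIV) = 2 ^ (6 - vec.dim A)"
proof -
  have AX: "A \<subseteq> X" using A HX by simp
  have eq: "transversal A UNIV = layer A X 1 - layer A H 1"
    using HX by (auto simp: transversal_def layer_def interval_def)
  have "layer A H 1 \<subseteq> layer A X 1" using HX by (auto simp: layer_def interval_def)
  then have "card (transversal A UNIV) = card (layer A X 1) - card (layer A H 1)"
    unfolding eq by (simp add: card_Diff_subset)
  also have "\<dots> = (2 ^ (7 - vec.dim A) - 1) - (2 ^ (6 - vec.dim A) - 1)"
    using card_layer_1[OF A(1) X AX] card_layer_1[OF A(1) H A(2)] by (simp add: dim_X dim_H)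
  also have "\<dots> = 2 ^ (6 - vec.dim A)"
  proof -
    have "vec.dim A \<le> 6" using vec.dim_subset[OF A(2)] dim_H by simp
    then have "7 - vec.dim A = Suc (6 - vec.dim A)" by simp
    then show ?thesis by simp
  qed
  finally show ?thesis .
qed

text \<open>The subspaces without points of \<open>E\<close> are those of \<open>W\<close> and the
  64 spans of single vectors of \<open>X - H\<close>.\<close>

lemma kappa_zero: "kappa {0} = (\<Sum>j\<le>3. int (gauss 3 j) * pg_moebius j) + 64 * pg_moebius 1"
proof -
  have sub0: "vec.subspace {0 :: bit ^ 10}" by (rule vec.subspace_single_0)
  have zero_H: "{0} \<subseteq> H" by simp
  have "{K. vec.subspace K \<and> vec.span (K \<inter> E) = {0}} = interval {0} W \<union> transversal {0} UNIV"
  proof (intro equalityI subsetI)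
    fix K assume "K \<in> {K. vec.subspace K \<and> vec.span (K \<inter> E) = {0}}"
    then have K: "vec.subspace K" "vec.span (K \<inter> E) = {0}" by auto
    have K0: "0 \<in> K" using K(1) by (rule vec.subspace_0)
    have below: "C = {0}" if "C \<in> spanned" "C \<subseteq> K" for C
      using spanned_subset_span[OF that] K(2) zero_in_spanned_elem[OF that(1)] by blast
    show "K \<in> interval {0} W \<union> transversal {0} UNIV"
    proof (cases "K \<in> spanned")
      case True
      then have "K = {0}" using below[OF True order.refl] by simp
      then show ?thesis using sub0 by (simp add: interval_def)
    next
      case False
      from not_spanned_cases[OF K(1) False] show ?thesis
      proof (elim disjE)
        assume "K \<subseteq> W \<and> K \<noteq> {0}"
        then show ?thesis using K(1) K0 by (simp add: interval_def)
      next
        assume KX: "K \<subseteq> X \<and> \<not> K \<subseteq> H"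
        have "K \<inter> H = {0}"
          by (rule below) (simp_all add: spanned_below_H[OF Int_subspace[OF K(1) H]])
        then show ?thesis using KX K(1) transversal_iff[OF sub0 zero_H, of K UNIV] by simp
      next
        assume "\<exists>q\<in>pairs UNIV. K = line q"
        then obtain q where q: "q \<in> pairs UNIV" "K = line q" by blast
        have "mid q \<subseteq> K" unfolding q by (auto simp: mid_def line_def)
        then have "mid q = {0}" using below[OF spanned_mid[OF q(1)]] by simp
        then show ?thesis using mid_neq_zero[OF q(1)] by simp
      qed
    qed
  next
    fix K assume K: "K \<in> interval {0} W \<union> transversal {0} UNIV"
    have "vec.subspace K \<and> K \<inter> E = {}"
    proof (cases "K \<in> interval {0} W")
      case True
      then show ?thesis by (auto simp: interval_def mem_E)
    next
      case False
      then have "K \<in> transversal {0} UNIV" using K by simp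
      then have K': "vec.subspace K" "K \<subseteq> X" "K \<inter> H = {0}"
        using transversal_iff[OF sub0 zero_H, of K UNIV] by simp_all
      have "K \<inter> E \<subseteq> K \<inter> H"
      proof
        fix v assume "v \<in> K \<inter> E"
        with K'(2) show "v \<in> K \<inter> H" using mem_E[of v] by blast
      qed
      then have "K \<inter> E \<subseteq> {0}" unfolding K'(3) .
      then show ?thesis using K'(1) zero_notin_E by blast
    qed
    then show "K \<in> {K. vec.subspace K \<and> vec.span (K \<inter> E) = {0}}" by simp
  qed
  moreover have "interval {0} W \<inter> transversal {0} UNIV = {}"
  proof (rule Int_emptyI)
    fix K assume "K \<in> interval {0} W" "K \<in> transversal {0} UNIV"
    then have "K \<subseteq> W \<inter> X" "\<not> K \<subseteq> H" by (simp_all add: transversal_def layer_def interval_def)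
    then show False unfolding WX using order.trans[OF _ zero_H] by simp
  qed
  ultimately have "kappa {0} = (\<Sum>K\<in>interval {0} W. pg_moebius (vec.dim K)) + (\<Sum>K\<in>transversal {0} UNIV. pg_moebius (vec.dim K))"
    unfolding kappa_def by (simp add: sum.union_disjoint)
  moreover have "(\<Sum>K\<in>transversal {0} UNIV. pg_moebius (vec.dim K)) = (\<Sum>K\<in>transversal {0} UNIV. pg_moebius 1)"
    by (intro sum.cong refl) (simp add: transversal_def layer_def)
  moreover have "(\<Sum>K\<in>interval {0} W. pg_moebius (vec.dim K)) = (\<Sum>j\<le>3. int (gauss 3 j) * pg_moebius j)"
    using sum_interval[OF sub0 W, of pg_moebius] by (simp add: dim_W)
  ultimately show ?thesis
    using card_transversal[OF sub0 zero_H] by simp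
qed

text \<open>All subspaces of \<open>H\<close> are spanned, so below \<open>D\<close> the flats form
  a full projective geometry.\<close>

lemma nu_below_H:
  assumes "vec.subspace D" "D \<subseteq> H"
  shows "nu D = (- 1) ^ vec.dim D * 2 ^ (vec.dim D * (vec.dim D - 1) div 2)"
  using assms
proof (induction "card D" arbitrary: D rule: less_induct)
  case less
  let ?f = "\<lambda>j. (- 1) ^ j * 2 ^ (j * (j - 1) div 2) :: int"
  have sub0: "vec.subspace {0 :: bit ^ 10}" by (rule vec.subspace_single_0)
  have D0: "{0} \<subseteq> D" using less.prems vec.subspace_0 by auto
  have IH: "nu K = ?f (vec.dim K)" if "K \<in> interval {0} D - {D}" for K
    using that less.prems by (intro less.hyps psubset_card_mono) (auto simp: interval_def)
  have D_in: "D \<in> interval {0} D" using less.prems D0 by (simp add: interval_def)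
  have below: "{A \<in> spanned. A \<subseteq> D} = interval {0} D"
  proof (intro equalityI subsetI)
    fix A assume "A \<in> {A \<in> spanned. A \<subseteq> D}"
    then show "A \<in> interval {0} D"
      using subspace_spanned[of A] zero_in_spanned_elem[of A] by (simp add: interval_def)
  next
    fix A assume "A \<in> interval {0} D"
    then have A: "vec.subspace A" "A \<subseteq> D" by (simp_all add: interval_def)
    then show "A \<in> {A \<in> spanned. A \<subseteq> D}"
      using spanned_below_H[OF A(1) order.trans[OF A(2) less.prems(2)]] by simp
  qed
  have "(\<Sum>K\<in>interval {0} D. nu K) = of_bool (D = {0})"
    using sum_nu[OF spanned_below_H[OF less.prems]] by (simp add: below)
  moreover have "(\<Sum>K\<in>interval {0} D. ?f (vec.dim K)) = of_bool (D = {0})"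
  proof -
    have "D = {0} \<longleftrightarrow> vec.dim D = 0" using D0 by auto
    then show ?thesis
      using sum_interval[OF sub0 less.prems(1) D0, of ?f] sum_gauss_moebius[OF dim_le_10, of D] by simp
  qed
  moreover have "(\<Sum>K\<in>interval {0} D - {D}. nu K) = (\<Sum>K\<in>interval {0} D - {D}. ?f (vec.dim K))"
    using IH by simp
  ultimately show ?case
    using sum.remove[OF _ D_in, of nu] sum.remove[OF _ D_in, of "\<lambda>K. ?f (vec.dim K)"] by simp
qed

lemma nu_mid:
  assumes "q \<in> pairs UNIV"
  shows "nu (mid q) = - 1"
proof -
  have "A \<in> spanned \<and> A \<subseteq> mid q \<longleftrightarrow> A = {0} \<or> A = mid q" for A
  proof
    assume "A \<in> spanned \<and> A \<subseteq> mid q"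
    then show "A = {0} \<or> A = mid q" using subset_mid zero_in_spanned_elem by metis
  next
    have "{0} \<subseteq> mid q" using zero_in_spanned_elem[OF spanned_mid[OF assms]] by simp
    moreover assume "A = {0} \<or> A = mid q"
    ultimately show "A \<in> spanned \<and> A \<subseteq> mid q" using spanned_mid[OF assms] spanned_zero by (metis order.refl)
  qed
  then have "{A \<in> spanned. A \<subseteq> mid q} = {{0}, mid q}" by (intro set_eqI) simp
  then have "nu {0} + nu (mid q) = 0"
    using sum_nu[OF spanned_mid[OF assms]] mid_neq_zero[OF assms] by simp
  then show ?thesis by (simp add: nu_def)
qed

lemma sum_codim_one:
  assumes A: "vec.subspace A" "A \<subseteq> H"
  shows "(\<Sum>B\<in>{B \<in> interval A UNIV. \<not> B \<subseteq> X}. of_bool (codim_one B) * pg_moebius (vec.dim B)) =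
    (\<Sum>j\<le>7 - vec.dim A. int (gauss (7 - vec.dim A) j) *
       ((2 ^ (10 - (vec.dim A + j)) - 2 ^ (7 - (vec.dim A + j))) * pg_moebius (vec.dim A + j + 1)))
    - (\<Sum>j\<le>6 - vec.dim A. int (gauss (6 - vec.dim A) j) *
       ((2 ^ (10 - (vec.dim A + j)) - 2 ^ (7 - (vec.dim A + j))) * pg_moebius (vec.dim A + j + 1)))"
proof -
  let ?S = "{B \<in> interval A UNIV. \<not> B \<subseteq> X \<and> codim_one B}"
  let ?T = "interval A X - interval A H"
  define h :: "nat \<Rightarrow> int" where "h y = (2 ^ (10 - y) - 2 ^ (7 - y)) * pg_moebius (y + 1)" for y
  have AX: "A \<subseteq> X" using A HX by simp
  have fiber: "(\<Sum>B\<in>{B \<in> ?S. B \<inter> X = Y}. pg_moebius (vec.dim B)) = h (vec.dim Y)" if Y: "Y \<in> ?T" for Y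
  proof -
    have Y': "vec.subspace Y" "Y \<subseteq> X" "A \<subseteq> Y" "\<not> Y \<subseteq> H" using Y by (auto simp: interval_def)
    \<comment> \<open>An extension of \<open>Y\<close> by one dimension that leaves \<open>X\<close>
      meets \<open>X\<close> in exactly \<open>Y\<close>, for dimension reasons.\<close>
    have "{B \<in> ?S. B \<inter> X = Y} = layer Y UNIV 1 - layer Y X 1"
    proof (intro equalityI subsetI)
      fix B assume "B \<in> {B \<in> ?S. B \<inter> X = Y}"
      then show "B \<in> layer Y UNIV 1 - layer Y X 1"
        by (auto simp: layer_def interval_def codim_one_def)
    next
      fix B assume B: "B \<in> layer Y UNIV 1 - layer Y X 1"
      then have B': "vec.subspace B" "Y \<subseteq> B" "vec.dim B = vec.dim Y + 1" "\<not> B \<subseteq> X"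
        by (auto simp: layer_def interval_def)
      have "vec.dim (B \<inter> X) \<le> vec.dim Y" using dim_Int_X_less[OF B'(1,4)] B'(3) by simp
      moreover have "Y \<subseteq> B \<inter> X" using B' Y' by simp
      ultimately have "Y = B \<inter> X"
        using vec.subspace_dim_equal[OF Y'(1) Int_subspace[OF B'(1) X]] by blast
      then show "B \<in> {B \<in> ?S. B \<inter> X = Y}"
        using B' Y' by (auto simp: interval_def codim_one_def)
    qed
    moreover have "card (layer Y UNIV 1 - layer Y X 1) = (2 ^ (10 - vec.dim Y) - 1) - (2 ^ (7 - vec.dim Y) - 1)"
    proof -
      have "layer Y X 1 \<subseteq> layer Y UNIV 1" by (auto simp: layer_def interval_def)
      then have "card (layer Y UNIV 1 - layer Y X 1) = card (layer Y UNIV 1) - card (layer Y X 1)"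
        by (simp add: card_Diff_subset)
      moreover have "card (layer Y UNIV 1) = 2 ^ (10 - vec.dim Y) - 1"
        using card_layer_1[OF Y'(1) vec.subspace_UNIV subset_UNIV] unfolding vec_dim_card by simp
      moreover have "card (layer Y X 1) = 2 ^ (7 - vec.dim Y) - 1"
        using card_layer_1[OF Y'(1) X Y'(2)] by (simp add: dim_X)
      ultimately show ?thesis by simp
    qed
    moreover have "(2::nat) ^ (7 - vec.dim Y) \<le> 2 ^ (10 - vec.dim Y)"
      by (intro power_increasing) auto
    moreover have "(\<Sum>B\<in>layer Y UNIV 1 - layer Y X 1. pg_moebius (vec.dim B)) =
        (\<Sum>B\<in>layer Y UNIV 1 - layer Y X 1. pg_moebius (vec.dim Y + 1))"
      by (intro sum.cong refl) (simp add: layer_def)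
    ultimately show ?thesis by (simp add: h_def of_nat_diff)
  qed
  have "(\<Sum>B\<in>{B \<in> interval A UNIV. \<not> B \<subseteq> X}. of_bool (codim_one B) * pg_moebius (vec.dim B)) =
      (\<Sum>B\<in>?S. pg_moebius (vec.dim B))"
    by (rule sum.mono_neutral_cong_right) auto
  also have "\<dots> = (\<Sum>Y\<in>?T. \<Sum>B\<in>{B \<in> ?S. B \<inter> X = Y}. pg_moebius (vec.dim B))"
  proof (rule sum.group[symmetric])
    show "(\<lambda>B. B \<inter> X) ` ?S \<subseteq> ?T"
      using AX Int_subspace[OF _ X] by (auto simp: interval_def codim_one_def)
  qed simp_all
  also have "\<dots> = (\<Sum>Y\<in>?T. h (vec.dim Y))"
    by (rule sum.cong[OF refl fiber])
  also have "\<dots> = (\<Sum>Y\<in>interval A X. h (vec.dim Y)) - (\<Sum>Y\<in>interval A H. h (vec.dim Y))"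
    using HX by (intro sum_diff) (auto simp: interval_def)
  finally show ?thesis
    using sum_interval[OF A(1) X AX, of h] sum_interval[OF A(1) H A(2), of h]
    by (simp add: dim_X dim_H h_def)
qed

lemma sum_pX:
  assumes A: "vec.subspace A" "A \<subseteq> H"
  shows "(\<Sum>B\<in>interval A UNIV \<inter> spanned. pX A B * pg_moebius (vec.dim B)) = X_sum (vec.dim A)"
proof -
  let ?T = "{B \<in> interval A UNIV. \<not> B \<subseteq> X}"
  let ?a = "vec.dim A"
  have "(\<Sum>B\<in>interval A UNIV \<inter> spanned. pX A B * pg_moebius (vec.dim B)) = (\<Sum>B\<in>?T. pX A B * pg_moebius (vec.dim B))"
  \<comment> \<open>\<open>pX\<close> vanishes where the index sets differ: a flat inside
    \<open>X\<close> lies in \<open>H\<close>, and a non-spanned \<open>B\<close> outside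
    \<open>X\<close> lies in \<open>W\<close> or has dimension 2.\<close>
  proof (rule sum.mono_neutral_cong)
    fix B assume "B \<in> ?T - interval A UNIV \<inter> spanned"
    then have B: "vec.subspace B" "A \<subseteq> B" "\<not> B \<subseteq> X" "B \<notin> spanned" by (auto simp: interval_def)
    have "pX A B = 0"
      using not_spanned_cases[OF B(1,4)]
    proof (elim disjE)
      assume "B \<subseteq> W \<and> B \<noteq> {0}"
      then have "B \<inter> X \<subseteq> {0}" using WX by blast
      then show ?thesis using zero_mem(3) by (intro pX_eq_0) auto
    next
      assume "\<exists>q\<in>pairs UNIV. B = line q"
      then have "vec.dim B = 2" using dim_line by blast
      then show ?thesis using A B by (intro pX_eq_0_small) auto
    qed (use B in simp)
    then show "pX A B * pg_moebius (vec.dim B) = 0" by simp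
  next
    fix B assume "B \<in> interval A UNIV \<inter> spanned - ?T"
    then have "B \<in> spanned" "B \<subseteq> X" by (auto simp: interval_def)
    then have "B \<inter> X \<subseteq> H" using spanned_subset_X by blast
    then show "pX A B * pg_moebius (vec.dim B) = 0" by (simp add: pX_eq_0)
  qed simp_all
  also have "\<dots> = (\<Sum>B\<in>?T. int (card (transversal A B)) * pg_moebius (vec.dim B)) -
      (\<Sum>B\<in>?T. of_bool (codim_one B) * pg_moebius (vec.dim B))"
    by (simp add: pX_def left_diff_distrib sum_subtractf)
  also have "(\<Sum>B\<in>?T. int (card (transversal A B)) * pg_moebius (vec.dim B)) =
      (\<Sum>B\<in>?T. \<Sum>K\<in>{K \<in> transversal A UNIV. K \<subseteq> B}. pg_moebius (vec.dim B))"
  proof (rule sum.cong[OF refl])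
    fix B
    have "{K \<in> transversal A UNIV. K \<subseteq> B} = transversal A B" by (auto simp: transversal_def layer_def interval_def)
    then show "int (card (transversal A B)) * pg_moebius (vec.dim B) = (\<Sum>K\<in>{K \<in> transversal A UNIV. K \<subseteq> B}. pg_moebius (vec.dim B))"
      by simp
  qed
  also have "\<dots> = (\<Sum>K\<in>transversal A UNIV. \<Sum>B\<in>{B \<in> ?T. K \<subseteq> B}. pg_moebius (vec.dim B))"
    by (rule sum.swap_restrict) simp_all
  \<comment> \<open>The Moebius values over all subspaces above \<open>K\<close> sum to 0, so those
    not inside \<open>X\<close> give minus the sum over those inside.\<close>
  also have "\<dots> = (\<Sum>K\<in>transversal A UNIV. - (\<Sum>j\<le>6 - ?a. int (gauss (6 - ?a) j) * pg_moebius (?a + 1 + j)))"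
  proof (rule sum.cong[OF refl])
    fix K assume K: "K \<in> transversal A UNIV"
    then have K': "vec.subspace K" "A \<subseteq> K" "K \<subseteq> X" "vec.dim K = ?a + 1"
      by (auto simp: transversal_def layer_def interval_def)
    have "{B \<in> ?T. K \<subseteq> B} = interval K UNIV - interval K X"
      using K' by (auto simp: interval_def)
    moreover have "(\<Sum>B\<in>interval K UNIV - interval K X. pg_moebius (vec.dim B)) =
        (\<Sum>B\<in>interval K UNIV. pg_moebius (vec.dim B)) - (\<Sum>B\<in>interval K X. pg_moebius (vec.dim B))"
      by (rule sum_diff) (auto simp: interval_def)
    moreover have "K \<noteq> UNIV"
    proof -
      have "vec.dim K \<noteq> 10" using vec.dim_subset[OF K'(3)] dim_X by simp
      then show ?thesis using dim_UNIV_10 by metis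
    qed
    ultimately show "(\<Sum>B\<in>{B \<in> ?T. K \<subseteq> B}. pg_moebius (vec.dim B)) =
        - (\<Sum>j\<le>6 - ?a. int (gauss (6 - ?a) j) * pg_moebius (?a + 1 + j))"
      using sum_pg_moebius[OF K'(1)] sum_interval[OF K'(1) X K'(3), of pg_moebius] by (simp add: dim_X K'(4))
  qed
  finally show ?thesis
    unfolding sum_codim_one[OF A] by (simp add: X_sum_def card_transversal[OF A])
qed

section \<open>Contributions of the flats \<open>mid q\<close>, of \<open>W\<close> and of the
  subspaces of \<open>H\<close>\<close>

lemma card_pairs: "card (pairs UNIV) = 448"
proof -
  have "card (W - {0}) = 7" "card (X - H) = 64"
    using HX by (simp_all add: card_Diff_subset card_subspace_bit W X H dim_W dim_X dim_H)
  then show ?thesis by (simp add: pairs_def)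
qed

lemma sum_monom_coeff: "(\<Sum>B\<in>S. monom (f B) k) = monom (\<Sum>B\<in>S. f B) k" for f :: "_ \<Rightarrow> int"
  by (induction S rule: infinite_finite_induct) (simp_all add: add_monom[symmetric])

text \<open>Only the \<open>B\<close> above \<open>line q\<close> of dimension at least 4
  contribute. They are counted from the 2-dimensional \<open>line q\<close>, whence the 8 and the
  condition \<open>2 \<le> j\<close>.\<close>

lemma R_mid:
  assumes q: "q \<in> pairs UNIV"
  shows "R (mid q) = monom (\<Sum>j\<le>8. int (gauss 8 j) * (if 2 \<le> j then pg_moebius (2 + j) else 0)) 1"
proof -
  let ?g = "\<lambda>n. if 4 \<le> n then pg_moebius n else 0"
  have "R (mid q) = (\<Sum>B\<in>interval (line q) UNIV. monom (?g (vec.dim B)) 1)"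
    unfolding R_def
  proof (rule sum.mono_neutral_cong)
    fix B assume B: "B \<in> interval (line q) UNIV - interval (mid q) UNIV \<inter> spanned"
    then have B': "vec.subspace B" "line q \<subseteq> B" "B \<notin> spanned"
      by (auto simp: interval_def mid_def line_def)
    have "mid q \<subseteq> line q" by (auto simp: mid_def line_def)
    then have "B \<in> interval (mid q) UNIV - spanned"
      using B' order.trans by (simp add: interval_def)
    then have "B = line q"
      unfolding not_spanned_above_mid[OF q spanned_UNIV] using q by simp
    then show "monom (?g (vec.dim B)) 1 = 0" using dim_line[OF q] by simp
  next
    fix B assume B: "B \<in> interval (mid q) UNIV \<inter> spanned - interval (line q) UNIV"
    then have "q \<notin> pairs B" using pairs_subset[of q B] subspace_spanned by (auto simp: interval_def)
    then show "smult (pg_moebius (vec.dim B)) (p (mid q) B) = 0" by (simp add: p_mid[OF q])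
  next
    fix B assume B: "B \<in> interval (mid q) UNIV \<inter> spanned \<inter> interval (line q) UNIV"
    then have "q \<in> pairs B" using line_subset_iff[OF q, of B] by (simp add: interval_def)
    then show "smult (pg_moebius (vec.dim B)) (p (mid q) B) = monom (?g (vec.dim B)) 1"
      by (simp add: p_mid[OF q] smult_monom)
  qed simp_all
  also have "\<dots> = monom (\<Sum>B\<in>interval (line q) UNIV. ?g (vec.dim B)) 1"
    by (rule sum_monom_coeff)
  also have "(\<Sum>B\<in>interval (line q) UNIV. ?g (vec.dim B)) = (\<Sum>j\<le>8. int (gauss 8 j) * ?g (2 + j))"
    using sum_interval_UNIV[OF subspace_line', of ?g q] unfolding dim_line[OF q] by simp
  also have "\<dots> = (\<Sum>j\<le>8. int (gauss 8 j) * (if 2 \<le> j then pg_moebius (2 + j) else 0))"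
    by (intro sum.cong refl) auto
  finally show ?thesis .
qed

text \<open>Each of the 448 subspaces \<open>line q\<close> lies in 2^8 - 1 = 255 subspaces of
  dimension 3, and all of these are spanned.\<close>

lemma sum_planes:
  "(\<Sum>B\<in>interval {0} UNIV \<inter> spanned. of_bool (vec.dim B = 3) * int (card (pairs B)) * pg_moebius (vec.dim B)) =
    448 * (255 * pg_moebius 3)"
proof -
  let ?S = "{B \<in> interval {0} UNIV \<inter> spanned. vec.dim B = 3}"
  have pairs_eq: "pairs B = {q \<in> pairs UNIV. line q \<subseteq> B}" if "vec.subspace B" for B
    using line_subset_iff[OF _ that] by (auto simp: pairs_def line_def)
  have "(\<Sum>B\<in>interval {0} UNIV \<inter> spanned. of_bool (vec.dim B = 3) * int (card (pairs B)) * pg_moebius (vec.dim B)) =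
      (\<Sum>B\<in>?S. int (card (pairs B)) * pg_moebius 3)"
    by (rule sum.mono_neutral_cong_right) auto
  also have "\<dots> = (\<Sum>B\<in>?S. \<Sum>q\<in>{q \<in> pairs UNIV. line q \<subseteq> B}. pg_moebius 3)"
    by (intro sum.cong refl) (simp add: interval_def flip: pairs_eq)
  also have "\<dots> = (\<Sum>q\<in>pairs UNIV. \<Sum>B\<in>{B \<in> ?S. line q \<subseteq> B}. pg_moebius 3)"
    by (rule sum.swap_restrict) simp_all
  also have "\<dots> = (\<Sum>q\<in>pairs UNIV. 255 * pg_moebius 3)"
  proof (rule sum.cong[OF refl])
    fix q assume q: "q \<in> pairs UNIV"
    have "B \<in> spanned" if B: "vec.subspace B" "line q \<subseteq> B" "vec.dim B = 3" for B
    proof (rule ccontr)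
      assume "B \<notin> spanned"
      from not_spanned_cases[OF B(1) this] show False
      proof (elim disjE bexE)
        fix q' assume "q' \<in> pairs UNIV" "B = line q'"
        then show False using dim_line B(3) by simp
      qed (use line_not_subset[OF q] B(2) order.trans in metis)+
    qed
    then have "{B \<in> ?S. line q \<subseteq> B} = layer (line q) UNIV 1"
      using dim_line[OF q] vec.subspace_0 by (auto simp: layer_def interval_def)
    moreover have "card (layer (line q) UNIV 1) = 255"
      using card_layer_1[OF subspace_line' vec.subspace_UNIV subset_UNIV, of q] dim_line[OF q]
      unfolding vec_dim_card by simp
    ultimately show "(\<Sum>B\<in>{B \<in> ?S. line q \<subseteq> B}. pg_moebius 3) = 255 * pg_moebius 3" by simp
  qed
  finally show ?thesis by (simp add: card_pairs)
qed

text \<open>The total weight of one \<open>k\<close>-dimensional subspace \<open>K\<close> of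
  \<open>W\<close>: the sum over all \<open>B\<close> above \<open>K\<close> minus that over the
  non-spanned \<open>B\<close> inside \<open>W\<close>. The value 0 at \<open>k = 0\<close> lets
  \<open>K\<close> range over all subspaces of \<open>W\<close>.\<close>

definition w_part :: "nat \<Rightarrow> int poly" where
  "w_part k = (if k = 0 then 0 else
     (\<Sum>j\<le>10 - k. of_nat (gauss (10 - k) j) * smult (pg_moebius (k + j)) (phi k (k + j)))
     - (\<Sum>j\<le>3 - k. of_nat (gauss (3 - k) j) * smult (pg_moebius (k + j)) (phi k (k + j))))"

lemma sum_W_part:
  "(\<Sum>B\<in>interval {0} UNIV \<inter> spanned. smult (pg_moebius (vec.dim B))
      (\<Sum>K\<in>interval {0} (W \<inter> B) - {{0}}. phi (vec.dim K) (vec.dim B))) =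
    (\<Sum>k\<le>3. of_nat (gauss 3 k) * w_part k)"
proof -
  let ?g = "\<lambda>k n. smult (pg_moebius n) (phi k n)"
  let ?U = "interval {0} W - {{0}}"
  have sub0: "vec.subspace {0 :: bit ^ 10}" by (rule vec.subspace_single_0)
  have "(\<Sum>B\<in>interval {0} UNIV \<inter> spanned. smult (pg_moebius (vec.dim B))
      (\<Sum>K\<in>interval {0} (W \<inter> B) - {{0}}. phi (vec.dim K) (vec.dim B))) =
      (\<Sum>B\<in>interval {0} UNIV \<inter> spanned. \<Sum>K\<in>{K \<in> ?U. K \<subseteq> B}. ?g (vec.dim K) (vec.dim B))"
  proof (rule sum.cong[OF refl])
    fix B
    have "{K \<in> ?U. K \<subseteq> B} = interval {0} (W \<inter> B) - {{0}}" by (auto simp: interval_def)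
    then show "smult (pg_moebius (vec.dim B)) (\<Sum>K\<in>interval {0} (W \<inter> B) - {{0}}. phi (vec.dim K) (vec.dim B)) =
        (\<Sum>K\<in>{K \<in> ?U. K \<subseteq> B}. ?g (vec.dim K) (vec.dim B))"
      by (simp only: smult_sum_right)
  qed
  also have "\<dots> = (\<Sum>K\<in>?U. \<Sum>B\<in>{B \<in> interval {0} UNIV \<inter> spanned. K \<subseteq> B}. ?g (vec.dim K) (vec.dim B))"
    by (rule sum.swap_restrict) simp_all
  also have "\<dots> = (\<Sum>K\<in>?U. w_part (vec.dim K))"
  proof (rule sum.cong[OF refl])
    fix K assume K: "K \<in> ?U"
    then have K': "vec.subspace K" "K \<subseteq> W" "0 \<in> K" "K \<noteq> {0}" by (auto simp: interval_def)
    have pos: "0 < vec.dim K" by (rule dim_pos[OF K])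
    have nX: "\<not> K \<subseteq> X" using K' WX by blast
    have "{B \<in> interval {0} UNIV \<inter> spanned. K \<subseteq> B} = interval K UNIV \<inter> spanned"
      using K'(3) by (auto simp: interval_def)
    then have "(\<Sum>B\<in>{B \<in> interval {0} UNIV \<inter> spanned. K \<subseteq> B}. ?g (vec.dim K) (vec.dim B)) =
        (\<Sum>B\<in>interval K UNIV. ?g (vec.dim K) (vec.dim B)) - (\<Sum>B\<in>interval K UNIV - spanned. ?g (vec.dim K) (vec.dim B))"
      by (simp add: sum_spanned_interval)
    also have "(\<Sum>B\<in>interval K UNIV - spanned. ?g (vec.dim K) (vec.dim B)) = (\<Sum>B\<in>interval K W. ?g (vec.dim K) (vec.dim B))"
    proof (rule sum.mono_neutral_right)
      show "interval K W \<subseteq> interval K UNIV - spanned"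
        using K' spanned_subset_W by (auto simp: interval_def)
      show "\<forall>B\<in>interval K UNIV - spanned - interval K W. ?g (vec.dim K) (vec.dim B) = 0"
      proof
        fix B assume B: "B \<in> interval K UNIV - spanned - interval K W"
        then have B': "vec.subspace B" "K \<subseteq> B" "B \<notin> spanned" "\<not> B \<subseteq> W" by (auto simp: interval_def)
        have "\<not> B \<subseteq> X" using nX B'(2) by blast
        then obtain q where q: "q \<in> pairs UNIV" "B = line q"
          using not_spanned_cases[OF B'(1,3)] B'(4) by blast
        have "K \<subset> B" using B' K' by blast
        then have "vec.dim K < vec.dim B"
          using vec.dim_psubset[of K B] K'(1) B'(1) by (metis vec.span_eq_iff)
        \<comment> \<open>A \<open>line q\<close> above \<open>K\<close> is non-spanned as well, but
          its weight is \<open>phi 1 2 = 0\<close>.\<close>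
        then have "vec.dim K = 1" "vec.dim B = 2" using pos dim_line[OF q(1)] q(2) by auto
        then show "?g (vec.dim K) (vec.dim B) = 0" by (simp add: phi_def)
      qed
    qed simp
    also have "(\<Sum>B\<in>interval K UNIV. ?g (vec.dim K) (vec.dim B)) - (\<Sum>B\<in>interval K W. ?g (vec.dim K) (vec.dim B)) =
        w_part (vec.dim K)"
      unfolding w_part_def sum_interval_UNIV[OF K'(1), of "?g (vec.dim K)"]
        sum_interval[OF K'(1) W K'(2), of "?g (vec.dim K)"] dim_W
      by (rule if_not_P[symmetric]) (use pos in linarith)
    finally show "(\<Sum>B\<in>{B \<in> interval {0} UNIV \<inter> spanned. K \<subseteq> B}. ?g (vec.dim K) (vec.dim B)) = w_part (vec.dim K)" .
  qed
  also have "\<dots> = (\<Sum>K\<in>interval {0} W. w_part (vec.dim K))"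
    by (rule sum.mono_neutral_left) (auto simp: w_part_def)
  also have "\<dots> = (\<Sum>k\<le>3. of_nat (gauss 3 k) * w_part k)"
    using sum_interval[OF sub0 W, of w_part] by (simp add: dim_W)
  finally show ?thesis .
qed

lemma R_below_H:
  assumes D: "vec.subspace D" "D \<subseteq> H"
  shows "R D = monom (X_sum (vec.dim D)) 1 + (if D = {0} then
    (\<Sum>k\<le>3. of_nat (gauss 3 k) * w_part k) - monom (448 * (255 * pg_moebius 3)) 1 else 0)"
proof -
  have X_part: "(\<Sum>B\<in>interval D UNIV \<inter> spanned. monom (pX D B * pg_moebius (vec.dim B)) 1) = monom (X_sum (vec.dim D)) 1"
    unfolding sum_monom_coeff sum_pX[OF D] ..
  show ?thesis
  proof (cases "D = {0}")
    case False
    have "R D = (\<Sum>B\<in>interval D UNIV \<inter> spanned. monom (pX D B * pg_moebius (vec.dim B)) 1)"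
      unfolding R_def by (intro sum.cong refl) (simp add: p_below_H D False smult_monom mult.commute)
    then show ?thesis using X_part False by simp
  next
    case True
    have "R D = (\<Sum>B\<in>interval {0} UNIV \<inter> spanned. monom (pX {0} B * pg_moebius (vec.dim B)) 1
        - monom (of_bool (vec.dim B = 3) * int (card (pairs B)) * pg_moebius (vec.dim B)) 1
        + smult (pg_moebius (vec.dim B)) (\<Sum>K\<in>interval {0} (W \<inter> B) - {{0}}. phi (vec.dim K) (vec.dim B)))"
      unfolding R_def True
      by (intro sum.cong refl)
         (simp add: p_def smult_add_right smult_monom diff_monom left_diff_distrib right_diff_distrib mult_ac)
    then show ?thesis
      using X_part True
      by (simp only: sum.distrib sum_subtractf sum_W_part sum_monom_coeff sum_planes) simp
  qed
qed

lemma R_nonspecial: "A \<in> spanned \<Longrightarrow> \<not> special A \<Longrightarrow> R A = 0"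
  by (simp add: R_def p_nonspecial)

text \<open>\<open>R\<close> vanishes off the special flats. What remains are the subspaces of
  \<open>H\<close>, with extra terms at \<open>{0}\<close>, and the 448 atoms \<open>mid q\<close>,
  where \<open>nu\<close> is -1.\<close>

lemma sum_nu_R:
  "(\<Sum>A\<in>spanned. smult (nu A) (R A)) =
    monom (\<Sum>j\<le>6. int (gauss 6 j) * ((- 1) ^ j * 2 ^ (j * (j - 1) div 2) * X_sum j)) 1
    + (\<Sum>k\<le>3. of_nat (gauss 3 k) * w_part k) - monom (448 * (255 * pg_moebius 3)) 1
    - monom (448 * (\<Sum>j\<le>8. int (gauss 8 j) * (if 2 \<le> j then pg_moebius (2 + j) else 0))) 1"
proof -
  let ?s = "\<lambda>j. (- 1) ^ j * 2 ^ (j * (j - 1) div 2) * X_sum j"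
  let ?Z = "(\<Sum>k\<le>3. of_nat (gauss 3 k) * w_part k) - monom (448 * (255 * pg_moebius 3)) 1"
  have sub0: "vec.subspace {0 :: bit ^ 10}" by (rule vec.subspace_single_0)
  have all: "spanned = interval {0} UNIV \<inter> spanned"
    using subspace_spanned zero_in_spanned_elem by (auto simp: interval_def)
  have "(\<Sum>A\<in>spanned. smult (nu A) (R A)) = (\<Sum>A\<in>interval {0} UNIV \<inter> spanned. smult (nu A) (R A))"
    using all by simp
  also have "\<dots> = (\<Sum>D\<in>interval {0} (UNIV \<inter> H). smult (nu D) (R D)) + (\<Sum>q\<in>pairs UNIV. smult (nu (mid q)) (R (mid q)))"
    by (rule sum_zero_interval_spanned[OF spanned_UNIV]) (simp add: R_nonspecial special_def)
  also have "(\<Sum>q\<in>pairs UNIV. smult (nu (mid q)) (R (mid q))) =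
      - monom (448 * (\<Sum>j\<le>8. int (gauss 8 j) * (if 2 \<le> j then pg_moebius (2 + j) else 0))) 1"
    by (simp only: nu_mid R_mid sum_constant card_pairs cong: sum.cong)
       (simp add: of_nat_poly smult_monom minus_monom)
  also have "(\<Sum>D\<in>interval {0} (UNIV \<inter> H). smult (nu D) (R D)) =
      (\<Sum>D\<in>interval {0} H. monom (?s (vec.dim D)) 1 + (if D = {0} then ?Z else 0))"
  proof (rule sum.cong)
    fix D assume "D \<in> interval {0} H"
    then have D: "vec.subspace D" "D \<subseteq> H" by (auto simp: interval_def)
    show "smult (nu D) (R D) = monom (?s (vec.dim D)) 1 + (if D = {0} then ?Z else 0)"
      using nu_below_H[OF D] R_below_H[OF D] by (auto simp: smult_add_right smult_monom)
  qed simp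
  also have "\<dots> = monom (\<Sum>D\<in>interval {0} H. ?s (vec.dim D)) 1 + ?Z"
    using sub0 H vec.subspace_0 by (simp add: sum.distrib sum_monom_coeff interval_def)
  also have "(\<Sum>D\<in>interval {0} H. ?s (vec.dim D)) = (\<Sum>j\<le>6. int (gauss 6 j) * ?s j)"
    using sum_interval[OF sub0 H, of ?s] by (simp add: dim_H)
  finally show ?thesis by (simp only: diff_conv_add_uminus add.assoc)
qed

end

section \<open>Numerical values\<close>

lemma monom_small:
  "monom (c::int) 0 = [:c:]" "monom c 1 = [:0, c:]" "monom c (Suc 0) = [:0, c:]"
  "monom c 2 = [:0, 0, c:]" "monom c 3 = [:0, 0, 0, c:]"
  by (simp_all add: monom_0 monom_Suc numeral_2_eq_2 numeral_3_eq_3)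

context deleted_geometry begin

lemma X_value:
  "(\<Sum>j\<le>6. int (gauss 6 j) * ((- 1) ^ j * 2 ^ (j * (j - 1) div 2) * X_sum j)) = - 3839700762624"
  by (simp add: sum_atMost_numeral X_sum_def pg_moebius_def)

lemma mid_value:
  "448 * (\<Sum>j\<le>8. int (gauss 8 j) * (if 2 \<le> j then pg_moebius (2 + j) else 0)) = 119319560192"
  by (simp add: sum_atMost_numeral pg_moebius_def)

lemma plane_value: "448 * (255 * pg_moebius 3) = - 239578644480"
  by (simp add: pg_moebius_def)

text \<open>These are the only corrections of degree above 1; the cubic term comes from
  \<open>W\<close> itself, where \<open>phi 3 n\<close> is t^3 for n \<ge> 7.\<close>

lemma w_part_values:
  "w_part 0 = 0" "w_part 1 = [:0, - 68448944128:]" "w_part 2 = [:0, 532676608, - 87392256:]" "w_part 3 = [:0, - 4161536, 2731008, - 89280:]"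
  by (simp_all add: w_part_def sum_atMost_numeral pg_moebius_def phi_def monom_small numeral_poly)

lemma kappa_value: "kappa {0} = 30307166191616"
  by (simp add: kappa_zero sum_atMost_numeral pg_moebius_def)

lemma Q_value: "Q {0} = [:30307166191616, 4194859712512, 609014784, 89280:]"
proof -
  have "(\<Sum>k\<le>3. of_nat (gauss 3 k) * w_part k) = w_part 0 + 7 * w_part 1 + 7 * w_part 2 + w_part 3"
    by (simp add: sum_atMost_numeral)
  then show ?thesis
    unfolding Q_zero sum_nu_R X_value mid_value plane_value kappa_value w_part_values
    by (simp add: monom_small numeral_poly)
qed

section \<open>The ground set and its coordinates\<close>

lemma card_E: "card E = 952"
proof -
  have eq: "E = UNIV - (W \<union> (X - H))" by (auto simp: E_def)
  have "W \<inter> (X - H) = {}"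
  proof (rule Int_emptyI)
    fix v assume "v \<in> W" "v \<in> X - H"
    moreover from this have "v = 0" using WX_eq_0 by simp
    ultimately show False by simp
  qed
  then have "card (W \<union> (X - H)) = card W + card (X - H)"
    by (intro card_Un_disjoint) simp_all
  also have "\<dots> = 8 + 64"
    using HX by (simp add: card_Diff_subset card_subspace_bit W X H dim_W dim_X dim_H)
  finally have "card (W \<union> (X - H)) = 72" by simp
  moreover have "card (UNIV :: (bit ^ 10) set) = 1024"
    using card_subspace_bit[OF vec.subspace_UNIV, where ?'n = 10] unfolding dim_UNIV_10 by simp
  ultimately show ?thesis unfolding eq by (simp add: card_Diff_subset)
qed

end

text \<open>In the index type 10 equals 0, so 1, ..., 10 is still a full set of residues.\<close>

lemma inj_on_of_nat_10: "inj_on (of_nat :: nat \<Rightarrow> 10) {1..10}"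
proof -
  have "{1..10::nat} = {1, 2, 3, 4, 5, 6, 7, 8, 9, 10}"
    by (simp add: atLeastAtMost_insertL[symmetric] numeral_eq_Suc atLeastAtMostSuc_conv insert_commute)
  then show ?thesis by (simp add: inj_on_def)
qed

lemma dim_span_std_vec:
  assumes "I \<subseteq> {1..10}"
  shows "vec.dim (vec.span (std_vec ` I)) = card I"
proof -
  have inj: "inj_on std_vec I"
    using inj_on_subset[OF inj_on_of_nat_10 assms] by (auto simp: inj_on_def std_vec_def axis_eq_axis)
  have "vec.independent (std_vec ` I)"
    by (rule vec.independent_mono[OF independent_cart_basis]) (auto simp: std_vec_def cart_basis_def)
  then show ?thesis
    by (simp add: vec.dim_span_eq_card_independent card_image[OF inj] del: vec.dim_span)
qed

lemma span_std_vec_component: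
  assumes "x \<in> vec.span (std_vec ` I)" "k \<notin> of_nat ` I"
  shows "x $ k = 0"
proof -
  have "vec.subspace {x :: bit ^ 10. x $ k = 0}" by (simp add: vec.subspace_def)
  moreover have "std_vec ` I \<subseteq> {x. x $ k = 0}"
    using assms(2) by (auto simp: std_vec_def axis_def)
  ultimately show ?thesis using vec.span_minimal assms(1) by blast
qed

lemma deleted_geometry_std:
  "deleted_geometry (vec.span {std_vec 1, std_vec 2, std_vec 3}) (vec.span (std_vec ` {4..10}))
    (vec.span (std_vec ` {4..9}))"
proof -
  have W_eq: "{std_vec 1, std_vec 2, std_vec 3} = std_vec ` {1, 2, 3}" by simp
  have "x = 0" if x: "x \<in> vec.span (std_vec ` {1, 2, 3})" "x \<in> vec.span (std_vec ` {4..10})" for x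
  proof -
    \<comment> \<open>The index sets stay disjoint after reduction modulo 10, so every coordinate of
      \<open>x\<close> is killed by one of the two spans.\<close>
    have "of_nat ` {1, 2, 3} \<inter> of_nat ` {4..10} = ({} :: 10 set)"
      using inj_on_image_Int[OF inj_on_of_nat_10, of "{1, 2, 3}" "{4..10}"] by simp
    then have "x $ k = 0" for k
      using span_std_vec_component[OF x(1), of k] span_std_vec_component[OF x(2), of k] by blast
    then show ?thesis by (simp add: vec_eq_iff)
  qed
  then show ?thesis
    unfolding deleted_geometry_def W_eq
    using dim_span_std_vec[of "{1, 2, 3}"] dim_span_std_vec[of "{4..10}"] dim_span_std_vec[of "{4..9}"]
    by (auto simp: vec.span_zero simp del: vec.dim_span intro!: vec.span_mono)
qed

theorem proposition3p3:
  fixes W X H E :: "(bit ^ 10) set" and M :: "(bit ^ 10) matroid"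
  assumes "W = vec.span {std_vec 1, std_vec 2, std_vec 3}"
    and "X = vec.span (std_vec ` {4..10})"
    and "H = vec.span (std_vec ` {4..9})"
    and "E = (UNIV - {0}) - ((W - {0}) \<union> (X - H))"
    and "M = binary_matroid E"
  shows "simple M \<and> mrank M = 10 \<and> card (ground M) = 952 \<and>
    inv_KL_poly M = [:30307166191616, 4194859712512, 609014784, 89280:] \<and>
    Delta2 M = -3618068002504704 \<and> Delta2 M < 0"
proof -
  interpret geo: deleted_geometry W X H
    unfolding assms(1-3) by (rule deleted_geometry_std)
  have E: "E = geo.E" by (simp add: assms(4) geo.E_def)
  have Q: "inv_KL_poly M = [:30307166191616, 4194859712512, 609014784, 89280:]"
    using geo.inv_KL_eq_Q geo.Q_value by (simp add: assms(5) E)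
  moreover have "Delta2 M = -3618068002504704"
    by (simp add: Delta2_def Q numeral_2_eq_2 numeral_3_eq_3)
  moreover have "simple M" using simple_binary[OF geo.zero_notin_E] by (simp add: assms(5) E)
  moreover have "mrank M = 10" using geo.mrank_M by (simp add: assms(5) E)
  moreover have "card (ground M) = 952" using geo.card_E by (simp add: assms(5) E ground_binary)
  ultimately show ?thesis by simp
qed

end
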